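(* Let $(\Lambda,d)$ be an aperiodic finitely aligned $k$-graph, let $C^*_{\min}(\Lambda)\subset\mathcal{B}(\ell^2(\partial\Lambda^{\mathrm{ap}}))$ be the $C^*$-algebra generated by $\{S^{\mathrm{ap}}_\lambda:\lambda\in\Lambda\}$, and let $P^{\mathrm{ap}}_\lambda:=S^{\mathrm{ap}}_\lambda(S^{\mathrm{ap}}_\lambda)^*$. Let $\Phi_{S^{\mathrm{ap}}}:C^*_{\min}(\Lambda)\to\overline{\operatorname{span}}\{P^{\mathrm{ap}}_\lambda:\lambda\in\Lambda\}$ be the conditional expectation satisfying $\Phi_{S^{\mathrm{ap}}}(S^{\mathrm{ap}}_\mu(S^{\mathrm{ap}}_\nu)^* )=\delta_{\mu,\nu}P^{\mathrm{ap}}_\mu$ for all $\mu,\nu\in\Lambda$ with $s(\mu)=s(\nu)$. Then $\Phi_{S^{\mathrm{ap}}}$ is faithful on positive elements: if $a\in C^*_{\min}(\Lambda)$ is positive and $\Phi_{S^{\mathrm{ap}}}(a)=0$, then $a=0$.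
   Context: $\mathbb{N}=\{0,1,2,\dots\}$; $\mathbb{N}^k$ is ordered coordinatewise and $m\vee n$ denotes the coordinatewise maximum. A $k$-graph $(\Lambda,d)$ is a countable small category $\Lambda$ with a functor $d:\Lambda\to\mathbb{N}^k$ satisfying the factorization property: whenever $d(\lambda)=m+n$ there are unique $\mu,\nu\in\Lambda$ with $\lambda=\mu\nu$, $d(\mu)=m$, $d(\nu)=n$. Write $\Lambda^n=d^{-1}(n)$; objects are identified with $\Lambda^0$, and $r,s:\Lambda\to\Lambda^0$ are the codomain and domain maps; $v\Lambda=r^{-1}(v)$, $\Lambda v=s^{-1}(v)$. For $\mu,\nu\in\Lambda$, $\mathrm{MCE}(\mu,\nu)$ is the set of $\lambda\in\Lambda$ with $d(\lambda)=d(\mu)\vee d(\nu)$ and $\lambda=\mu\mu'=\nu\nu'$ for some $\mu',\nu'\in\Lambda$. $\Lambda$ is finitely aligned if every $\mathrm{MCE}(\mu,\nu)$ is finite (possibly empty). $\Lambda$ is aperiodic if for all distinct $\mu,\nu\in\Lambda$ with $s(\mu)=s(\nu)$ there is $\tau\in s(\mu)\Lambda$ with $\mathrm{MCE}(\mu\tau,\nu\tau)=\emptyset$. A set $E\subset v\Lambda$ is exhaustive if for every $\mu\in v\Lambda$ there is $\lambda\in E$ with $\mathrm{MCE}(\mu,\lambda)\neq\emptyset$; $v\mathrm{FE}(\Lambda)$ denotes the set of finite exhaustive subsets of $v\Lambda$. For $m\in(\mathbb{N}\cup\{\infty\})^k$, $\Omega_{k,m}$ is the $k$-graph with objects $\{p\in\mathbb{N}^k:p\le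 m\}$, morphisms $\{(p,q):p\le q\}$ between such objects, $r(p,q)=p$, $s(p,q)=q$, $d(p,q)=q-p$. For a degree-preserving functor $x:\Omega_{k,m}\to\Lambda$ write $d(x)=m$, $x(n)$ for the vertex $x(n,n)$, $r(x)=x(0)$. For $n\in\mathbb{N}^k$, $n\le d(x)$, $\sigma^n(x):\Omega_{k,m-n}\to\Lambda$ is $\sigma^n(x)(p,q)=x(n+p,n+q)$; for $\lambda\in\Lambda r(x)$, $\lambda x:\Omega_{k,m+d(\lambda)}\to\Lambda$ is the unique degree-preserving functor with $(\lambda x)(0,d(\lambda))=\lambda$ and $\sigma^{d(\lambda)}(\lambda x)=x$. Such an $x$ is a boundary path if for all $n\in\mathbb{N}^k$ with $n\le d(x)$ and all $E\in x(n)\mathrm{FE}(\Lambda)$ there is $p\in\mathbb{N}^k$ with $p\le d(x)-n$ and $x(n,n+p)\in E$. $\partial\Lambda$ is the set of boundary paths, and $\partial\Lambda^{\mathrm{ap}}$ is the set of $x\in\partial\Lambda$ such that $\sigma^m(x)\ne\sigma^n(x)$ for all distinct $m,n\in\mathbb{N}^k$ with $m,n\le d(x)$. Let $\{\xi_x\}$ be the canonical basis of $\ell^2(\partial\Lambda^{\mathrm{ap}})$. $S^{\mathrm{ap}}_\lambda$ is the bounded operator with $S^{\mathrm{ap}}_\lambda\xi_x=\xi_{\lambda x}$ if $s(\lambda)=r(x)$ and $S^{\mathrm{ap}}_\lambda\xi_x=0$ otherwise (prepending $\lambda$ preserves $\partial\Lambda^{\mathrm{ap}}$). The linear span of the elements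 $S^{\mathrm{ap}}_\mu(S^{\mathrm{ap}}_\nu)^*$ with $s(\mu)=s(\nu)$ is dense in $C^*_{\min}(\Lambda)$, so $\Phi_{S^{\mathrm{ap}}}$ is uniquely determined by the stated formula; $\delta_{\mu,\nu}$ is the Kronecker delta. *)

theory Defs
  imports
    "HOL-Analysis.Analysis"
    "HOL-Library.Function_Algebras"
    "HOL-Library.Extended_Nat"
begin

section \<open>Higher-rank graphs\<close>

text \<open>
  \<open>\<nat>\<^sup>k\<close> is the set of \<open>n :: nat \<Rightarrow> nat\<close> vanishing at all indices \<open>i \<ge> k\<close>, and similarly for
  \<open>(\<nat> \<union> {\<infinity>})\<^sup>k\<close>.  On these functions \<open>\<le>\<close>, \<open>sup\<close>, \<open>+\<close>, \<open>-\<close> and \<open>0\<close> are the pointwise library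
  operations, so \<open>sup m n\<close> is the coordinatewise maximum.
\<close>

definition Nk :: "nat \<Rightarrow> (nat \<Rightarrow> nat) set" where
  "Nk k = {n. \<forall>i\<ge>k. n i = 0}"

definition Nk_inf :: "nat \<Rightarrow> (nat \<Rightarrow> enat) set" where
  "Nk_inf k = {m. \<forall>i\<ge>k. m i = 0}"

abbreviation enatv :: "(nat \<Rightarrow> nat) \<Rightarrow> nat \<Rightarrow> enat" where
  "enatv n \<equiv> (\<lambda>i. enat (n i))"

text \<open>
  Small categories are given by their morphisms alone; an object is identified with its identity
  morphism.  \<open>cat_comp \<Lambda> \<mu> \<nu>\<close> is the composite \<open>\<mu>\<nu>\<close>, which is meaningful only if \<open>src \<Lambda> \<mu> = rng \<Lambda> \<nu>\<close>.
\<close>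

record 'a graded_category =
  Mor :: "'a set"
  rng :: "'a \<Rightarrow> 'a"
  src :: "'a \<Rightarrow> 'a"
  cat_comp :: "'a \<Rightarrow> 'a \<Rightarrow> 'a"
  deg :: "'a \<Rightarrow> nat \<Rightarrow> nat"

definition is_category :: "'a graded_category \<Rightarrow> bool" where
  "is_category \<Lambda> \<longleftrightarrow>
     (\<forall>\<eta>\<in>Mor \<Lambda>. rng \<Lambda> \<eta> \<in> Mor \<Lambda> \<and> src \<Lambda> \<eta> \<in> Mor \<Lambda> \<and>
        rng \<Lambda> (rng \<Lambda> \<eta>) = rng \<Lambda> \<eta> \<and> src \<Lambda> (rng \<Lambda> \<eta>) = rng \<Lambda> \<eta> \<and>
        rng \<Lambda> (src \<Lambda> \<eta>) = src \<Lambda> \<eta> \<and> src \<Lambda> (src \<Lambda> \<eta>) = src \<Lambda> \<eta> \<and>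
        cat_comp \<Lambda> (rng \<Lambda> \<eta>) \<eta> = \<eta> \<and> cat_comp \<Lambda> \<eta> (src \<Lambda> \<eta>) = \<eta>) \<and>
     (\<forall>\<mu>\<in>Mor \<Lambda>. \<forall>\<nu>\<in>Mor \<Lambda>. src \<Lambda> \<mu> = rng \<Lambda> \<nu> \<longrightarrow>
        cat_comp \<Lambda> \<mu> \<nu> \<in> Mor \<Lambda> \<and> rng \<Lambda> (cat_comp \<Lambda> \<mu> \<nu>) = rng \<Lambda> \<mu> \<and> src \<Lambda> (cat_comp \<Lambda> \<mu> \<nu>) = src \<Lambda> \<nu>) \<and>
     (\<forall>\<eta>\<in>Mor \<Lambda>. \<forall>\<mu>\<in>Mor \<Lambda>. \<forall>\<nu>\<in>Mor \<Lambda>. src \<Lambda> \<eta> = rng \<Lambda> \<mu> \<and> src \<Lambda> \<mu> = rng \<Lambda> \<nu> \<longrightarrow>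
        cat_comp \<Lambda> (cat_comp \<Lambda> \<eta> \<mu>) \<nu> = cat_comp \<Lambda> \<eta> (cat_comp \<Lambda> \<mu> \<nu>))"

definition kgraph :: "nat \<Rightarrow> 'a graded_category \<Rightarrow> bool" where
  "kgraph k \<Lambda> \<longleftrightarrow>
     is_category \<Lambda> \<and> countable (Mor \<Lambda>) \<and>
     (\<forall>\<eta>\<in>Mor \<Lambda>. deg \<Lambda> \<eta> \<in> Nk k \<and> deg \<Lambda> (rng \<Lambda> \<eta>) = 0 \<and> deg \<Lambda> (src \<Lambda> \<eta>) = 0) \<and>
     (\<forall>\<mu>\<in>Mor \<Lambda>. \<forall>\<nu>\<in>Mor \<Lambda>. src \<Lambda> \<mu> = rng \<Lambda> \<nu> \<longrightarrow>
        deg \<Lambda> (cat_comp \<Lambda> \<mu> \<nu>) = deg \<Lambda> \<mu> + deg \<Lambda> \<nu>) \<and>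
     (\<forall>\<eta>\<in>Mor \<Lambda>. \<forall>m\<in>Nk k. \<forall>n\<in>Nk k. deg \<Lambda> \<eta> = m + n \<longrightarrow>
        (\<exists>!(\<mu>, \<nu>). \<mu> \<in> Mor \<Lambda> \<and> \<nu> \<in> Mor \<Lambda> \<and> src \<Lambda> \<mu> = rng \<Lambda> \<nu> \<and>
           \<eta> = cat_comp \<Lambda> \<mu> \<nu> \<and> deg \<Lambda> \<mu> = m \<and> deg \<Lambda> \<nu> = n))"

definition paths_from :: "'a graded_category \<Rightarrow> 'a \<Rightarrow> 'a set" where
  "paths_from \<Lambda> v = {\<eta>\<in>Mor \<Lambda>. rng \<Lambda> \<eta> = v}"

definition MCE :: "'a graded_category \<Rightarrow> 'a \<Rightarrow> 'a \<Rightarrow> 'a set" where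
  "MCE \<Lambda> \<mu> \<nu> = {\<eta>\<in>Mor \<Lambda>. deg \<Lambda> \<eta> = sup (deg \<Lambda> \<mu>) (deg \<Lambda> \<nu>) \<and>
     (\<exists>\<mu>'\<in>Mor \<Lambda>. src \<Lambda> \<mu> = rng \<Lambda> \<mu>' \<and> \<eta> = cat_comp \<Lambda> \<mu> \<mu>') \<and>
     (\<exists>\<nu>'\<in>Mor \<Lambda>. src \<Lambda> \<nu> = rng \<Lambda> \<nu>' \<and> \<eta> = cat_comp \<Lambda> \<nu> \<nu>')}"

definition finitely_aligned :: "'a graded_category \<Rightarrow> bool" where
  "finitely_aligned \<Lambda> \<longleftrightarrow> (\<forall>\<mu>\<in>Mor \<Lambda>. \<forall>\<nu>\<in>Mor \<Lambda>. finite (MCE \<Lambda> \<mu> \<nu>))"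

definition aperiodic :: "'a graded_category \<Rightarrow> bool" where
  "aperiodic \<Lambda> \<longleftrightarrow> (\<forall>\<mu>\<in>Mor \<Lambda>. \<forall>\<nu>\<in>Mor \<Lambda>. \<mu> \<noteq> \<nu> \<and> src \<Lambda> \<mu> = src \<Lambda> \<nu> \<longrightarrow>
     (\<exists>\<tau>\<in>paths_from \<Lambda> (src \<Lambda> \<mu>). MCE \<Lambda> (cat_comp \<Lambda> \<mu> \<tau>) (cat_comp \<Lambda> \<nu> \<tau>) = {}))"

definition exhaustive :: "'a graded_category \<Rightarrow> 'a \<Rightarrow> 'a set \<Rightarrow> bool" where
  "exhaustive \<Lambda> v E \<longleftrightarrow>
     E \<subseteq> paths_from \<Lambda> v \<and> (\<forall>\<mu>\<in>paths_from \<Lambda> v. \<exists>\<eta>\<in>E. MCE \<Lambda> \<mu> \<eta> \<noteq> {})"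

definition FE :: "'a graded_category \<Rightarrow> 'a \<Rightarrow> 'a set set" where
  "FE \<Lambda> v = {E. finite E \<and> exhaustive \<Lambda> v E}"


section \<open>Boundary paths\<close>

text \<open>The object \<open>p\<close> of \<open>\<Omega>\<^bsub>k,m\<^esub>\<close> is identified with its identity morphism \<open>(p, p)\<close>.\<close>

definition Omega :: "nat \<Rightarrow> (nat \<Rightarrow> enat) \<Rightarrow> ((nat \<Rightarrow> nat) \<times> (nat \<Rightarrow> nat)) graded_category" where
  "Omega k m =
     \<lparr>Mor = {(p, q). p \<in> Nk k \<and> q \<in> Nk k \<and> p \<le> q \<and> enatv q \<le> m},
      rng = (\<lambda>(p, q). (p, p)),
      src = (\<lambda>(p, q). (q, q)),
      cat_comp = (\<lambda>(p, _) (_, q). (p, q)),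
      deg = (\<lambda>(p, q). q - p)\<rparr>"

text \<open>
  Functors take the value \<open>undefined\<close> outside the morphisms of their domain, so that equality of
  HOL functions is equality of functors.
\<close>

definition graded_functor ::
    "'b graded_category \<Rightarrow> 'a graded_category \<Rightarrow> ('b \<Rightarrow> 'a) \<Rightarrow> bool" where
  "graded_functor \<Gamma> \<Lambda> F \<longleftrightarrow>
     F \<in> Mor \<Gamma> \<rightarrow>\<^sub>E Mor \<Lambda> \<and>
     (\<forall>a\<in>Mor \<Gamma>. F (rng \<Gamma> a) = rng \<Lambda> (F a) \<and> F (src \<Gamma> a) = src \<Lambda> (F a) \<and>
        deg \<Lambda> (F a) = deg \<Gamma> a) \<and>
     (\<forall>a\<in>Mor \<Gamma>. \<forall>b\<in>Mor \<Gamma>. src \<Gamma> a = rng \<Gamma> b \<longrightarrow> F (cat_comp \<Gamma> a b) = cat_comp \<Lambda> (F a) (F b))"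

text \<open>A path is the pair \<open>(d(x), x)\<close>.\<close>

type_synonym 'a path = "(nat \<Rightarrow> enat) \<times> ((nat \<Rightarrow> nat) \<times> (nat \<Rightarrow> nat) \<Rightarrow> 'a)"

abbreviation pdeg :: "'a path \<Rightarrow> nat \<Rightarrow> enat" where
  "pdeg x \<equiv> fst x"

abbreviation pseg :: "'a path \<Rightarrow> (nat \<Rightarrow> nat) \<Rightarrow> (nat \<Rightarrow> nat) \<Rightarrow> 'a" where
  "pseg x p q \<equiv> snd x (p, q)"

definition paths :: "nat \<Rightarrow> 'a graded_category \<Rightarrow> 'a path set" where
  "paths k \<Lambda> = {x. pdeg x \<in> Nk_inf k \<and> graded_functor (Omega k (pdeg x)) \<Lambda> (snd x)}"

definition prng :: "'a path \<Rightarrow> 'a" where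
  "prng x = pseg x 0 0"

definition shift :: "nat \<Rightarrow> (nat \<Rightarrow> nat) \<Rightarrow> 'a path \<Rightarrow> 'a path" where
  "shift k n x =
     (pdeg x - enatv n,
      \<lambda>(p, q) \<in> Mor (Omega k (pdeg x - enatv n)). pseg x (n + p) (n + q))"

definition prepend :: "nat \<Rightarrow> 'a graded_category \<Rightarrow> 'a \<Rightarrow> 'a path \<Rightarrow> 'a path" where
  "prepend k \<Lambda> \<eta> x =
     (THE y. y \<in> paths k \<Lambda> \<and> pdeg y = pdeg x + enatv (deg \<Lambda> \<eta>) \<and>
        pseg y 0 (deg \<Lambda> \<eta>) = \<eta> \<and> shift k (deg \<Lambda> \<eta>) y = x)"

definition boundary_paths :: "nat \<Rightarrow> 'a graded_category \<Rightarrow> 'a path set" where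
  "boundary_paths k \<Lambda> =
     {x \<in> paths k \<Lambda>. \<forall>n\<in>Nk k. enatv n \<le> pdeg x \<longrightarrow>
        (\<forall>E\<in>FE \<Lambda> (pseg x n n). \<exists>p\<in>Nk k. enatv p \<le> pdeg x - enatv n \<and> pseg x n (n + p) \<in> E)}"

definition aperiodic_boundary_paths :: "nat \<Rightarrow> 'a graded_category \<Rightarrow> 'a path set" where
  "aperiodic_boundary_paths k \<Lambda> =
     {x \<in> boundary_paths k \<Lambda>. \<forall>m\<in>Nk k. \<forall>n\<in>Nk k.
        m \<noteq> n \<and> enatv m \<le> pdeg x \<and> enatv n \<le> pdeg x \<longrightarrow> shift k m x \<noteq> shift k n x}"


section \<open>Bounded operators on \<open>\<ell>\<^sup>2(X)\<close>\<close>

text \<open>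
  Elements of \<open>\<ell>\<^sup>2(X)\<close> are functions on the whole type that vanish outside \<open>X\<close>; operators vanish
  outside \<open>\<ell>\<^sup>2(X)\<close>.  Hence sums, differences, zero and products of operators are the pointwise
  operations and composition of HOL functions.
\<close>

type_synonym 'x operator = "('x \<Rightarrow> complex) \<Rightarrow> ('x \<Rightarrow> complex)"

definition ell2 :: "'x set \<Rightarrow> ('x \<Rightarrow> complex) set" where
  "ell2 X = {f. (\<forall>x. x \<notin> X \<longrightarrow> f x = 0) \<and> (\<lambda>x. (cmod (f x))\<^sup>2) summable_on X}"

definition ell2_inner :: "'x set \<Rightarrow> ('x \<Rightarrow> complex) \<Rightarrow> ('x \<Rightarrow> complex) \<Rightarrow> complex" where
  "ell2_inner X f g = (\<Sum>\<^sub>\<infinity>x\<in>X. f x * cnj (g x))"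

definition ell2_norm :: "'x set \<Rightarrow> ('x \<Rightarrow> complex) \<Rightarrow> real" where
  "ell2_norm X f = sqrt (\<Sum>\<^sub>\<infinity>x\<in>X. (cmod (f x))\<^sup>2)"

definition basis_vec :: "'x \<Rightarrow> 'x \<Rightarrow> complex" where
  "basis_vec x = (\<lambda>y. if y = x then 1 else 0)"

definition bounded_ops :: "'x set \<Rightarrow> 'x operator set" where
  "bounded_ops X =
     {T. (\<forall>f\<in>ell2 X. T f \<in> ell2 X) \<and> (\<forall>f. f \<notin> ell2 X \<longrightarrow> T f = 0) \<and>
         (\<forall>f\<in>ell2 X. \<forall>g\<in>ell2 X. T (f + g) = T f + T g) \<and>
         (\<forall>c. \<forall>f\<in>ell2 X. T (\<lambda>x. c * f x) = (\<lambda>x. c * T f x)) \<and>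
         (\<exists>C. \<forall>f\<in>ell2 X. ell2_norm X (T f) \<le> C * ell2_norm X f)}"

definition op_scale :: "complex \<Rightarrow> 'x operator \<Rightarrow> 'x operator" where
  "op_scale c T = (\<lambda>f x. c * T f x)"

interpretation op: vector_space op_scale
  by unfold_locales (auto simp: op_scale_def fun_eq_iff algebra_simps)

definition op_norm :: "'x set \<Rightarrow> 'x operator \<Rightarrow> real" where
  "op_norm X T = (SUP f\<in>{f \<in> ell2 X. ell2_norm X f \<le> 1}. ell2_norm X (T f))"

definition op_adjoint :: "'x set \<Rightarrow> 'x operator \<Rightarrow> 'x operator" where
  "op_adjoint X T = (THE T'. T' \<in> bounded_ops X \<and>
     (\<forall>f\<in>ell2 X. \<forall>g\<in>ell2 X. ell2_inner X (T f) g = ell2_inner X f (T' g)))"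

definition op_positive :: "'x set \<Rightarrow> 'x operator \<Rightarrow> bool" where
  "op_positive X T \<longleftrightarrow> (\<forall>f\<in>ell2 X. ell2_inner X (T f) f \<in> \<real>\<^sub>\<ge>\<^sub>0)"

definition op_closure :: "'x set \<Rightarrow> 'x operator set \<Rightarrow> 'x operator set" where
  "op_closure X A = {T \<in> bounded_ops X. \<forall>\<epsilon>>0. \<exists>a\<in>A. op_norm X (T - a) < \<epsilon>}"

definition cstar_subalgebra :: "'x set \<Rightarrow> 'x operator set \<Rightarrow> bool" where
  "cstar_subalgebra X A \<longleftrightarrow>
     A \<subseteq> bounded_ops X \<and> 0 \<in> A \<and>
     (\<forall>a\<in>A. \<forall>b\<in>A. a + b \<in> A \<and> a \<circ> b \<in> A) \<and>
     (\<forall>c. \<forall>a\<in>A. op_scale c a \<in> A) \<and>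
     (\<forall>a\<in>A. op_adjoint X a \<in> A) \<and>
     op_closure X A \<subseteq> A"

definition cstar_generated :: "'x set \<Rightarrow> 'x operator set \<Rightarrow> 'x operator set" where
  "cstar_generated X G = \<Inter>{A. cstar_subalgebra X A \<and> G \<subseteq> A}"

text \<open>
  Conditional expectations of \<open>A\<close> onto \<open>D\<close>, where \<open>D \<subseteq> A\<close> are \<open>C\<^sup>*\<close>-algebras of operators on
  \<open>\<ell>\<^sup>2(X)\<close>: contractive positive linear \<open>D\<close>-bimodule projections.  Complete positivity need not be
  required separately, as it follows from positivity and the bimodule property.
\<close>

definition conditional_expectation ::
    "'x set \<Rightarrow> 'x operator set \<Rightarrow> 'x operator set \<Rightarrow> ('x operator \<Rightarrow> 'x operator) \<Rightarrow> bool" where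
  "conditional_expectation X A D \<Phi> \<longleftrightarrow>
     (\<forall>a\<in>A. \<Phi> a \<in> D) \<and>
     (\<forall>a\<in>A. \<forall>b\<in>A. \<Phi> (a + b) = \<Phi> a + \<Phi> b) \<and>
     (\<forall>c. \<forall>a\<in>A. \<Phi> (op_scale c a) = op_scale c (\<Phi> a)) \<and>
     (\<forall>d\<in>D. \<Phi> d = d) \<and>
     (\<forall>a\<in>A. op_norm X (\<Phi> a) \<le> op_norm X a) \<and>
     (\<forall>a\<in>A. op_positive X a \<longrightarrow> op_positive X (\<Phi> a)) \<and>
     (\<forall>a\<in>A. \<forall>d\<in>D. \<forall>d'\<in>D. \<Phi> (d \<circ> a \<circ> d') = d \<circ> \<Phi> a \<circ> d')"


section \<open>The algebra \<open>C\<^sup>*\<^sub>m\<^sub>i\<^sub>n(\<Lambda>)\<close>\<close>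

definition S_ap :: "nat \<Rightarrow> 'a graded_category \<Rightarrow> 'a \<Rightarrow> 'a path operator" where
  "S_ap k \<Lambda> \<eta> =
     (THE T. T \<in> bounded_ops (aperiodic_boundary_paths k \<Lambda>) \<and>
        (\<forall>x\<in>aperiodic_boundary_paths k \<Lambda>.
           T (basis_vec x) = (if src \<Lambda> \<eta> = prng x then basis_vec (prepend k \<Lambda> \<eta> x) else 0)))"

definition S_ap_adj :: "nat \<Rightarrow> 'a graded_category \<Rightarrow> 'a \<Rightarrow> 'a path operator" where
  "S_ap_adj k \<Lambda> \<eta> = op_adjoint (aperiodic_boundary_paths k \<Lambda>) (S_ap k \<Lambda> \<eta>)"

definition P_ap :: "nat \<Rightarrow> 'a graded_category \<Rightarrow> 'a \<Rightarrow> 'a path operator" where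
  "P_ap k \<Lambda> \<eta> = S_ap k \<Lambda> \<eta> \<circ> S_ap_adj k \<Lambda> \<eta>"

definition Cstar_min :: "nat \<Rightarrow> 'a graded_category \<Rightarrow> 'a path operator set" where
  "Cstar_min k \<Lambda> = cstar_generated (aperiodic_boundary_paths k \<Lambda>) (S_ap k \<Lambda> ` Mor \<Lambda>)"

definition Diag_min :: "nat \<Rightarrow> 'a graded_category \<Rightarrow> 'a path operator set" where
  "Diag_min k \<Lambda> = op_closure (aperiodic_boundary_paths k \<Lambda>) (op.span (P_ap k \<Lambda> ` Mor \<Lambda>))"

end

theory Submission
  imports Defs
begin

text \<open>
  For an aperiodic boundary path \<open>x\<close>, \<open>S\<^sub>\<mu> S\<^sub>\<nu>\<^sup>*\<close> with \<open>\<mu> \<noteq> \<nu>\<close> has zero diagonal entry at \<open>\<xi>\<^sub>x\<close>: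
  otherwise \<open>x = \<nu>y = \<mu>y\<close>, hence \<open>\<sigma>\<^sup>m(x) = \<sigma>\<^sup>n(x)\<close> with \<open>m = d(\<mu>)\<close> and \<open>n = d(\<nu>)\<close>, so \<open>m = n\<close> and
  \<open>\<mu> = \<nu>\<close>.  Thus \<open>a\<close> and \<open>\<Phi> a\<close> have the same diagonal entries when \<open>a\<close> is in the span of these
  monomials.  That span is dense, because finite alignment writes \<open>S\<^sub>\<nu>\<^sup>* S\<^sub>\<alpha>\<close> as a finite sum of
  monomials, and \<open>\<Phi>\<close> is contractive, so the diagonals agree for every \<open>a\<close> in the algebra.  A positive
  operator with zero diagonal vanishes by Cauchy--Schwarz.
\<close>

text \<open>The objects of the statement are given indirectly: \<open>op_adjoint\<close>,
  \<open>prepend\<close> and \<open>S_ap\<close> are definite descriptions, and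
  \<open>Cstar_min\<close> is an intersection of subalgebras. Existence and uniqueness must be
  settled before any relation can be used, and this shapes the development more than the comparison
  of diagonals does. Two points carry the content. First, adjoints are constructed by hand from
  matrix entries, and operators are identified by their values on basis vectors. Second,
  \<open>S_ap\<close> makes sense only if prepending preserves the aperiodic boundary paths. For the
  boundary condition, an exhaustive set attached to a vertex inside the prepended morphism has to be
  carried past that morphism, and finite alignment keeps the transported set finite. For
  aperiodicity, a coincidence of two shifts has to be pushed past the prepended morphism without
  leaving the domain of the path, although multi-indices are only partially ordered and some
  coordinates of the degree may be finite.\<close>

section \<open>The Hilbert space\<close>

lemma ell2_vanish: "f \<in> ell2 X \<Longrightarrow> x \<notin> X \<Longrightarrow> f x = 0"
  by (simp add: ell2_def)

text \<open>A series of nonnegative terms is the supremum of its finite partial sums, so a uniform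
  bound on finite sections gives membership and the norm bound together. Later norm estimates are
  thereby reduced to inequalities for \<open>L2_set\<close>.\<close>

lemma ell2I:
  assumes "\<And>x. x \<notin> X \<Longrightarrow> f x = 0"
    and "\<And>F. finite F \<Longrightarrow> F \<subseteq> X \<Longrightarrow> L2_set (\<lambda>x. cmod (f x)) F \<le> C"
  shows "f \<in> ell2 X" and "ell2_norm X f \<le> C"
proof -
  have "0 \<le> C" using assms(2)[of "{}"] by simp
  have sq: "(\<Sum>x\<in>F. (cmod (f x))\<^sup>2) \<le> C\<^sup>2" if "finite F" "F \<subseteq> X" for F
    using assms(2)[OF that] \<open>0 \<le> C\<close>
    by (simp add: L2_set_def real_sqrt_le_iff' sum_nonneg)
  have sm: "(\<lambda>x. (cmod (f x))\<^sup>2) summable_on X"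
    by (rule nonneg_bdd_above_summable_on) (auto intro!: bdd_aboveI[where M = "C\<^sup>2"] sq)
  then show "f \<in> ell2 X" using assms(1) by (simp add: ell2_def)
  have "(\<Sum>\<^sub>\<infinity>x\<in>X. (cmod (f x))\<^sup>2) \<le> C\<^sup>2"
    by (rule infsum_le_finite_sums[OF sm]) (rule sq)
  then show "ell2_norm X f \<le> C"
    using \<open>0 \<le> C\<close> real_le_lsqrt by (simp add: ell2_norm_def real_sqrt_le_iff')
qed

lemma ell2_norm_nonneg: "0 \<le> ell2_norm X f"
  by (simp add: ell2_norm_def infsum_nonneg)

lemma L2_set_le_ell2_norm:
  assumes "f \<in> ell2 X" "finite F" "F \<subseteq> X"
  shows "L2_set (\<lambda>x. cmod (f x)) F \<le> ell2_norm X f"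
  unfolding L2_set_def ell2_norm_def using assms
  by (intro real_sqrt_le_mono finite_sum_le_infsum) (auto simp: ell2_def)

lemma cmod_le_ell2_norm:
  assumes "f \<in> ell2 X"
  shows "cmod (f x) \<le> ell2_norm X f"
proof (cases "x \<in> X")
  case True
  then show ?thesis using L2_set_le_ell2_norm[OF assms, of "{x}"] by simp
next
  case False
  then show ?thesis using assms by (simp add: ell2_vanish ell2_norm_nonneg)
qed

lemma ell2_add:
  assumes "f \<in> ell2 X" "g \<in> ell2 X"
  shows "f + g \<in> ell2 X" and "ell2_norm X (f + g) \<le> ell2_norm X f + ell2_norm X g"
proof -
  have 1: "(f + g) x = 0" if "x \<notin> X" for x using assms that by (simp add: ell2_vanish)
  have 2: "L2_set (\<lambda>x. cmod ((f + g) x)) F \<le> ell2_norm X f + ell2_norm X g"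
    if "finite F" "F \<subseteq> X" for F
  proof -
    have "L2_set (\<lambda>x. cmod ((f + g) x)) F \<le> L2_set (\<lambda>x. cmod (f x) + cmod (g x)) F"
      by (rule L2_set_mono) (auto simp: norm_triangle_ineq)
    also have "\<dots> \<le> L2_set (\<lambda>x. cmod (f x)) F + L2_set (\<lambda>x. cmod (g x)) F"
      by (rule L2_set_triangle_ineq)
    also have "\<dots> \<le> ell2_norm X f + ell2_norm X g"
      by (intro add_mono L2_set_le_ell2_norm assms that)
    finally show ?thesis .
  qed
  show "f + g \<in> ell2 X" and "ell2_norm X (f + g) \<le> ell2_norm X f + ell2_norm X g"
    using ell2I[OF 1 2] by blast+
qed

lemma ell2_scale:
  assumes "f \<in> ell2 X"
  shows "(\<lambda>x. c * f x) \<in> ell2 X" and "ell2_norm X (\<lambda>x. c * f x) \<le> cmod c * ell2_norm X f"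
proof -
  have 1: "c * f x = 0" if "x \<notin> X" for x using assms that by (simp add: ell2_vanish)
  have 2: "L2_set (\<lambda>x. cmod (c * f x)) F \<le> cmod c * ell2_norm X f"
    if "finite F" "F \<subseteq> X" for F
    by (simp add: norm_mult L2_set_right_distrib[symmetric] mult_left_mono
        L2_set_le_ell2_norm[OF assms that])
  show "(\<lambda>x. c * f x) \<in> ell2 X" and "ell2_norm X (\<lambda>x. c * f x) \<le> cmod c * ell2_norm X f"
    using ell2I[OF 1 2] by blast+
qed

lemma ell2_zero [simp]: "0 \<in> ell2 X" "ell2_norm X 0 = 0"
  by (auto simp: ell2_def ell2_norm_def)

lemma ell2_diff: "f \<in> ell2 X \<Longrightarrow> g \<in> ell2 X \<Longrightarrow> f - g \<in> ell2 X"
proof -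
  assume a: "f \<in> ell2 X" "g \<in> ell2 X"
  have "f - g = f + (\<lambda>x. (-1) * g x)" by auto
  then show ?thesis using ell2_add(1)[OF a(1) ell2_scale(1)[OF a(2)]] by metis
qed

lemma ell2_norm_eq_0:
  assumes "f \<in> ell2 X" "ell2_norm X f = 0"
  shows "f = 0"
proof
  fix x
  show "f x = 0 x" using cmod_le_ell2_norm[OF assms(1), of x] assms(2) by simp
qed

lemma ell2_finite_support:
  assumes "finite F" "F \<subseteq> X" "\<And>x. x \<notin> F \<Longrightarrow> f x = 0"
  shows "f \<in> ell2 X" and "ell2_norm X f = L2_set (\<lambda>x. cmod (f x)) F"
proof -
  have "(\<lambda>x. (cmod (f x))\<^sup>2) summable_on X \<longleftrightarrow> (\<lambda>x. (cmod (f x))\<^sup>2) summable_on F"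
    using assms by (intro summable_on_cong_neutral) auto
  then show "f \<in> ell2 X" using assms by (auto simp: ell2_def)
  have "(\<Sum>\<^sub>\<infinity>x\<in>X. (cmod (f x))\<^sup>2) = (\<Sum>\<^sub>\<infinity>x\<in>F. (cmod (f x))\<^sup>2)"
    using assms by (intro infsum_cong_neutral) auto
  then show "ell2_norm X f = L2_set (\<lambda>x. cmod (f x)) F"
    using assms(1) by (simp add: ell2_norm_def L2_set_def)
qed

lemma basis_vec_ell2 [simp]: "x \<in> X \<Longrightarrow> basis_vec x \<in> ell2 X"
  by (rule ell2_finite_support(1)[of "{x}"]) (auto simp: basis_vec_def)

lemma ell2_norm_basis_vec: "x \<in> X \<Longrightarrow> ell2_norm X (basis_vec x) = 1"
  by (subst ell2_finite_support(2)[of "{x}"]) (auto simp: basis_vec_def)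

section \<open>Approximation by finitely supported vectors\<close>

definition truncate :: "'x set \<Rightarrow> ('x \<Rightarrow> complex) \<Rightarrow> 'x \<Rightarrow> complex" where
  "truncate F f = (\<lambda>x. if x \<in> F then f x else 0)"

lemma truncate_ell2: "finite F \<Longrightarrow> F \<subseteq> X \<Longrightarrow> truncate F f \<in> ell2 X"
  by (rule ell2_finite_support(1)[of F]) (auto simp: truncate_def)

text \<open>The squared distance is the tail of a convergent nonnegative series: a finite
  \<open>G\<close> sees only \<open>G - F\<close>, whose sum is at most the total minus the sum over
  \<open>F\<close>.\<close>

lemma truncate_approx:
  assumes "f \<in> ell2 X" "\<epsilon> > 0"
  shows "\<exists>F. finite F \<and> F \<subseteq> X \<and> ell2_norm X (f - truncate F f) \<le> \<epsilon>"
proof -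
  define h where "h = (\<lambda>x. (cmod (f x))\<^sup>2)"
  have h: "h summable_on X" using assms(1) by (simp add: ell2_def h_def)
  obtain F where F: "finite F" "F \<subseteq> X" "dist (sum h F) (infsum h X) \<le> \<epsilon>\<^sup>2"
    using infsum_finite_approximation[OF h, of "\<epsilon>\<^sup>2"] assms(2) by auto
  have 1: "(f - truncate F f) x = 0" if "x \<notin> X" for x
    using assms(1) that by (simp add: ell2_vanish truncate_def)
  have 2: "L2_set (\<lambda>x. cmod ((f - truncate F f) x)) G \<le> \<epsilon>" if G: "finite G" "G \<subseteq> X" for G
  proof -
    have "(\<Sum>x\<in>G. (cmod ((f - truncate F f) x))\<^sup>2) = sum h (G - F)"
      unfolding h_def by (rule sum.mono_neutral_cong_right) (use G in \<open>auto simp: truncate_def\<close>)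
    also have "\<dots> = sum h (G \<union> F) - sum h F"
      using sum.union_disjoint[of "G - F" F h] G F by (simp add: Diff_disjoint inf_commute)
    also have "\<dots> \<le> infsum h X - sum h F"
      using G F h by (intro diff_right_mono finite_sum_le_infsum) (auto simp: h_def)
    also have "\<dots> \<le> \<epsilon>\<^sup>2" using F(3) by (simp add: dist_real_def)
    finally show ?thesis
      using assms(2) by (simp add: L2_set_def real_le_lsqrt sum_nonneg)
  qed
  show ?thesis using ell2I(2)[OF 1 2] F by blast
qed

text \<open>An \<open>infsum\<close> that does not converge is 0 by convention, so additivity of the
  inner product requires summability first. The finite Cauchy--Schwarz inequality yields absolute
  summability and the norm estimate from the same bound.\<close>

lemma ell2_inner_summable:
  assumes "f \<in> ell2 X" "g \<in> ell2 X"
  shows "(\<lambda>x. f x * cnj (g x)) summable_on X"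
    and "cmod (ell2_inner X f g) \<le> ell2_norm X f * ell2_norm X g"
proof -
  have b: "(\<Sum>x\<in>F. norm (f x * cnj (g x))) \<le> ell2_norm X f * ell2_norm X g"
    if F: "finite F" "F \<subseteq> X" for F
  proof -
    have "(\<Sum>x\<in>F. norm (f x * cnj (g x))) = (\<Sum>x\<in>F. \<bar>cmod (f x)\<bar> * \<bar>cmod (g x)\<bar>)"
      by (simp add: norm_mult)
    also have "\<dots> \<le> L2_set (\<lambda>x. cmod (f x)) F * L2_set (\<lambda>x. cmod (g x)) F"
      by (rule L2_set_mult_ineq)
    also have "\<dots> \<le> ell2_norm X f * ell2_norm X g"
      by (intro mult_mono L2_set_le_ell2_norm assms F ell2_norm_nonneg L2_set_nonneg)
    finally show ?thesis .
  qed
  have abs: "(\<lambda>x. norm (f x * cnj (g x))) summable_on X"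
    by (rule nonneg_bdd_above_summable_on)
      (auto intro!: bdd_aboveI[where M = "ell2_norm X f * ell2_norm X g"] b)
  then show "(\<lambda>x. f x * cnj (g x)) summable_on X" by (rule abs_summable_summable)
  have "cmod (ell2_inner X f g) \<le> (\<Sum>\<^sub>\<infinity>x\<in>X. norm (f x * cnj (g x)))"
    unfolding ell2_inner_def by (rule norm_infsum_bound[OF abs])
  also have "\<dots> \<le> ell2_norm X f * ell2_norm X g"
    by (rule infsum_le_finite_sums[OF abs]) (rule b)
  finally show "cmod (ell2_inner X f g) \<le> ell2_norm X f * ell2_norm X g" .
qed

lemma ell2_inner_cnj: "ell2_inner X f g = cnj (ell2_inner X g f)"
  unfolding ell2_inner_def by (simp add: infsum_cnj[symmetric] mult.commute)

lemma ell2_inner_add_left: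
  assumes "f \<in> ell2 X" "g \<in> ell2 X" "h \<in> ell2 X"
  shows "ell2_inner X (f + g) h = ell2_inner X f h + ell2_inner X g h"
  unfolding ell2_inner_def
  by (simp add: ring_distribs infsum_add ell2_inner_summable(1) assms)

lemma ell2_inner_scale_left: "ell2_inner X (\<lambda>x. c * f x) g = c * ell2_inner X f g"
  unfolding ell2_inner_def by (simp add: mult.assoc infsum_cmult_right')

lemma ell2_inner_add_right:
  assumes "f \<in> ell2 X" "g \<in> ell2 X" "h \<in> ell2 X"
  shows "ell2_inner X h (f + g) = ell2_inner X h f + ell2_inner X h g"
  using ell2_inner_add_left[OF assms] by (metis complex_cnj_add ell2_inner_cnj)

lemma ell2_inner_scale_right: "ell2_inner X g (\<lambda>x. c * f x) = cnj c * ell2_inner X g f"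
  by (metis complex_cnj_mult ell2_inner_cnj ell2_inner_scale_left)

lemma ell2_inner_basis:
  assumes "x \<in> X"
  shows "ell2_inner X f (basis_vec x) = f x" "ell2_inner X (basis_vec x) f = cnj (f x)"
proof -
  have "ell2_inner X f (basis_vec x) = (\<Sum>\<^sub>\<infinity>y\<in>{x}. f y * cnj (basis_vec x y))"
    unfolding ell2_inner_def
    by (rule infsum_cong_neutral) (use assms in \<open>auto simp: basis_vec_def\<close>)
  then show "ell2_inner X f (basis_vec x) = f x" by (simp add: basis_vec_def)
  then show "ell2_inner X (basis_vec x) f = cnj (f x)" by (metis ell2_inner_cnj)
qed

lemma ell2_inner_self:
  assumes "f \<in> ell2 X"
  shows "ell2_inner X f f = of_real ((ell2_norm X f)\<^sup>2)"
proof -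
  have "ell2_inner X f f = (\<Sum>\<^sub>\<infinity>x\<in>X. of_real ((cmod (f x))\<^sup>2))"
    unfolding ell2_inner_def by (intro infsum_cong) (rule complex_norm_square[symmetric])
  also have "\<dots> = of_real (\<Sum>\<^sub>\<infinity>x\<in>X. (cmod (f x))\<^sup>2)"
    using assms by (intro infsumI has_sum_of_real has_sum_infsum) (auto simp: ell2_def)
  finally show ?thesis by (simp add: ell2_norm_def infsum_nonneg)
qed

section \<open>Bounded operators and adjoints\<close>

lemma bounded_opsD:
  assumes "T \<in> bounded_ops X"
  shows bounded_ops_ell2: "f \<in> ell2 X \<Longrightarrow> T f \<in> ell2 X"
    and bounded_ops_outside: "f \<notin> ell2 X \<Longrightarrow> T f = 0"
    and bounded_ops_add: "f \<in> ell2 X \<Longrightarrow> g \<in> ell2 X \<Longrightarrow> T (f + g) = T f + T g"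
    and bounded_ops_scale: "f \<in> ell2 X \<Longrightarrow> T (\<lambda>x. c * f x) = (\<lambda>x. c * T f x)"
  using assms by (auto simp: bounded_ops_def)

lemma bounded_ops_zero:
  assumes "T \<in> bounded_ops X"
  shows "T 0 = 0"
  using bounded_ops_scale[OF assms ell2_zero(1), of 0] by (simp add: fun_eq_iff zero_fun_def)

lemma bounded_ops_diff:
  assumes "T \<in> bounded_ops X" "f \<in> ell2 X" "g \<in> ell2 X"
  shows "T (f - g) = T f - T g"
  using bounded_ops_add[OF assms(1) ell2_diff[OF assms(2,3)] assms(3)]
  by (simp add: fun_eq_iff)

text \<open>The supremum defining \<open>op_norm\<close> says something only once the set is known
  to be bounded above. Vectors outside the unit ball are then handled by normalization.\<close>

lemma op_norm_bound:
  assumes "T \<in> bounded_ops X"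
  shows op_norm_nonneg: "0 \<le> op_norm X T"
    and ell2_norm_apply_le: "f \<in> ell2 X \<Longrightarrow> ell2_norm X (T f) \<le> op_norm X T * ell2_norm X f"
proof -
  obtain C where C: "\<And>f. f \<in> ell2 X \<Longrightarrow> ell2_norm X (T f) \<le> C * ell2_norm X f"
    using assms unfolding bounded_ops_def by blast
  \<comment> \<open>The constant in \<open>bounded_ops\<close> carries no sign condition; its
    absolute value can be multiplied into an inequality.\<close>
  have "ell2_norm X (T f) \<le> \<bar>C\<bar>" if "f \<in> ell2 X" "ell2_norm X f \<le> 1" for f
  proof -
    have "ell2_norm X (T f) \<le> C * ell2_norm X f" using C that by blast
    also have "\<dots> \<le> \<bar>C\<bar> * 1"
      using that ell2_norm_nonneg[of X f] by (intro mult_mono) auto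
    finally show ?thesis by simp
  qed
  then have bdd: "bdd_above ((\<lambda>f. ell2_norm X (T f)) ` {f \<in> ell2 X. ell2_norm X f \<le> 1})"
    by (auto intro!: bdd_aboveI)
  have le: "ell2_norm X (T f) \<le> op_norm X T" if "f \<in> ell2 X" "ell2_norm X f \<le> 1" for f
    unfolding op_norm_def using that by (intro cSUP_upper bdd) auto
  show "0 \<le> op_norm X T"
    using le[of 0] bounded_ops_zero[OF assms] by simp
  show "ell2_norm X (T f) \<le> op_norm X T * ell2_norm X f" if f: "f \<in> ell2 X"
  proof (cases "ell2_norm X f = 0")
    case True
    then show ?thesis using ell2_norm_eq_0[OF f True] bounded_ops_zero[OF assms] by simp
  next
    case False
    define t where "t = ell2_norm X f"
    have t: "t > 0" using False ell2_norm_nonneg[of X f] by (simp add: t_def)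
    define g where "g = (\<lambda>x. of_real (1 / t) * f x)"
    have g: "g \<in> ell2 X" unfolding g_def by (rule ell2_scale[OF f])
    have "ell2_norm X g \<le> cmod (of_real (1 / t)) * ell2_norm X f"
      unfolding g_def by (rule ell2_scale[OF f])
    also have "\<dots> = 1" using t by (simp add: t_def norm_divide)
    finally have Tg: "ell2_norm X (T g) \<le> op_norm X T" by (rule le[OF g])
    have "f = (\<lambda>x. of_real t * g x)" using t by (auto simp: g_def)
    then have "T f = (\<lambda>x. of_real t * T g x)" using bounded_ops_scale[OF assms g] by metis
    then have "ell2_norm X (T f) \<le> cmod (of_real t) * ell2_norm X (T g)"
      using ell2_scale(2)[OF bounded_ops_ell2[OF assms g]] by metis
    also have "\<dots> \<le> t * op_norm X T" using t Tg by simp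
    finally show ?thesis by (simp add: t_def mult.commute)
  qed
qed

lemma op_norm_le:
  assumes "0 \<le> C" "\<And>f. f \<in> ell2 X \<Longrightarrow> ell2_norm X (T f) \<le> C * ell2_norm X f"
  shows "op_norm X T \<le> C"
  unfolding op_norm_def
proof (rule cSUP_least)
  show "{f \<in> ell2 X. ell2_norm X f \<le> 1} \<noteq> {}"
    by (auto intro!: exI[of _ 0])
  fix f assume f: "f \<in> {f \<in> ell2 X. ell2_norm X f \<le> 1}"
  then have "ell2_norm X (T f) \<le> C * ell2_norm X f" using assms by blast
  also have "\<dots> \<le> C * 1" using f assms(1) by (intro mult_left_mono) auto
  finally show "ell2_norm X (T f) \<le> C" by simp
qed

lemma bounded_opsI:
  assumes "\<And>f. f \<in> ell2 X \<Longrightarrow> T f \<in> ell2 X" "\<And>f. f \<notin> ell2 X \<Longrightarrow> T f = 0"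
    "\<And>f g. f \<in> ell2 X \<Longrightarrow> g \<in> ell2 X \<Longrightarrow> T (f + g) = T f + T g"
    "\<And>c f. f \<in> ell2 X \<Longrightarrow> T (\<lambda>x. c * f x) = (\<lambda>x. c * T f x)"
    "\<And>f. f \<in> ell2 X \<Longrightarrow> ell2_norm X (T f) \<le> C * ell2_norm X f"
  shows "T \<in> bounded_ops X"
  using assms unfolding bounded_ops_def by blast

lemma zero_bounded_ops: "0 \<in> bounded_ops X"
  by (rule bounded_opsI[where C = 0]) (auto simp: zero_fun_def[symmetric])

lemma op_add:
  assumes S: "S \<in> bounded_ops X" and T: "T \<in> bounded_ops X"
  shows "S + T \<in> bounded_ops X" and "op_norm X (S + T) \<le> op_norm X S + op_norm X T"
proof -
  have n: "ell2_norm X ((S + T) f) \<le> (op_norm X S + op_norm X T) * ell2_norm X f"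
    if f: "f \<in> ell2 X" for f
    using ell2_add(2)[OF bounded_ops_ell2[OF S f] bounded_ops_ell2[OF T f]]
      ell2_norm_apply_le[OF S f] ell2_norm_apply_le[OF T f]
    by (simp add: distrib_right)
  show "op_norm X (S + T) \<le> op_norm X S + op_norm X T"
    by (rule op_norm_le[OF _ n]) (intro add_nonneg_nonneg op_norm_nonneg S T)
  show "S + T \<in> bounded_ops X"
    by (rule bounded_opsI[OF _ _ _ _ n])
      (simp_all add: bounded_opsD[OF S] bounded_opsD[OF T] ell2_add fun_eq_iff algebra_simps)
qed

lemma op_scale:
  assumes T: "T \<in> bounded_ops X"
  shows "op_scale c T \<in> bounded_ops X" and "op_norm X (op_scale c T) \<le> cmod c * op_norm X T"
proof -
  have n: "ell2_norm X (op_scale c T f) \<le> (cmod c * op_norm X T) * ell2_norm X f"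
    if f: "f \<in> ell2 X" for f
  proof -
    have "ell2_norm X (op_scale c T f) \<le> cmod c * ell2_norm X (T f)"
      unfolding op_scale_def by (rule ell2_scale[OF bounded_ops_ell2[OF T f]])
    also have "\<dots> \<le> cmod c * (op_norm X T * ell2_norm X f)"
      by (intro mult_left_mono ell2_norm_apply_le T f) auto
    finally show ?thesis by (simp add: mult.assoc)
  qed
  show "op_norm X (op_scale c T) \<le> cmod c * op_norm X T"
    by (rule op_norm_le[OF _ n]) (simp_all add: op_norm_nonneg T)
  show "op_scale c T \<in> bounded_ops X"
    by (rule bounded_opsI[OF _ _ _ _ n])
      (simp_all add: op_scale_def bounded_opsD[OF T] ell2_scale fun_eq_iff algebra_simps)
qed

lemma op_diff:
  assumes S: "S \<in> bounded_ops X" and T: "T \<in> bounded_ops X"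
  shows "S - T \<in> bounded_ops X" and "op_norm X (S - T) \<le> op_norm X S + op_norm X T"
proof -
  have "S - T = S + op_scale (-1) T" by (auto simp: op_scale_def fun_eq_iff)
  then show "S - T \<in> bounded_ops X" "op_norm X (S - T) \<le> op_norm X S + op_norm X T"
    using op_add[OF S op_scale(1)[OF T, of "-1"]] op_scale(2)[OF T, of "-1"] by auto
qed

lemma op_comp:
  assumes S: "S \<in> bounded_ops X" and T: "T \<in> bounded_ops X"
  shows "S \<circ> T \<in> bounded_ops X" and "op_norm X (S \<circ> T) \<le> op_norm X S * op_norm X T"
proof -
  have n: "ell2_norm X ((S \<circ> T) f) \<le> (op_norm X S * op_norm X T) * ell2_norm X f"
    if f: "f \<in> ell2 X" for f
  proof -
    have "ell2_norm X ((S \<circ> T) f) \<le> op_norm X S * ell2_norm X (T f)"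
      using ell2_norm_apply_le[OF S bounded_ops_ell2[OF T f]] by simp
    also have "\<dots> \<le> op_norm X S * (op_norm X T * ell2_norm X f)"
      by (intro mult_left_mono ell2_norm_apply_le T f op_norm_nonneg S)
    finally show ?thesis by (simp add: mult.assoc)
  qed
  show "op_norm X (S \<circ> T) \<le> op_norm X S * op_norm X T"
    by (rule op_norm_le[OF _ n]) (intro mult_nonneg_nonneg op_norm_nonneg S T)
  show "S \<circ> T \<in> bounded_ops X"
    by (rule bounded_opsI[OF _ _ _ _ n])
      (simp_all add: bounded_opsD[OF S] bounded_opsD[OF T] bounded_ops_zero[OF S])
qed

lemma bounded_ops_truncate:
  assumes T: "T \<in> bounded_ops X" and F: "finite F" "F \<subseteq> X"
  shows "T (truncate F f) = (\<lambda>y. \<Sum>x\<in>F. f x * T (basis_vec x) y)"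
  using F
proof (induction F rule: finite_induct)
  case empty
  then show ?case using bounded_ops_zero[OF T] by (auto simp: truncate_def zero_fun_def)
next
  case (insert x F)
  have "truncate (insert x F) f = (\<lambda>y. f x * basis_vec x y) + truncate F f"
    using insert by (auto simp: truncate_def basis_vec_def fun_eq_iff)
  moreover have "(\<lambda>y. f x * basis_vec x y) \<in> ell2 X" "truncate F f \<in> ell2 X"
    using insert by (auto intro!: ell2_scale truncate_ell2)
  ultimately have "T (truncate (insert x F) f) = T (\<lambda>y. f x * basis_vec x y) + T (truncate F f)"
    using bounded_ops_add[OF T] by metis
  then show ?case
    using insert bounded_ops_scale[OF T, of "basis_vec x" "f x"] by (auto simp: fun_eq_iff)
qed

text \<open>Continuity and density: removing a truncation from \<open>f\<close> does not change
  \<open>T f\<close>, and what remains of \<open>f\<close> is as small as desired.\<close>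

lemma bounded_ops_eq_0I:
  assumes T: "T \<in> bounded_ops X" and "\<And>F. finite F \<Longrightarrow> F \<subseteq> X \<Longrightarrow> T (truncate F f) = 0"
  shows "T f = 0"
proof (cases "f \<in> ell2 X")
  case f: True
  have "ell2_norm X (T f) \<le> \<epsilon>" if \<epsilon>: "\<epsilon> > 0" for \<epsilon>
  proof -
    let ?N = "op_norm X T"
    have N: "?N \<ge> 0" by (rule op_norm_nonneg[OF T])
    \<comment> \<open>The denominator \<open>?N + 1\<close> covers the case where the operator norm
      is 0.\<close>
    obtain F where F: "finite F" "F \<subseteq> X" "ell2_norm X (f - truncate F f) \<le> \<epsilon> / (?N + 1)"
      using truncate_approx[OF f, of "\<epsilon> / (?N + 1)"] \<epsilon> N by auto
    have t: "truncate F f \<in> ell2 X" using F by (intro truncate_ell2)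
    have "T f = T (f - truncate F f)"
      using bounded_ops_diff[OF T f t] assms(2)[OF F(1,2)] by simp
    then have "ell2_norm X (T f) \<le> ?N * ell2_norm X (f - truncate F f)"
      using ell2_norm_apply_le[OF T ell2_diff[OF f t]] by simp
    also have "\<dots> \<le> (?N + 1) * (\<epsilon> / (?N + 1))"
      using F(3) N \<epsilon> by (intro mult_mono) (auto simp: ell2_norm_nonneg)
    also have "\<dots> = \<epsilon>" using N by simp
    finally show ?thesis .
  qed
  then have "ell2_norm X (T f) \<le> 0" by (rule field_le_epsilon) (simp)
  then show ?thesis
    using ell2_norm_eq_0[OF bounded_ops_ell2[OF T f]] ell2_norm_nonneg[of X "T f"] by simp
qed (simp add: bounded_ops_outside[OF T])

text \<open>Equality of HOL functions results, because bounded operators vanish off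
  \<open>ell2 X\<close> by convention. It gives the uniqueness of adjoints and of
  \<open>S_ap\<close>, and it reduces relations between the generators to computations with single
  paths.\<close>

lemma bounded_ops_eqI:
  assumes S: "S \<in> bounded_ops X" and T: "T \<in> bounded_ops X"
    and "\<And>x. x \<in> X \<Longrightarrow> S (basis_vec x) = T (basis_vec x)"
  shows "S = T"
proof
  fix f
  have D: "S - T \<in> bounded_ops X" by (rule op_diff[OF S T])
  have "(S - T) f = 0"
  proof (rule bounded_ops_eq_0I[OF D])
    fix F assume F: "finite F" "F \<subseteq> X"
    show "(S - T) (truncate F f) = 0"
      unfolding bounded_ops_truncate[OF D F]
      using assms(3) F by (auto simp: fun_eq_iff subset_eq intro!: sum.neutral)
  qed
  then show "S f = T f" by (simp add: fun_eq_iff)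
qed

text \<open>The property inside the definite description of \<open>op_adjoint\<close>, separated so
  that a candidate can be verified first and identified with \<open>op_adjoint\<close>
  afterwards.\<close>

definition adjoint_of :: "'x set \<Rightarrow> 'x operator \<Rightarrow> 'x operator \<Rightarrow> bool" where
  "adjoint_of X T T' \<longleftrightarrow> T' \<in> bounded_ops X \<and>
     (\<forall>f\<in>ell2 X. \<forall>g\<in>ell2 X. ell2_inner X (T f) g = ell2_inner X f (T' g))"

lemma adjoint_of_entry:
  assumes "adjoint_of X T T'" "g \<in> ell2 X" "x \<in> X"
  shows "T' g x = cnj (ell2_inner X (T (basis_vec x)) g)"
  using assms ell2_inner_basis(2)[OF assms(3), of "T' g"] by (simp add: adjoint_of_def)

lemma adjoint_of_unique:
  assumes "adjoint_of X T T'" "adjoint_of X T T''"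
  shows "T' = T''"
proof (rule bounded_ops_eqI[where X = X])
  show "T' \<in> bounded_ops X" "T'' \<in> bounded_ops X" using assms by (auto simp: adjoint_of_def)
  fix x assume x: "x \<in> X"
  show "T' (basis_vec x) = T'' (basis_vec x)"
  proof
    fix y
    show "T' (basis_vec x) y = T'' (basis_vec x) y"
    proof (cases "y \<in> X")
      case True
      then show ?thesis
        using adjoint_of_entry[OF assms(1) _ True] adjoint_of_entry[OF assms(2) _ True] x
        by simp
    next
      case False
      have "T' (basis_vec x) \<in> ell2 X" "T'' (basis_vec x) \<in> ell2 X"
        using bounded_ops_ell2[of T' X "basis_vec x"] bounded_ops_ell2[of T'' X "basis_vec x"] assms x
        by (simp_all add: adjoint_of_def)
      then show ?thesis using False by (simp add: ell2_vanish)
    qed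
  qed
qed

lemma op_adjoint_eqI: "adjoint_of X T T' \<Longrightarrow> op_adjoint X T = T'"
  unfolding op_adjoint_def adjoint_of_def[symmetric]
  by (rule the_equality) (auto intro: adjoint_of_unique)

lemma adjoint_of_sym:
  assumes "T \<in> bounded_ops X" "adjoint_of X T T'"
  shows "adjoint_of X T' T"
  using assms unfolding adjoint_of_def by (metis ell2_inner_cnj)

text \<open>
  The adjoint is forced to be \<open>g \<mapsto> (x \<mapsto> \<langle>g, T \<xi>\<^sub>x\<rangle>)\<close>; testing \<open>T\<close> on the truncations of this
  function bounds its norm.
\<close>

lemma adjoint_of_exists:
  assumes T: "T \<in> bounded_ops X"
  shows "\<exists>T'. adjoint_of X T T'"
proof -
  define C where "C = op_norm X T"
  have C: "C \<ge> 0" unfolding C_def by (rule op_norm_nonneg[OF T])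
  define T' where
    "T' = (\<lambda>g x. if g \<in> ell2 X \<and> x \<in> X then ell2_inner X g (T (basis_vec x)) else 0)"
  \<comment> \<open>On finite sections this is linear algebra; \<open>f\<close> appears conjugated
    because the inner product is conjugate-linear in its second argument. The formula serves both
    the norm bound and the adjoint identity.\<close>
  have trunc: "ell2_inner X g (T (truncate F f)) = (\<Sum>x\<in>F. cnj (f x) * T' g x)"
    if g: "g \<in> ell2 X" and "finite F" "F \<subseteq> X" for f g F
    using that(2,3)
  proof (induction F rule: finite_induct)
    case empty
    then show ?case
      by (simp add: bounded_ops_truncate[OF T] ell2_inner_def)
  next
    case (insert x F)
    have x: "T (basis_vec x) \<in> ell2 X" using insert by (intro bounded_ops_ell2[OF T]) auto
    have "T (truncate (insert x F) f) = (\<lambda>y. f x * T (basis_vec x) y) + T (truncate F f)"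
      using insert by (simp add: bounded_ops_truncate[OF T] fun_eq_iff)
    then have "ell2_inner X g (T (truncate (insert x F) f)) =
        cnj (f x) * ell2_inner X g (T (basis_vec x)) + ell2_inner X g (T (truncate F f))"
      using insert g x
      by (simp add: ell2_inner_add_right ell2_inner_scale_right ell2_scale truncate_ell2
          bounded_ops_ell2[OF T])
    then show ?case using insert g by (simp add: T'_def)
  qed
  have L2: "L2_set (\<lambda>x. cmod (T' g x)) F \<le> C * ell2_norm X g"
    if g: "g \<in> ell2 X" and F: "finite F" "F \<subseteq> X" for g F
  proof -
    let ?L = "L2_set (\<lambda>x. cmod (T' g x)) F" and ?t = "truncate F (T' g)"
    have t: "?t \<in> ell2 X" using F by (rule truncate_ell2)
    have nt: "ell2_norm X ?t = ?L"
      using F by (subst ell2_finite_support(2)[of F]) (auto simp: truncate_def intro!: L2_set_cong)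
    \<comment> \<open>Taking \<open>f\<close> to be \<open>T' g\<close> itself turns the sum in
      \<open>trunc\<close> into a sum of squares. Cauchy--Schwarz then bounds \<open>?L\<close>
      squared by a multiple of \<open>?L\<close>, and one factor cancels unless it is 0.\<close>
    have "complex_of_real (?L\<^sup>2) = (\<Sum>x\<in>F. cnj (T' g x) * T' g x)"
      unfolding L2_set_def by (simp add: sum_nonneg) (simp add: complex_norm_square[symmetric] mult.commute)
    then have "complex_of_real (?L\<^sup>2) = ell2_inner X g (T ?t)"
      using trunc[OF g F] by simp
    then have "?L\<^sup>2 = cmod (ell2_inner X g (T ?t))"
      by (metis norm_of_real abs_power2)
    also have "\<dots> \<le> ell2_norm X g * ell2_norm X (T ?t)"
      by (intro ell2_inner_summable(2) g bounded_ops_ell2[OF T] t)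
    also have "\<dots> \<le> ell2_norm X g * (C * ?L)"
      using ell2_norm_apply_le[OF T t] by (simp add: nt C_def mult_left_mono ell2_norm_nonneg)
    finally have "?L * ?L \<le> (C * ell2_norm X g) * ?L" by (simp add: power2_eq_square algebra_simps)
    then show ?thesis
      using C by (cases "?L = 0") (auto simp: ell2_norm_nonneg less_le)
  qed
  have vanish: "T' g x = 0" if "x \<notin> X" for g x using that by (simp add: T'_def)
  have "T' \<in> bounded_ops X"
  proof (rule bounded_opsI)
    show "T' g \<in> ell2 X" "ell2_norm X (T' g) \<le> C * ell2_norm X g" if "g \<in> ell2 X" for g
      using ell2I[OF vanish L2[OF that]] by blast+
    show "T' g = 0" if "g \<notin> ell2 X" for g using that by (simp add: T'_def fun_eq_iff)
    show "T' (f + g) = T' f + T' g" if "f \<in> ell2 X" "g \<in> ell2 X" for f g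
      using that by (auto simp: T'_def fun_eq_iff ell2_add ell2_inner_add_left bounded_ops_ell2[OF T])
    show "T' (\<lambda>x. c * g x) = (\<lambda>x. c * T' g x)" if "g \<in> ell2 X" for c g
      using that by (auto simp: T'_def fun_eq_iff ell2_scale ell2_inner_scale_left)
  qed
  note T' = this
  have "ell2_inner X (T f) g = ell2_inner X f (T' g)" if f: "f \<in> ell2 X" and g: "g \<in> ell2 X" for f g
  proof -
    have "cmod (ell2_inner X (T f) g - ell2_inner X f (T' g)) \<le> \<epsilon>" if \<epsilon>: "\<epsilon> > 0" for \<epsilon>
    proof -
      \<comment> \<open>The first two summands are the factors multiplying the norm of
        \<open>u\<close> in the two error terms; adding 1 makes \<open>K\<close> positive.\<close>
      define K where "K = C * ell2_norm X g + ell2_norm X (T' g) + 1"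
      have K: "K > 0" using C by (simp add: K_def ell2_norm_nonneg add_nonneg_pos)
      obtain F where F: "finite F" "F \<subseteq> X" "ell2_norm X (f - truncate F f) \<le> \<epsilon> / K"
        using truncate_approx[OF f, of "\<epsilon> / K"] \<epsilon> K by auto
      define t where "t = truncate F f"
      have t: "t \<in> ell2 X" unfolding t_def using F by (intro truncate_ell2)
      define u where "u = f - t"
      have u: "u \<in> ell2 X" and fu: "f = u + t" using f t by (auto simp: u_def ell2_diff)
      \<comment> \<open>The identity is exact on the truncation \<open>t\<close>, so only the
        remainder \<open>u\<close> contributes to the difference below.\<close>
      have gt: "ell2_inner X (T t) g = ell2_inner X t (T' g)"
      proof -
        have "ell2_inner X (T t) g = cnj (\<Sum>x\<in>F. cnj (f x) * T' g x)"
          using trunc[OF g F(1,2)] by (metis ell2_inner_cnj t_def)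
        also have "\<dots> = (\<Sum>\<^sub>\<infinity>x\<in>F. t x * cnj (T' g x))"
          using F(1) by (simp add: t_def truncate_def)
        also have "\<dots> = ell2_inner X t (T' g)"
          unfolding ell2_inner_def using F by (intro infsum_cong_neutral) (auto simp: t_def truncate_def)
        finally show ?thesis .
      qed
      have "ell2_inner X (T f) g - ell2_inner X f (T' g) = ell2_inner X (T u) g - ell2_inner X u (T' g)"
        unfolding fu using u t g
        by (simp add: bounded_ops_add[OF T] ell2_inner_add_left bounded_ops_ell2[OF T]
            bounded_ops_ell2[OF T'] gt)
      also have "cmod \<dots> \<le> cmod (ell2_inner X (T u) g) + cmod (ell2_inner X u (T' g))"
        by (rule norm_triangle_ineq4)
      also have "\<dots> \<le> ell2_norm X (T u) * ell2_norm X g + ell2_norm X u * ell2_norm X (T' g)"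
        by (intro add_mono ell2_inner_summable(2) bounded_ops_ell2[OF T] bounded_ops_ell2[OF T'] u g)
      also have "\<dots> \<le> (C * ell2_norm X u) * ell2_norm X g + ell2_norm X u * ell2_norm X (T' g)"
        using ell2_norm_apply_le[OF T u]
        by (intro add_right_mono mult_right_mono) (auto simp: C_def ell2_norm_nonneg)
      also have "\<dots> \<le> K * ell2_norm X u"
        using ell2_norm_nonneg[of X u] by (simp add: K_def algebra_simps)
      also have "\<dots> \<le> K * (\<epsilon> / K)"
        using F(3) K by (intro mult_left_mono) (auto simp: u_def t_def)
      finally show ?thesis using K by simp
    qed
    then have "cmod (ell2_inner X (T f) g - ell2_inner X f (T' g)) \<le> 0"
      by (rule field_le_epsilon) simp
    then show ?thesis by simp
  qed
  then show ?thesis using T' by (auto simp: adjoint_of_def)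
qed

lemma adjoint_of_op_adjoint:
  assumes "T \<in> bounded_ops X"
  shows "adjoint_of X T (op_adjoint X T)"
  using adjoint_of_exists[OF assms] op_adjoint_eqI by metis

lemma op_adjoint_bounded_ops: "T \<in> bounded_ops X \<Longrightarrow> op_adjoint X T \<in> bounded_ops X"
  using adjoint_of_op_adjoint by (auto simp: adjoint_of_def)

lemma op_adjoint_adjoint: "T \<in> bounded_ops X \<Longrightarrow> op_adjoint X (op_adjoint X T) = T"
  by (rule op_adjoint_eqI[OF adjoint_of_sym]) (simp_all add: adjoint_of_op_adjoint)

text \<open>The square of the norm of \<open>T' g\<close> is the inner product of
  \<open>T (T' g)\<close> with \<open>g\<close>; bounding this by Cauchy--Schwarz leaves one factor
  to cancel. The estimate makes norm closures stable under adjoints.\<close>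

lemma op_adjoint_norm:
  assumes T: "T \<in> bounded_ops X"
  shows "op_norm X (op_adjoint X T) \<le> op_norm X T"
proof (rule op_norm_le)
  let ?T' = "op_adjoint X T"
  have a: "adjoint_of X T ?T'" by (rule adjoint_of_op_adjoint[OF T])
  then have T': "?T' \<in> bounded_ops X" by (simp add: adjoint_of_def)
  show "0 \<le> op_norm X T" by (rule op_norm_nonneg[OF T])
  fix g assume g: "g \<in> ell2 X"
  have h: "?T' g \<in> ell2 X" by (rule bounded_ops_ell2[OF T' g])
  let ?n = "ell2_norm X (?T' g)"
  have "?n\<^sup>2 = cmod (ell2_inner X (?T' g) (?T' g))"
    by (simp only: ell2_inner_self[OF h] norm_of_real abs_power2)
  also have "\<dots> = cmod (ell2_inner X (T (?T' g)) g)"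
    using a g h by (simp add: adjoint_of_def)
  also have "\<dots> \<le> ell2_norm X (T (?T' g)) * ell2_norm X g"
    by (intro ell2_inner_summable bounded_ops_ell2[OF T] h g)
  also have "\<dots> \<le> (op_norm X T * ?n) * ell2_norm X g"
    by (intro mult_right_mono ell2_norm_apply_le[OF T h] ell2_norm_nonneg)
  finally have "?n * ?n \<le> (op_norm X T * ell2_norm X g) * ?n"
    by (simp add: power2_eq_square algebra_simps)
  then show "?n \<le> op_norm X T * ell2_norm X g"
    using op_norm_nonneg[OF T] by (cases "?n = 0") (auto simp: ell2_norm_nonneg less_le)
qed

lemma op_adjoint_add:
  assumes S: "S \<in> bounded_ops X" and T: "T \<in> bounded_ops X"
  shows "op_adjoint X (S + T) = op_adjoint X S + op_adjoint X T"
  using adjoint_of_op_adjoint[OF S] adjoint_of_op_adjoint[OF T]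
  by (intro op_adjoint_eqI)
    (auto simp: adjoint_of_def op_add ell2_inner_add_left ell2_inner_add_right
      bounded_ops_ell2[OF S] bounded_ops_ell2[OF T] bounded_ops_ell2)

lemma op_adjoint_scale:
  assumes T: "T \<in> bounded_ops X"
  shows "op_adjoint X (op_scale c T) = op_scale (cnj c) (op_adjoint X T)"
  using adjoint_of_op_adjoint[OF T]
  by (intro op_adjoint_eqI)
    (auto simp: adjoint_of_def op_scale(1), simp add: op_scale_def ell2_inner_scale_left ell2_inner_scale_right)

lemma op_adjoint_diff:
  assumes S: "S \<in> bounded_ops X" and T: "T \<in> bounded_ops X"
  shows "op_adjoint X (S - T) = op_adjoint X S - op_adjoint X T"
proof -
  have "op_adjoint X (S + op_scale (-1) T) = op_adjoint X S + op_scale (-1) (op_adjoint X T)"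
    using op_adjoint_add[OF S op_scale(1)[OF T, of "-1"]] op_adjoint_scale[OF T, of "-1"] by simp
  moreover have "A - B = A + op_scale (-1) B" for A B :: "'a operator"
    by (auto simp: op_scale_def fun_eq_iff)
  ultimately show ?thesis by metis
qed

lemma op_adjoint_comp:
  assumes S: "S \<in> bounded_ops X" and T: "T \<in> bounded_ops X"
  shows "op_adjoint X (S \<circ> T) = op_adjoint X T \<circ> op_adjoint X S"
  using adjoint_of_op_adjoint[OF S] adjoint_of_op_adjoint[OF T]
  by (intro op_adjoint_eqI)
    (auto simp: adjoint_of_def op_comp bounded_ops_ell2[OF T] bounded_ops_ell2)

lemma op_adjoint_zero: "op_adjoint X 0 = 0"
  by (rule op_adjoint_eqI) (auto simp: adjoint_of_def zero_bounded_ops ell2_inner_def)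

section \<open>Generated algebras, positivity and partial injections\<close>

lemma op_span_bounded:
  assumes "G \<subseteq> bounded_ops X"
  shows "op.span G \<subseteq> bounded_ops X"
proof (rule op.span_minimal[OF assms])
  show "op.subspace (bounded_ops X)"
    by (rule op.subspaceI) (auto intro: zero_bounded_ops op_add op_scale)
qed

text \<open>Pointwise sums make composition linear in the outer operator for free, but in the inner
  operator only as far as \<open>g\<close> is linear, that is on \<open>ell2 X\<close>. Hence
  boundedness is carried through the induction, and outside \<open>ell2 X\<close> the value
  \<open>g 0 = 0\<close> is used. Separate sets \<open>G\<close> and \<open>H\<close> allow a
  product to pass through an intermediate span.\<close>

lemma op_span_comp_left:
  assumes g: "g \<in> bounded_ops X" and G: "G \<subseteq> bounded_ops X"
    and gG: "\<And>x. x \<in> G \<Longrightarrow> g \<circ> x \<in> op.span H" and b: "b \<in> op.span G"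
  shows "g \<circ> b \<in> op.span H"
proof -
  have "b \<in> bounded_ops X \<and> g \<circ> b \<in> op.span H"
    using b
  proof (induction rule: op.span_induct_alt)
    case base
    have "g \<circ> 0 = 0" using bounded_ops_zero[OF g] by (simp add: fun_eq_iff)
    then show ?case using op.span_zero[of H] zero_bounded_ops by metis
  next
    case (step c x y)
    have xy: "x \<in> bounded_ops X" "y \<in> bounded_ops X" using step G by auto
    have "g \<circ> (op_scale c x + y) = op_scale c (g \<circ> x) + (g \<circ> y)"
    proof
      fix f
      show "(g \<circ> (op_scale c x + y)) f = (op_scale c (g \<circ> x) + (g \<circ> y)) f"
      proof (cases "f \<in> ell2 X")
        case True
        then show ?thesis
          by (simp add: op_scale_def bounded_opsD[OF g] bounded_opsD[OF xy(1)]
              bounded_opsD[OF xy(2)] ell2_scale)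
      next
        case False
        then show ?thesis
          using bounded_ops_zero[OF g]
          by (simp add: op_scale_def bounded_ops_outside[OF xy(1)] bounded_ops_outside[OF xy(2)]
              zero_fun_def[symmetric])
      qed
    qed
    then have "g \<circ> (op_scale c x + y) \<in> op.span H"
      using step(2) gG[OF step(1)] by (metis op.span_add op.span_scale)
    moreover have "op_scale c x + y \<in> bounded_ops X" by (intro op_add op_scale xy)
    ultimately show ?case by blast
  qed
  then show ?thesis ..
qed

lemma op_span_comp_right:
  assumes "\<And>x. x \<in> G \<Longrightarrow> x \<circ> b \<in> op.span H" and "a \<in> op.span G"
  shows "a \<circ> b \<in> op.span H"
  using assms(2)
proof (induction rule: op.span_induct_alt)
  case base
  have "0 \<circ> b = 0" by (simp add: fun_eq_iff)
  then show ?case using op.span_zero[of H] by metis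
next
  case (step c x y)
  have "(op_scale c x + y) \<circ> b = op_scale c (x \<circ> b) + (y \<circ> b)"
    by (simp add: fun_eq_iff op_scale_def)
  then have "(op_scale c x + y) \<circ> b \<in> op.span H"
    using step(2) assms(1)[OF step(1)] by (metis op.span_add op.span_scale)
  then show ?case .
qed

lemma sum_ops_apply: "(\<Sum>i\<in>I. T i :: 'x operator) f = (\<Sum>i\<in>I. T i f)"
  by (induction I rule: infinite_finite_induct) auto

lemma sum_bounded_ops: "(\<And>i. i \<in> I \<Longrightarrow> T i \<in> bounded_ops Y) \<Longrightarrow> sum T I \<in> bounded_ops Y"
  by (induction I rule: infinite_finite_induct) (auto intro: op_add simp: zero_bounded_ops)

lemma op_span_adjoint:
  assumes G: "G \<subseteq> bounded_ops X" and GA: "\<And>a. a \<in> G \<Longrightarrow> op_adjoint X a \<in> op.span G"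
    and a: "a \<in> op.span G"
  shows "op_adjoint X a \<in> op.span G"
proof -
  have "a \<in> bounded_ops X \<and> op_adjoint X a \<in> op.span G"
    using a
  proof (induction rule: op.span_induct_alt)
    case base
    then show ?case using op.span_zero[of G] op_adjoint_zero[of X] zero_bounded_ops by metis
  next
    case (step c g h)
    have b: "g \<in> bounded_ops X" "h \<in> bounded_ops X" using step G by auto
    have "op_adjoint X (op_scale c g + h) = op_scale (cnj c) (op_adjoint X g) + op_adjoint X h"
      using op_adjoint_add[OF op_scale(1)[OF b(1)] b(2)] op_adjoint_scale[OF b(1)] by simp
    then have "op_adjoint X (op_scale c g + h) \<in> op.span G"
      using step(2) GA[OF step(1)] by (metis op.span_add op.span_scale)
    moreover have "op_scale c g + h \<in> bounded_ops X" by (intro op_add op_scale b)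
    ultimately show ?case by blast
  qed
  then show ?thesis ..
qed

lemma op_closureE:
  assumes "T \<in> op_closure X A" "\<epsilon> > 0"
  obtains a where "a \<in> A" "op_norm X (T - a) < \<epsilon>"
  using assms by (auto simp: op_closure_def)

lemma op_norm_self_diff: "op_norm X (T - T) = 0"
  using op_norm_le[of 0 X 0] op_norm_nonneg[OF zero_bounded_ops[of X]] by simp

lemma op_closure_superset: "A \<subseteq> bounded_ops X \<Longrightarrow> A \<subseteq> op_closure X A"
  unfolding op_closure_def
proof safe
  fix T \<epsilon> assume "T \<in> A" "(0::real) < \<epsilon>"
  then show "\<exists>a\<in>A. op_norm X (T - a) < \<epsilon>"
    by (intro bexI[of _ T]) (simp_all only: op_norm_self_diff)
qed auto

text \<open>\<open>GG\<close> and \<open>GA\<close> make the span itself closed under products and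
  adjoints. The algebraic operations are norm continuous, products on bounded sets, so the closure
  inherits this.\<close>

lemma cstar_subalgebra_closure_span:
  assumes G: "G \<subseteq> bounded_ops X"
    and GG: "\<And>a b. a \<in> G \<Longrightarrow> b \<in> G \<Longrightarrow> a \<circ> b \<in> op.span G"
    and GA: "\<And>a. a \<in> G \<Longrightarrow> op_adjoint X a \<in> op.span G"
  shows "cstar_subalgebra X (op_closure X (op.span G))"
proof -
  let ?L = "op.span G" and ?B = "op_closure X (op.span G)"
  have L: "?L \<subseteq> bounded_ops X" by (rule op_span_bounded[OF G])
  have BB: "?B \<subseteq> bounded_ops X" by (auto simp: op_closure_def)
  \<comment> \<open>Allowing an error \<open>K * \<delta>\<close> lets each operation below use its
    natural constant. The restriction of \<delta> to at most 1 is for products, where it bounds the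
    norm of an approximant.\<close>
  have closI: "T \<in> ?B" if T: "T \<in> bounded_ops X" "K \<ge> 0"
    and approx: "\<And>\<delta>. 0 < \<delta> \<Longrightarrow> \<delta> \<le> 1 \<Longrightarrow> \<exists>a\<in>?L. op_norm X (T - a) \<le> K * \<delta>" for T K
    unfolding op_closure_def
  proof (safe intro!: T(1))
    fix \<epsilon> :: real assume \<epsilon>: "\<epsilon> > 0"
    \<comment> \<open>\<open>K + 1\<close> avoids division by 0, and the factor 2 leaves room for
      the strict inequality.\<close>
    define \<delta> where "\<delta> = min 1 (\<epsilon> / (2 * (K + 1)))"
    have \<delta>: "0 < \<delta>" "\<delta> \<le> 1" using \<epsilon> T(2) by (auto simp: \<delta>_def)
    then obtain a where a: "a \<in> ?L" "op_norm X (T - a) \<le> K * \<delta>" using approx by blast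
    have "K * \<delta> \<le> (K + 1) * (\<epsilon> / (2 * (K + 1)))"
      using T(2) \<delta> by (intro mult_mono) (auto simp: \<delta>_def)
    also have "\<dots> = \<epsilon> / 2" using T(2) by (simp add: field_simps)
    finally show "\<exists>a\<in>?L. op_norm X (T - a) < \<epsilon>" using a \<epsilon> by force
  qed
  show ?thesis
    unfolding cstar_subalgebra_def
  proof (intro conjI ballI allI BB)
    show "0 \<in> ?B" using op_closure_superset[OF L] op.span_zero by blast
  next
    fix S T assume S: "S \<in> ?B" and T: "T \<in> ?B"
    have Sb: "S \<in> bounded_ops X" and Tb: "T \<in> bounded_ops X" using S T BB by auto
    show "S + T \<in> ?B"
    proof (rule closI[where K = 2])
      fix \<delta> :: real assume \<delta>: "0 < \<delta>"
      obtain s where s: "s \<in> ?L" "op_norm X (S - s) < \<delta>" using op_closureE[OF S \<delta>] .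
      obtain t where t: "t \<in> ?L" "op_norm X (T - t) < \<delta>" using op_closureE[OF T \<delta>] .
      have "S + T - (s + t) = (S - s) + (T - t)" by (simp add: algebra_simps)
      then have "op_norm X (S + T - (s + t)) \<le> op_norm X (S - s) + op_norm X (T - t)"
        using op_add(2)[of "S - s" X "T - t"] op_diff(1) s t L Sb Tb by (metis subsetD)
      then have "op_norm X (S + T - (s + t)) \<le> 2 * \<delta>" using s t by simp
      then show "\<exists>a\<in>?L. op_norm X (S + T - a) \<le> 2 * \<delta>"
        using op.span_add[OF s(1) t(1)] by blast
    qed (auto intro: op_add Sb Tb)
    show "S \<circ> T \<in> ?B"
    \<comment> \<open>The constant is read off from S T - s t = S (T - t) + (S - s) t, where the
      norm of \<open>t\<close> is at most \<open>op_norm X T + 1\<close>.\<close>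
    proof (rule closI[where K = "op_norm X S + op_norm X T + 1"])
      fix \<delta> :: real assume \<delta>: "0 < \<delta>" "\<delta> \<le> 1"
      obtain s where s: "s \<in> ?L" "op_norm X (S - s) < \<delta>" using op_closureE[OF S \<delta>(1)] .
      obtain t where t: "t \<in> ?L" "op_norm X (T - t) < \<delta>" using op_closureE[OF T \<delta>(1)] .
      have sb: "s \<in> bounded_ops X" and tb: "t \<in> bounded_ops X" using s t L by auto
      have "op_norm X t = op_norm X (T - (T - t))" by simp
      also have "\<dots> \<le> op_norm X T + op_norm X (T - t)" by (intro op_diff Tb tb)
      finally have nt: "op_norm X t \<le> op_norm X T + 1" using t \<delta> by simp
      have "(S \<circ> T) - (s \<circ> t) = (S \<circ> (T - t)) + ((S - s) \<circ> t)"
      proof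
        fix f
        show "((S \<circ> T) - (s \<circ> t)) f = ((S \<circ> (T - t)) + ((S - s) \<circ> t)) f"
        proof (cases "f \<in> ell2 X")
          case True
          then show ?thesis
            by (simp add: bounded_ops_diff[OF Sb] bounded_ops_ell2[OF Tb] bounded_ops_ell2[OF tb])
        next
          case False
          then show ?thesis
            by (simp add: bounded_ops_outside[OF Tb] bounded_ops_outside[OF tb]
                bounded_ops_zero[OF Sb] bounded_ops_zero[OF sb])
        qed
      qed
      then have "op_norm X ((S \<circ> T) - (s \<circ> t)) \<le>
          op_norm X (S \<circ> (T - t)) + op_norm X ((S - s) \<circ> t)"
        using op_add(2)[OF op_comp(1)[OF Sb op_diff(1)[OF Tb tb]]
            op_comp(1)[OF op_diff(1)[OF Sb sb] tb]] by simp
      also have "\<dots> \<le> op_norm X S * op_norm X (T - t) + op_norm X (S - s) * op_norm X t"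
        by (intro add_mono op_comp op_diff Sb sb Tb tb)
      also have "\<dots> \<le> op_norm X S * \<delta> + \<delta> * (op_norm X T + 1)"
        using s t nt \<delta> by (intro add_mono mult_mono) (auto intro: op_norm_nonneg op_diff Sb Tb tb)
      finally have "op_norm X ((S \<circ> T) - (s \<circ> t)) \<le> (op_norm X S + op_norm X T + 1) * \<delta>"
        by (simp add: algebra_simps)
      then show "\<exists>a\<in>?L. op_norm X ((S \<circ> T) - a) \<le> (op_norm X S + op_norm X T + 1) * \<delta>"
        using op_span_comp_right[OF op_span_comp_left[OF _ G GG t(1)] s(1)] G by blast
    qed (auto intro!: op_comp Sb Tb add_nonneg_nonneg op_norm_nonneg)
  next
    fix c T assume T: "T \<in> ?B"
    have Tb: "T \<in> bounded_ops X" using T BB by auto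
    show "op_scale c T \<in> ?B"
    proof (rule closI[where K = "cmod c"])
      fix \<delta> :: real assume \<delta>: "0 < \<delta>"
      obtain t where t: "t \<in> ?L" "op_norm X (T - t) < \<delta>" using op_closureE[OF T \<delta>] .
      have "op_scale c T - op_scale c t = op_scale c (T - t)"
        by (simp add: op_scale_def fun_eq_iff algebra_simps)
      moreover have "op_norm X (op_scale c (T - t)) \<le> cmod c * op_norm X (T - t)"
        using t L by (intro op_scale op_diff Tb) auto
      moreover have "cmod c * op_norm X (T - t) \<le> cmod c * \<delta>"
        using t by (intro mult_left_mono) auto
      ultimately show "\<exists>a\<in>?L. op_norm X (op_scale c T - a) \<le> cmod c * \<delta>"
        using t by (intro bexI[of _ "op_scale c t"]) (auto simp: op.span_scale)
    qed (auto intro: op_scale Tb)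
  next
    fix T assume T: "T \<in> ?B"
    have Tb: "T \<in> bounded_ops X" using T BB by auto
    show "op_adjoint X T \<in> ?B"
    proof (rule closI[where K = 1])
      fix \<delta> :: real assume \<delta>: "0 < \<delta>"
      obtain t where t: "t \<in> ?L" "op_norm X (T - t) < \<delta>" using op_closureE[OF T \<delta>] .
      have tb: "t \<in> bounded_ops X" using t L by auto
      have "op_norm X (op_adjoint X T - op_adjoint X t) \<le> op_norm X (T - t)"
        using op_adjoint_norm[OF op_diff(1)[OF Tb tb]] by (simp add: op_adjoint_diff Tb tb)
      then show "\<exists>a\<in>?L. op_norm X (op_adjoint X T - a) \<le> 1 * \<delta>"
        using t op_span_adjoint[OF G GA t(1)] by (intro bexI[of _ "op_adjoint X t"]) auto
    qed (auto intro: op_adjoint_bounded_ops Tb)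
  next
    show "op_closure X ?B \<subseteq> ?B"
    proof
      fix T assume T: "T \<in> op_closure X ?B"
      then have Tb: "T \<in> bounded_ops X" by (auto simp: op_closure_def)
      show "T \<in> ?B"
      proof (rule closI[where K = 2])
        fix \<delta> :: real assume \<delta>: "0 < \<delta>"
        obtain s where s: "s \<in> ?B" "op_norm X (T - s) < \<delta>" using op_closureE[OF T \<delta>] .
        obtain t where t: "t \<in> ?L" "op_norm X (s - t) < \<delta>" using op_closureE[OF s(1) \<delta>] .
        have "op_norm X ((T - s) + (s - t)) \<le> op_norm X (T - s) + op_norm X (s - t)"
          using s t BB L by (intro op_add op_diff Tb) auto
        then show "\<exists>a\<in>?L. op_norm X (T - a) \<le> 2 * \<delta>"
          using s t by (intro bexI[of _ t]) auto
      qed (auto intro: Tb)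
    qed
  qed
qed

text \<open>An intersection over an empty family would contain every function, so a member
  \<open>A\<close> must be at hand to place the generated algebra inside
  \<open>bounded_ops X\<close>. The remaining closure properties hold in each member and pass to the
  intersection.\<close>

lemma cstar_subalgebra_generated:
  assumes "cstar_subalgebra X A" "G \<subseteq> A"
  shows "cstar_subalgebra X (cstar_generated X G)" "G \<subseteq> cstar_generated X G"
    "cstar_generated X G \<subseteq> A"
proof -
  let ?C = "cstar_generated X G"
  show GC: "G \<subseteq> ?C" and CA: "?C \<subseteq> A" using assms by (auto simp: cstar_generated_def)
  have "op_closure X ?C \<subseteq> op_closure X B" if "cstar_subalgebra X B" "G \<subseteq> B" for B
    using that unfolding op_closure_def cstar_generated_def by blast
  then have "op_closure X ?C \<subseteq> ?C"
    unfolding cstar_generated_def using cstar_subalgebra_def by blast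
  moreover have "?C \<subseteq> bounded_ops X" using CA assms by (auto simp: cstar_subalgebra_def)
  ultimately show "cstar_subalgebra X ?C"
    unfolding cstar_subalgebra_def by (auto simp: cstar_generated_def cstar_subalgebra_def)
qed

text \<open>Cauchy--Schwarz for the form \<open>(f, g) \<mapsto> \<langle>T f, g\<rangle>\<close>, by testing on \<open>\<xi>\<^sub>x + c \<xi>\<^sub>y\<close> with \<open>c\<close> a fourth root of unity.\<close>

lemma op_positive_zero_diagonal:
  assumes T: "T \<in> bounded_ops X" and pos: "op_positive X T"
    and diag: "\<And>x. x \<in> X \<Longrightarrow> T (basis_vec x) x = 0"
  shows "T = 0"
proof (rule bounded_ops_eqI[OF T zero_bounded_ops])
  fix x assume x: "x \<in> X"
  have "T (basis_vec x) y = 0" for y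
  proof (cases "y \<in> X")
    case y: True
    define u where "u = T (basis_vec y) x"
    define w where "w = T (basis_vec x) y"
    have nn: "c * u + cnj c * w \<in> \<real>\<^sub>\<ge>\<^sub>0" for c
    proof -
      let ?cy = "\<lambda>z. c * basis_vec y z"
      have cy: "?cy \<in> ell2 X" "T (basis_vec x) \<in> ell2 X" "T ?cy \<in> ell2 X"
        using x y by (auto intro!: ell2_scale bounded_ops_ell2[OF T])
      have "ell2_inner X (T (basis_vec x + ?cy)) (basis_vec x + ?cy) \<in> \<real>\<^sub>\<ge>\<^sub>0"
        using pos ell2_add(1)[OF _ cy(1)] x by (simp add: op_positive_def)
      also have "ell2_inner X (T (basis_vec x + ?cy)) (basis_vec x + ?cy) = c * u + cnj c * w"
        using x y cy diag[OF x] diag[OF y]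
        by (simp add: bounded_ops_add[OF T] ell2_inner_add_left ell2_inner_add_right ell2_add
            ell2_inner_scale_right ell2_inner_basis bounded_ops_scale[OF T] u_def w_def)
      finally show ?thesis .
    qed
    \<comment> \<open>Replacing \<open>c\<close> by \<open>-c\<close> changes the sign, and both
      values are nonnegative reals. The choices 1 and \<i> then separate \<open>u\<close> from
      \<open>w\<close>.\<close>
    have z: "c * u + cnj c * w = 0" for c
      using nn[of c] nn[of "-c"]
      by (auto simp: complex_nonneg_Reals_iff complex_eq_iff)
    have "u + w = 0" "\<i> * u - \<i> * w = 0" using z[of 1] z[of \<i>] by simp_all
    then have "w = 0" by (auto simp: complex_eq_iff)
    then show ?thesis by (simp add: w_def)
  next
    case False
    then show ?thesis using ell2_vanish[OF bounded_ops_ell2[OF T]] x by simp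
  qed
  then show "T (basis_vec x) = 0 (basis_vec x)" by (simp add: fun_eq_iff)
qed

text \<open>Composing with the inverse of \<open>\<phi>\<close>, instead of extending from basis
  vectors, defines the operator on all of \<open>ell2 X\<close> without a limit. Injectivity lets
  the finite sums be reindexed, so the norm does not increase.\<close>

lemma partial_injection_op_exists:
  fixes \<phi> :: "'x \<Rightarrow> 'x"
  assumes A: "A \<subseteq> X" and inj: "inj_on \<phi> A" and im: "\<phi> ` A \<subseteq> X"
  shows "\<exists>T. T \<in> bounded_ops X \<and>
    (\<forall>x\<in>X. T (basis_vec x) = (if x \<in> A then basis_vec (\<phi> x) else 0))"
proof -
  define \<psi> where "\<psi> = inv_into A \<phi>"
  define T :: "'x operator" where
    "T = (\<lambda>f z. if f \<in> ell2 X \<and> z \<in> \<phi> ` A then f (\<psi> z) else 0)"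
  have \<psi>: "\<psi> (\<phi> x) = x" if "x \<in> A" for x using that inj by (simp add: \<psi>_def)
  have v: "T f z = 0" if "z \<notin> X" for f z using that im by (auto simp: T_def)
  have n: "L2_set (\<lambda>z. cmod (T f z)) F \<le> ell2_norm X f"
    if f: "f \<in> ell2 X" and F: "finite F" "F \<subseteq> X" for f F
  proof -
    let ?F = "F \<inter> \<phi> ` A"
    have "L2_set (\<lambda>z. cmod (T f z)) F = sqrt (\<Sum>z\<in>?F. (cmod (f (\<psi> z)))\<^sup>2)"
      unfolding L2_set_def using F f
      by (intro arg_cong[where f = sqrt] sum.mono_neutral_cong_right) (auto simp: T_def)
    also have "(\<Sum>z\<in>?F. (cmod (f (\<psi> z)))\<^sup>2) = (\<Sum>x\<in>\<psi> ` ?F. (cmod (f x))\<^sup>2)"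
    proof (rule sum.reindex_cong[symmetric, where l = \<psi>])
      show "inj_on \<psi> ?F" by (rule inj_onI) (auto simp: \<psi>)
    qed auto
    also have "sqrt \<dots> = L2_set (\<lambda>x. cmod (f x)) (\<psi> ` ?F)" by (simp add: L2_set_def)
    also have "\<dots> \<le> ell2_norm X f"
      using F A by (intro L2_set_le_ell2_norm f) (auto simp: \<psi>)
    finally show ?thesis .
  qed
  have "T \<in> bounded_ops X"
  proof (rule bounded_opsI[where C = 1])
    show "T f \<in> ell2 X" "ell2_norm X (T f) \<le> 1 * ell2_norm X f" if "f \<in> ell2 X" for f
      using ell2I[OF v n[OF that]] by simp_all
  qed (auto simp: T_def fun_eq_iff ell2_add ell2_scale)
  moreover have "T (basis_vec x) = (if x \<in> A then basis_vec (\<phi> x) else 0)" if "x \<in> X" for x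
    using that basis_vec_ell2[OF that] inj_onD[OF inj]
    by (auto simp: T_def fun_eq_iff \<psi>) (auto simp: basis_vec_def \<psi>)
  ultimately show ?thesis by blast
qed

lemma op_adjoint_basis_entry:
  assumes "T \<in> bounded_ops X" "x \<in> X" "z \<in> X"
  shows "op_adjoint X T (basis_vec z) x = cnj (T (basis_vec x) z)"
  using adjoint_of_entry[OF adjoint_of_op_adjoint[OF assms(1)] _ assms(2), of "basis_vec z"] assms
  by (simp add: ell2_inner_basis)

section \<open>Factorization and common extensions\<close>

lemma Nk_diff: "m \<in> Nk k \<Longrightarrow> m - n \<in> Nk k"
  and Nk_le: "n \<in> Nk k \<Longrightarrow> m \<le> n \<Longrightarrow> m \<in> Nk k"
  by (auto simp: Nk_def le_fun_def) (metis le_zero_eq)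

text \<open>A multi-index below the degree of a path lies in \<open>Nk k\<close> automatically; this
  keeps such side conditions out of the path lemmas.\<close>

lemma Nk_inf_le: "d \<in> Nk_inf k \<Longrightarrow> enatv n \<le> d \<Longrightarrow> n \<in> Nk k"
  by (auto simp: Nk_def Nk_inf_def le_fun_def) (metis enat_0_iff(1) le_zero_eq)

lemma add_diff_cancel_fun: "p \<le> q \<Longrightarrow> p + (q - p) = (q :: nat \<Rightarrow> nat)"
  by (auto simp: le_fun_def fun_eq_iff)

lemma zero_le_natv [simp]: "(0 :: nat \<Rightarrow> nat) \<le> p"
  by (simp add: le_fun_def)

lemma le_add_natv [simp]: "(p :: nat \<Rightarrow> nat) \<le> p + q" "q \<le> p + q"
  by (auto simp: le_fun_def)

lemma enatv_0 [simp]: "enatv 0 \<le> d"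
  by (simp add: le_fun_def zero_enat_def[symmetric])

lemma enatv_mono: "enatv q \<le> d \<Longrightarrow> p \<le> q \<Longrightarrow> enatv p \<le> d"
  by (auto simp: le_fun_def) (meson enat_ord_simps(1) order_trans)

lemma enatv_sup: "enatv p \<le> d \<Longrightarrow> enatv q \<le> d \<Longrightarrow> enatv (sup p q) \<le> d"
  by (auto simp: le_fun_def sup_max max_def)

text \<open>The premise excludes truncation, under which the left side would hold for
  \<open>p = 0\<close> whatever \<open>n\<close> is.\<close>

lemma enat_add_le_iff: "enat n \<le> d \<Longrightarrow> enat p \<le> d - enat n \<longleftrightarrow> enat (n + p) \<le> d"
  by (cases d) auto

lemma enatv_add_le_iff: "enatv n \<le> d \<Longrightarrow> enatv p \<le> d - enatv n \<longleftrightarrow> enatv (n + p) \<le> d"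
  by (simp add: le_fun_def enat_add_le_iff)

lemma enatv_diff_diff: "d - enatv m - enatv n = d - enatv (m + n)"
proof
  fix i show "(d - enatv m - enatv n) i = (d - enatv (m + n)) i" by (cases "d i") auto
qed

lemma enatv_add_diff [simp]: "d + enatv n - enatv n = d"
proof
  fix i show "(d + enatv n - enatv n) i = d i" by (cases "d i") auto
qed

lemma enatv_diff_add [simp]: "enatv n \<le> d \<Longrightarrow> d - enatv n + enatv n = d"
proof
  fix i assume "enatv n \<le> d"
  then have "enat (n i) \<le> d i" by (simp add: le_fun_def)
  then show "(d - enatv n + enatv n) i = d i" by (cases "d i") auto
qed

lemma enatv_le_add [simp]: "enatv n \<le> d + enatv n"
  by (simp add: le_fun_def)

lemma enatv_le_add_iff: "enatv (n + p) \<le> d + enatv n \<longleftrightarrow> enatv p \<le> d"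
  using enatv_add_le_iff[of n "d + enatv n" p] by simp

lemma Nk_inf_add: "d \<in> Nk_inf k \<Longrightarrow> n \<in> Nk k \<Longrightarrow> d + enatv n \<in> Nk_inf k"
  and Nk_inf_diff: "d \<in> Nk_inf k \<Longrightarrow> d - enatv n \<in> Nk_inf k"
  by (auto simp: Nk_inf_def Nk_def zero_enat_def[symmetric])

locale finitely_aligned_kgraph =
  fixes k :: nat and \<Lambda> :: "'a graded_category"
  assumes kgraph: "kgraph k \<Lambda>" and finitely_aligned: "finitely_aligned \<Lambda>"
begin

text \<open>
  The simplifier would push pointwise arithmetic under the abstraction hidden in \<^term>\<open>enatv\<close>
  and thereby block unification.
\<close>

lemmas pointwise = plus_fun_apply minus_apply zero_fun_apply sup_apply

declare pointwise [simp del]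

abbreviation dot (infixr "\<cdot>" 70) where "\<mu> \<cdot> \<nu> \<equiv> cat_comp \<Lambda> \<mu> \<nu>"

lemma identities:
  assumes "\<eta> \<in> Mor \<Lambda>"
  shows "rng \<Lambda> \<eta> \<in> Mor \<Lambda>" "src \<Lambda> \<eta> \<in> Mor \<Lambda>"
    "rng \<Lambda> (rng \<Lambda> \<eta>) = rng \<Lambda> \<eta>" "src \<Lambda> (rng \<Lambda> \<eta>) = rng \<Lambda> \<eta>"
    "rng \<Lambda> (src \<Lambda> \<eta>) = src \<Lambda> \<eta>" "src \<Lambda> (src \<Lambda> \<eta>) = src \<Lambda> \<eta>"
    "rng \<Lambda> \<eta> \<cdot> \<eta> = \<eta>" "\<eta> \<cdot> src \<Lambda> \<eta> = \<eta>"
    "deg \<Lambda> (rng \<Lambda> \<eta>) = 0" "deg \<Lambda> (src \<Lambda> \<eta>) = 0" "deg \<Lambda> \<eta> \<in> Nk k"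
  using kgraph assms by (auto simp: kgraph_def is_category_def)

lemma composites:
  assumes "\<mu> \<in> Mor \<Lambda>" "\<nu> \<in> Mor \<Lambda>" "src \<Lambda> \<mu> = rng \<Lambda> \<nu>"
  shows "\<mu> \<cdot> \<nu> \<in> Mor \<Lambda>" "rng \<Lambda> (\<mu> \<cdot> \<nu>) = rng \<Lambda> \<mu>" "src \<Lambda> (\<mu> \<cdot> \<nu>) = src \<Lambda> \<nu>"
    "deg \<Lambda> (\<mu> \<cdot> \<nu>) = deg \<Lambda> \<mu> + deg \<Lambda> \<nu>"
  using kgraph assms by (auto simp: kgraph_def is_category_def)

lemma dot_assoc:
  assumes "\<eta> \<in> Mor \<Lambda>" "\<mu> \<in> Mor \<Lambda>" "\<nu> \<in> Mor \<Lambda>" "src \<Lambda> \<eta> = rng \<Lambda> \<mu>" "src \<Lambda> \<mu> = rng \<Lambda> \<nu>"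
  shows "(\<eta> \<cdot> \<mu>) \<cdot> \<nu> = \<eta> \<cdot> \<mu> \<cdot> \<nu>"
  using kgraph assms by (auto simp: kgraph_def is_category_def)

lemma factorization:
  assumes "\<eta> \<in> Mor \<Lambda>" "m \<in> Nk k" "n \<in> Nk k" "deg \<Lambda> \<eta> = m + n"
  shows "\<exists>!(\<mu>, \<nu>). \<mu> \<in> Mor \<Lambda> \<and> \<nu> \<in> Mor \<Lambda> \<and> src \<Lambda> \<mu> = rng \<Lambda> \<nu> \<and>
           \<eta> = \<mu> \<cdot> \<nu> \<and> deg \<Lambda> \<mu> = m \<and> deg \<Lambda> \<nu> = n"
  using kgraph assms unfolding kgraph_def by blast

lemma factorization_exists:
  assumes "\<eta> \<in> Mor \<Lambda>" "p \<le> deg \<Lambda> \<eta>"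
  obtains \<mu> \<nu> where "\<mu> \<in> Mor \<Lambda>" "\<nu> \<in> Mor \<Lambda>" "src \<Lambda> \<mu> = rng \<Lambda> \<nu>" "\<eta> = \<mu> \<cdot> \<nu>" "deg \<Lambda> \<mu> = p"
proof -
  have "deg \<Lambda> \<eta> = p + (deg \<Lambda> \<eta> - p)" using assms(2) by (simp add: add_diff_cancel_fun)
  then show thesis
    using factorization[OF assms(1), of p "deg \<Lambda> \<eta> - p"] that identities(11)[OF assms(1)] assms(2)
    by (auto intro: Nk_le Nk_diff dest: ex1_implies_ex)
qed

text \<open>The factorization property prescribes both degrees; that of the second factor is
  recovered by cancelling in the additive monoid. With equal first factors this is left cancellation
  in the category.\<close>

lemma factorization_unique:
  assumes "\<mu> \<in> Mor \<Lambda>" "\<nu> \<in> Mor \<Lambda>" "src \<Lambda> \<mu> = rng \<Lambda> \<nu>"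
    "\<mu>' \<in> Mor \<Lambda>" "\<nu>' \<in> Mor \<Lambda>" "src \<Lambda> \<mu>' = rng \<Lambda> \<nu>'"
    "\<mu> \<cdot> \<nu> = \<mu>' \<cdot> \<nu>'" "deg \<Lambda> \<mu> = deg \<Lambda> \<mu>'"
  shows "\<mu> = \<mu>'" "\<nu> = \<nu>'"
proof -
  have d: "deg \<Lambda> (\<mu> \<cdot> \<nu>) = deg \<Lambda> \<mu> + deg \<Lambda> \<nu>" by (rule composites(4)[OF assms(1-3)])
  have "deg \<Lambda> \<mu> + deg \<Lambda> \<nu> = deg \<Lambda> \<mu>' + deg \<Lambda> \<nu>'"
    using d composites(4)[OF assms(4-6)] assms(7) by simp
  then have "deg \<Lambda> \<nu> = deg \<Lambda> \<nu>'" using assms(8) by simp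
  then have "(\<mu>, \<nu>) = (\<mu>', \<nu>')"
    using assms
    by (intro Uniq_D[OF ex1_iff_ex_Uniq[THEN iffD1, THEN conjunct2,
            OF factorization[OF composites(1)[OF assms(1-3)] identities(11)[OF assms(1)]
            identities(11)[OF assms(2)] d]]]) auto
  then show "\<mu> = \<mu>'" "\<nu> = \<nu>'" by auto
qed

text \<open>Composing \<open>\<eta>\<close> with its range identity and with its source identity
  gives two factorizations of \<open>\<eta>\<close> whose first factors both have degree 0.\<close>

lemma deg_zero_identity:
  assumes "\<eta> \<in> Mor \<Lambda>" "deg \<Lambda> \<eta> = 0"
  shows "rng \<Lambda> \<eta> = \<eta>" "src \<Lambda> \<eta> = \<eta>"
  using factorization_unique[of "rng \<Lambda> \<eta>" \<eta> \<eta> "src \<Lambda> \<eta>"] identities[OF assms(1)] assms by auto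

section \<open>Initial segments of morphisms and minimal common extensions\<close>

definition prefix :: "'a \<Rightarrow> 'a \<Rightarrow> bool" where
  "prefix \<mu> \<eta> \<longleftrightarrow> \<mu> \<in> Mor \<Lambda> \<and> (\<exists>\<nu>\<in>Mor \<Lambda>. src \<Lambda> \<mu> = rng \<Lambda> \<nu> \<and> \<eta> = \<mu> \<cdot> \<nu>)"

lemma prefixI: "\<mu> \<in> Mor \<Lambda> \<Longrightarrow> \<nu> \<in> Mor \<Lambda> \<Longrightarrow> src \<Lambda> \<mu> = rng \<Lambda> \<nu> \<Longrightarrow> prefix \<mu> (\<mu> \<cdot> \<nu>)"
  by (auto simp: prefix_def)

lemma prefixE:
  assumes "prefix \<mu> \<eta>"
  obtains \<nu> where "\<mu> \<in> Mor \<Lambda>" "\<nu> \<in> Mor \<Lambda>" "src \<Lambda> \<mu> = rng \<Lambda> \<nu>" "\<eta> = \<mu> \<cdot> \<nu>"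
  using assms by (auto simp: prefix_def)

lemma prefixD:
  assumes "prefix \<mu> \<eta>"
  shows "\<mu> \<in> Mor \<Lambda>" "\<eta> \<in> Mor \<Lambda>" "rng \<Lambda> \<mu> = rng \<Lambda> \<eta>" "deg \<Lambda> \<mu> \<le> deg \<Lambda> \<eta>"
  using assms composites by (auto simp: prefix_def)

lemma prefix_refl: "\<eta> \<in> Mor \<Lambda> \<Longrightarrow> prefix \<eta> \<eta>"
  using prefixI[of \<eta> "src \<Lambda> \<eta>"] by (simp add: identities)

lemma prefix_trans:
  assumes "prefix \<mu> \<nu>" "prefix \<nu> \<eta>"
  shows "prefix \<mu> \<eta>"
proof -
  obtain \<alpha> where \<alpha>: "\<mu> \<in> Mor \<Lambda>" "\<alpha> \<in> Mor \<Lambda>" "src \<Lambda> \<mu> = rng \<Lambda> \<alpha>" "\<nu> = \<mu> \<cdot> \<alpha>"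
    using assms(1) by (rule prefixE)
  obtain \<beta> where \<beta>: "\<nu> \<in> Mor \<Lambda>" "\<beta> \<in> Mor \<Lambda>" "src \<Lambda> \<nu> = rng \<Lambda> \<beta>" "\<eta> = \<nu> \<cdot> \<beta>"
    using assms(2) by (rule prefixE)
  have s: "src \<Lambda> \<alpha> = rng \<Lambda> \<beta>" using \<alpha> \<beta> by (simp add: composites)
  have "\<eta> = \<mu> \<cdot> \<alpha> \<cdot> \<beta>" using \<alpha> \<beta> s by (simp add: dot_assoc)
  then show ?thesis using prefixI[of \<mu> "\<alpha> \<cdot> \<beta>"] \<alpha> \<beta> s by (simp add: composites)
qed

lemma prefix_deg_unique:
  assumes "prefix \<mu> \<eta>" "prefix \<nu> \<eta>" "deg \<Lambda> \<mu> = deg \<Lambda> \<nu>"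
  shows "\<mu> = \<nu>"
  using assms by (auto elim!: prefixE dest: factorization_unique)

lemma prefix_of_deg:
  assumes "\<eta> \<in> Mor \<Lambda>" "p \<le> deg \<Lambda> \<eta>"
  shows "\<exists>\<mu>. prefix \<mu> \<eta> \<and> deg \<Lambda> \<mu> = p"
  using factorization_exists[OF assms] prefixI by metis

text \<open>The segment of \<open>\<nu>\<close> of degree \<open>deg \<Lambda> \<mu>\<close> is also
  a segment of \<open>\<eta>\<close>, and segments of a fixed morphism are determined by their
  degrees.\<close>

lemma prefix_linear:
  assumes "prefix \<mu> \<eta>" "prefix \<nu> \<eta>" "deg \<Lambda> \<mu> \<le> deg \<Lambda> \<nu>"
  shows "prefix \<mu> \<nu>"
proof -
  obtain \<mu>' where "prefix \<mu>' \<nu>" "deg \<Lambda> \<mu>' = deg \<Lambda> \<mu>"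
    using prefix_of_deg[OF prefixD(1)[OF assms(2)] assms(3)] by blast
  moreover have "\<mu>' = \<mu>"
    using calculation assms by (intro prefix_deg_unique[of _ \<eta>]) (auto intro: prefix_trans)
  ultimately show ?thesis by simp
qed

lemma prefix_left_cancel:
  assumes "prefix (\<kappa> \<cdot> \<alpha>) (\<kappa> \<cdot> \<beta>)" "\<kappa> \<in> Mor \<Lambda>" "\<alpha> \<in> Mor \<Lambda>" "\<beta> \<in> Mor \<Lambda>"
    "src \<Lambda> \<kappa> = rng \<Lambda> \<alpha>" "src \<Lambda> \<kappa> = rng \<Lambda> \<beta>"
  shows "prefix \<alpha> \<beta>"
proof -
  obtain \<gamma> where \<gamma>: "\<gamma> \<in> Mor \<Lambda>" "src \<Lambda> (\<kappa> \<cdot> \<alpha>) = rng \<Lambda> \<gamma>" "\<kappa> \<cdot> \<beta> = (\<kappa> \<cdot> \<alpha>) \<cdot> \<gamma>"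
    using assms(1) by (rule prefixE)
  have s: "src \<Lambda> \<alpha> = rng \<Lambda> \<gamma>" using \<gamma> assms by (simp add: composites)
  have "\<kappa> \<cdot> \<beta> = \<kappa> \<cdot> \<alpha> \<cdot> \<gamma>" using \<gamma> s assms by (simp add: dot_assoc)
  then have "\<beta> = \<alpha> \<cdot> \<gamma>"
    using factorization_unique(2)[of \<kappa> \<beta> \<kappa> "\<alpha> \<cdot> \<gamma>"] assms \<gamma> s by (simp add: composites)
  then show ?thesis using prefixI assms \<gamma> s by blast
qed

lemma MCE_iff:
  assumes "\<mu> \<in> Mor \<Lambda>" "\<nu> \<in> Mor \<Lambda>"
  shows "\<eta> \<in> MCE \<Lambda> \<mu> \<nu> \<longleftrightarrow> prefix \<mu> \<eta> \<and> prefix \<nu> \<eta> \<and> deg \<Lambda> \<eta> = sup (deg \<Lambda> \<mu>) (deg \<Lambda> \<nu>)"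
  using assms prefixD(2)[of \<mu> \<eta>] unfolding MCE_def prefix_def by blast

text \<open>Cut \<open>\<eta>\<close> at the join of the two degrees; \<open>prefix_linear\<close>
  puts both segments below the cut. Nonemptiness of \<open>MCE\<close> can therefore be tested with
  any common extension.\<close>

lemma MCE_of_common_extension:
  assumes "prefix \<mu> \<eta>" "prefix \<nu> \<eta>"
  shows "\<exists>\<omega>\<in>MCE \<Lambda> \<mu> \<nu>. prefix \<omega> \<eta>"
proof -
  note d = prefixD[OF assms(1)] prefixD[OF assms(2)]
  obtain \<omega> where \<omega>: "prefix \<omega> \<eta>" "deg \<Lambda> \<omega> = sup (deg \<Lambda> \<mu>) (deg \<Lambda> \<nu>)"
    using prefix_of_deg[of \<eta> "sup (deg \<Lambda> \<mu>) (deg \<Lambda> \<nu>)"] d by auto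
  then have "prefix \<mu> \<omega>" "prefix \<nu> \<omega>" using assms by (auto intro: prefix_linear)
  then show ?thesis using \<omega> d by (auto simp: MCE_iff)
qed

text \<open>The set \<open>Ext(\<kappa>; E)\<close> of the literature.\<close>

definition extenders :: "'a \<Rightarrow> 'a set \<Rightarrow> 'a set" where
  "extenders \<kappa> E = {\<alpha> \<in> paths_from \<Lambda> (src \<Lambda> \<kappa>). \<exists>\<mu>\<in>E. \<kappa> \<cdot> \<alpha> \<in> MCE \<Lambda> \<kappa> \<mu>}"

text \<open>Finiteness: composition with \<open>\<kappa>\<close> maps the extenders injectively into
  finitely many \<open>MCE\<close> sets, each finite by alignment. Exhaustiveness: for a given
  \<open>\<beta>\<close>, some \<open>\<mu>\<close> in \<open>E\<close> has a common extension
  \<open>\<omega>\<close> with \<open>\<kappa> \<cdot> \<beta>\<close>. Cutting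
  \<open>\<omega>\<close> to an element of \<open>MCE \<Lambda> \<kappa> \<mu>\<close> and
  cancelling \<open>\<kappa>\<close> produces an extender that has a common extension with
  \<open>\<beta>\<close>.\<close>

lemma extenders_FE:
  assumes "E \<in> FE \<Lambda> v" "\<kappa> \<in> paths_from \<Lambda> v"
  shows "extenders \<kappa> E \<in> FE \<Lambda> (src \<Lambda> \<kappa>)"
proof -
  have \<kappa>: "\<kappa> \<in> Mor \<Lambda>" "rng \<Lambda> \<kappa> = v" using assms(2) by (auto simp: paths_from_def)
  have E: "finite E" "E \<subseteq> Mor \<Lambda>"
    and ex: "\<And>\<mu>. \<mu> \<in> paths_from \<Lambda> v \<Longrightarrow> \<exists>\<eta>\<in>E. MCE \<Lambda> \<mu> \<eta> \<noteq> {}"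
    using assms(1) by (auto simp: FE_def exhaustive_def paths_from_def)
  have "inj_on (dot \<kappa>) (extenders \<kappa> E)"
    using \<kappa> by (auto intro!: inj_onI simp: extenders_def paths_from_def intro: factorization_unique(2)[of \<kappa> _ \<kappa>])
  moreover have "dot \<kappa> ` extenders \<kappa> E \<subseteq> (\<Union>\<mu>\<in>E. MCE \<Lambda> \<kappa> \<mu>)" by (auto simp: extenders_def)
  moreover have "finite (\<Union>\<mu>\<in>E. MCE \<Lambda> \<kappa> \<mu>)"
    using finitely_aligned E \<kappa> by (auto simp: finitely_aligned_def)
  ultimately have "finite (extenders \<kappa> E)" by (meson finite_imageD finite_subset)
  moreover have "\<exists>\<alpha>\<in>extenders \<kappa> E. MCE \<Lambda> \<beta> \<alpha> \<noteq> {}" if "\<beta> \<in> paths_from \<Lambda> (src \<Lambda> \<kappa>)" for \<beta>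
  proof -
    have \<beta>: "\<beta> \<in> Mor \<Lambda>" "rng \<Lambda> \<beta> = src \<Lambda> \<kappa>" using that by (auto simp: paths_from_def)
    have "\<kappa> \<cdot> \<beta> \<in> paths_from \<Lambda> v" using \<kappa> \<beta> composites by (simp add: paths_from_def)
    then obtain \<mu> \<omega> where \<mu>: "\<mu> \<in> E" "\<omega> \<in> MCE \<Lambda> (\<kappa> \<cdot> \<beta>) \<mu>" using ex by blast
    have \<mu>M: "\<mu> \<in> Mor \<Lambda>" using \<mu> E by auto
    have pre: "prefix (\<kappa> \<cdot> \<beta>) \<omega>" "prefix \<mu> \<omega>"
      using \<mu> \<mu>M \<kappa> \<beta> composites by (auto simp: MCE_iff)
    have \<kappa>\<omega>: "prefix \<kappa> \<omega>" using prefix_trans[OF prefixI pre(1)] \<kappa> \<beta> by simp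
    then obtain \<gamma> where \<gamma>: "\<gamma> \<in> Mor \<Lambda>" "src \<Lambda> \<kappa> = rng \<Lambda> \<gamma>" "\<omega> = \<kappa> \<cdot> \<gamma>" by (rule prefixE)
    obtain \<zeta> where \<zeta>: "\<zeta> \<in> MCE \<Lambda> \<kappa> \<mu>" "prefix \<zeta> \<omega>"
      using MCE_of_common_extension[OF \<kappa>\<omega> pre(2)] by blast
    then have "prefix \<kappa> \<zeta>" using \<kappa> \<mu>M by (simp add: MCE_iff)
    then obtain \<alpha> where \<alpha>: "\<alpha> \<in> Mor \<Lambda>" "src \<Lambda> \<kappa> = rng \<Lambda> \<alpha>" "\<zeta> = \<kappa> \<cdot> \<alpha>" by (rule prefixE)
    have "prefix \<alpha> \<gamma>" "prefix \<beta> \<gamma>"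
      using \<alpha> \<gamma> \<beta> \<kappa> \<zeta> pre by (auto intro: prefix_left_cancel)
    then have "MCE \<Lambda> \<beta> \<alpha> \<noteq> {}" using MCE_of_common_extension by blast
    moreover have "\<alpha> \<in> extenders \<kappa> E" using \<alpha> \<zeta> \<mu> by (auto simp: extenders_def paths_from_def)
    ultimately show ?thesis by blast
  qed
  ultimately show ?thesis by (auto simp: FE_def exhaustive_def extenders_def)
qed

section \<open>Paths, shifts and prepending\<close>

lemma pathsD:
  assumes x: "x \<in> paths k \<Lambda>"
  shows paths_deg: "pdeg x \<in> Nk_inf k"
    and paths_seg: "p \<le> q \<Longrightarrow> enatv q \<le> pdeg x \<Longrightarrow>
      pseg x p q \<in> Mor \<Lambda> \<and> deg \<Lambda> (pseg x p q) = q - p \<and>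
      rng \<Lambda> (pseg x p q) = pseg x p p \<and> src \<Lambda> (pseg x p q) = pseg x q q"
    and paths_comp: "p \<le> q \<Longrightarrow> q \<le> r \<Longrightarrow> enatv r \<le> pdeg x \<Longrightarrow>
      pseg x p r = pseg x p q \<cdot> pseg x q r"
    and paths_outside: "\<not> (p \<le> q \<and> enatv q \<le> pdeg x) \<Longrightarrow> pseg x p q = undefined"
proof -
  let ?O = "Omega k (pdeg x)"
  show d: "pdeg x \<in> Nk_inf k" using x by (simp add: paths_def)
  have Mor: "(p, q) \<in> Mor ?O \<longleftrightarrow> p \<le> q \<and> enatv q \<le> pdeg x" for p q
    using Nk_inf_le[OF d] Nk_le by (auto simp: Omega_def)
  have F: "graded_functor ?O \<Lambda> (snd x)" using x by (simp add: paths_def)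
  show "pseg x p q \<in> Mor \<Lambda> \<and> deg \<Lambda> (pseg x p q) = q - p \<and>
      rng \<Lambda> (pseg x p q) = pseg x p p \<and> src \<Lambda> (pseg x p q) = pseg x q q"
    if "p \<le> q" "enatv q \<le> pdeg x"
  proof -
    have pq: "(p, q) \<in> Mor ?O" using that Mor by simp
    have "pseg x p q \<in> Mor \<Lambda>"
      using F pq by (auto simp: graded_functor_def)
    moreover have "snd x (rng ?O (p, q)) = rng \<Lambda> (pseg x p q) \<and>
        snd x (src ?O (p, q)) = src \<Lambda> (pseg x p q) \<and> deg \<Lambda> (pseg x p q) = deg ?O (p, q)"
      using F pq unfolding graded_functor_def by blast
    ultimately show ?thesis by (simp add: Omega_def)
  qed
  show "pseg x p r = pseg x p q \<cdot> pseg x q r" if "p \<le> q" "q \<le> r" "enatv r \<le> pdeg x"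
  proof -
    have "(p, q) \<in> Mor ?O" "(q, r) \<in> Mor ?O" using that Mor enatv_mono by blast+
    moreover have "src ?O (p, q) = rng ?O (q, r)" "cat_comp ?O (p, q) (q, r) = (p, r)"
      by (auto simp: Omega_def)
    ultimately show ?thesis using F unfolding graded_functor_def by metis
  qed
  show "pseg x p q = undefined" if "\<not> (p \<le> q \<and> enatv q \<le> pdeg x)"
  proof -
    have "snd x \<in> Mor ?O \<rightarrow>\<^sub>E Mor \<Lambda>" using F by (simp add: graded_functor_def)
    then show ?thesis by (rule PiE_arb) (use that Mor in blast)
  qed
qed

lemma pathsI:
  assumes "pdeg x \<in> Nk_inf k"
    and "\<And>p q. p \<le> q \<Longrightarrow> enatv q \<le> pdeg x \<Longrightarrow>
      pseg x p q \<in> Mor \<Lambda> \<and> deg \<Lambda> (pseg x p q) = q - p \<and>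
      rng \<Lambda> (pseg x p q) = pseg x p p \<and> src \<Lambda> (pseg x p q) = pseg x q q"
    and "\<And>p q r. p \<le> q \<Longrightarrow> q \<le> r \<Longrightarrow> enatv r \<le> pdeg x \<Longrightarrow>
      pseg x p r = pseg x p q \<cdot> pseg x q r"
    and "\<And>p q. \<not> (p \<le> q \<and> enatv q \<le> pdeg x) \<Longrightarrow> pseg x p q = undefined"
  shows "x \<in> paths k \<Lambda>"
proof -
  have Mor: "Mor (Omega k (pdeg x)) = {(p, q). p \<le> q \<and> enatv q \<le> pdeg x}"
    using Nk_inf_le[OF assms(1)] Nk_le by (auto simp: Omega_def)
  have "graded_functor (Omega k (pdeg x)) \<Lambda> (snd x)"
    unfolding graded_functor_def Mor
  proof (intro conjI ballI impI)
    show "snd x \<in> {(p, q). p \<le> q \<and> enatv q \<le> pdeg x} \<rightarrow>\<^sub>E Mor \<Lambda>"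
    proof (rule PiE_I)
      show "snd x a \<in> Mor \<Lambda>" if "a \<in> {(p, q). p \<le> q \<and> enatv q \<le> pdeg x}" for a
        using that assms(2)[of "fst a" "snd a"] by (cases a) simp
      show "snd x a = undefined" if "a \<notin> {(p, q). p \<le> q \<and> enatv q \<le> pdeg x}" for a
        using that assms(4)[of "fst a" "snd a"] by (cases a) simp
    qed
  next
    fix a assume a: "a \<in> {(p, q). p \<le> q \<and> enatv q \<le> pdeg x}"
    obtain p q where [simp]: "a = (p, q)" by (cases a)
    show "snd x (rng (Omega k (pdeg x)) a) = rng \<Lambda> (snd x a)"
      "snd x (src (Omega k (pdeg x)) a) = src \<Lambda> (snd x a)"
      "deg \<Lambda> (snd x a) = deg (Omega k (pdeg x)) a"
      using a assms(2)[of p q] by (simp_all add: Omega_def)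
  next
    fix a b
    assume ab: "a \<in> {(p, q). p \<le> q \<and> enatv q \<le> pdeg x}" "b \<in> {(p, q). p \<le> q \<and> enatv q \<le> pdeg x}"
      "src (Omega k (pdeg x)) a = rng (Omega k (pdeg x)) b"
    obtain p q q' r where [simp]: "a = (p, q)" "b = (q', r)" by (cases a, cases b)
    show "snd x (cat_comp (Omega k (pdeg x)) a b) = snd x a \<cdot> snd x b"
      using ab assms(3)[of p q r] by (simp add: Omega_def)
  qed
  then show ?thesis using assms(1) by (simp add: paths_def)
qed

section \<open>Paths described by their initial segments\<close>

abbreviation init :: "'a path \<Rightarrow> (nat \<Rightarrow> nat) \<Rightarrow> 'a" where
  "init x q \<equiv> pseg x 0 q"

lemma init_props:
  assumes "x \<in> paths k \<Lambda>" "enatv q \<le> pdeg x"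
  shows "init x q \<in> Mor \<Lambda>" "deg \<Lambda> (init x q) = q" "src \<Lambda> (init x q) = pseg x q q"
    "rng \<Lambda> (init x q) = prng x"
  using paths_seg[OF assms(1) zero_le_natv assms(2)] by (simp_all add: prng_def)

lemma init_comp:
  assumes "x \<in> paths k \<Lambda>" "p \<le> q" "enatv q \<le> pdeg x"
  shows "init x q = init x p \<cdot> pseg x p q"
  using paths_comp[OF assms(1) zero_le_natv assms(2,3)] .

lemma init_prefix:
  assumes "x \<in> paths k \<Lambda>" "p \<le> q" "enatv q \<le> pdeg x"
  shows "prefix (init x p) (init x q)"
  using init_comp[OF assms] init_props[OF assms(1) enatv_mono[OF assms(3,2)]]
    paths_seg[OF assms] prefixI by metis

lemma init_eq_prefix:
  assumes "x \<in> paths k \<Lambda>" "enatv q \<le> pdeg x" "prefix \<mu> (init x q)"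
  shows "init x (deg \<Lambda> \<mu>) = \<mu>"
proof -
  have "deg \<Lambda> \<mu> \<le> q" using prefixD(4)[OF assms(3)] init_props[OF assms(1,2)] by simp
  then show ?thesis
    using prefix_deg_unique[OF init_prefix[OF assms(1) _ assms(2)] assms(3)]
      init_props[OF assms(1) enatv_mono[OF assms(2)]] by simp
qed

lemma seg_unique:
  assumes "x \<in> paths k \<Lambda>" "p \<le> q" "enatv q \<le> pdeg x"
    "\<nu> \<in> Mor \<Lambda>" "src \<Lambda> (init x p) = rng \<Lambda> \<nu>" "init x q = init x p \<cdot> \<nu>"
  shows "pseg x p q = \<nu>"
proof (rule factorization_unique(2))
  have p: "enatv p \<le> pdeg x" by (rule enatv_mono[OF assms(3,2)])
  show "init x p \<cdot> pseg x p q = init x p \<cdot> \<nu>" using assms(6) init_comp[OF assms(1-3)] by simp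
  show "src \<Lambda> (init x p) = rng \<Lambda> (pseg x p q)"
    using paths_seg[OF assms(1-3)] init_props[OF assms(1) p] by simp
qed (use assms init_props[OF assms(1) enatv_mono[OF assms(3,2)]] paths_seg[OF assms(1-3)] in auto)

text \<open>Agreement is required only at some \<open>r\<close> beyond each \<open>q\<close>, since
  longer segments determine shorter ones. This cofinal form is what \<open>prepend_unique\<close>
  needs, where segments are known only at degrees beyond the prepended morphism.\<close>

lemma paths_eqI:
  assumes x: "x \<in> paths k \<Lambda>" and y: "y \<in> paths k \<Lambda>" and d: "pdeg x = pdeg y"
    and i: "\<And>q. enatv q \<le> pdeg x \<Longrightarrow> \<exists>r. q \<le> r \<and> enatv r \<le> pdeg x \<and> init x r = init y r"
  shows "x = y"
proof -
  have i: "init x q = init y q" if q: "enatv q \<le> pdeg x" for q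
  proof -
    obtain r where r: "q \<le> r" "enatv r \<le> pdeg x" "init x r = init y r" using i[OF q] by blast
    have "prefix (init y q) (init x r)" using init_prefix[OF y r(1)] r d by simp
    from init_eq_prefix[OF x r(2) this] show ?thesis using init_props(2)[OF y] q d by simp
  qed
  have "pseg x p q = pseg y p q" for p q
  proof (cases "p \<le> q \<and> enatv q \<le> pdeg x")
    case True
    then have p: "enatv p \<le> pdeg x" using enatv_mono by blast
    note sy = paths_seg[OF y, of p q]
    have pq: "p \<le> q" "enatv q \<le> pdeg x" "enatv q \<le> pdeg y" using True d by auto
    show ?thesis
    proof (rule seg_unique[OF x pq(1,2)])
      show "pseg y p q \<in> Mor \<Lambda>" using sy pq by blast
      show "src \<Lambda> (init x p) = rng \<Lambda> (pseg y p q)"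
        using sy init_props(3)[OF y, of p] pq d p i by simp
      show "init x q = init x p \<cdot> pseg y p q"
        using init_comp[OF y, of p q] pq d p i by simp
    qed
  next
    case False
    then show ?thesis using paths_outside[OF x] paths_outside[OF y] d by simp
  qed
  then show ?thesis using d by (auto simp: prod_eq_iff fun_eq_iff)
qed

text \<open>The segment from \<open>p\<close> to \<open>q\<close> has to be the factor by which
  \<open>f q\<close> extends \<open>f p\<close>. Left cancellation makes this factor unique, and
  uniqueness gives functoriality.\<close>

lemma path_of_initial_segments:
  assumes m: "m \<in> Nk_inf k"
    and f: "\<And>q. enatv q \<le> m \<Longrightarrow> f q \<in> Mor \<Lambda> \<and> deg \<Lambda> (f q) = q"
    and pre: "\<And>p q. p \<le> q \<Longrightarrow> enatv q \<le> m \<Longrightarrow> prefix (f p) (f q)"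
  shows "\<exists>x\<in>paths k \<Lambda>. pdeg x = m \<and> (\<forall>q. enatv q \<le> m \<longrightarrow> init x q = f q)"
proof -
  define g where "g = (\<lambda>p q. THE \<nu>. \<nu> \<in> Mor \<Lambda> \<and> src \<Lambda> (f p) = rng \<Lambda> \<nu> \<and> f q = f p \<cdot> \<nu>)"
  have g_eq: "g p q = \<nu>" if pq: "p \<le> q" "enatv q \<le> m"
    and \<nu>: "\<nu> \<in> Mor \<Lambda>" "src \<Lambda> (f p) = rng \<Lambda> \<nu>" "f q = f p \<cdot> \<nu>" for p q \<nu>
    unfolding g_def
  proof (rule the_equality)
    fix \<nu>' assume *: "\<nu>' \<in> Mor \<Lambda> \<and> src \<Lambda> (f p) = rng \<Lambda> \<nu>' \<and> f q = f p \<cdot> \<nu>'"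
    show "\<nu>' = \<nu>"
      by (rule factorization_unique(2)[of "f p" \<nu>' "f p" \<nu>])
        (use * \<nu> f[OF enatv_mono[OF pq(2,1)]] in auto)
  qed (use \<nu> in auto)
  have g: "g p q \<in> Mor \<Lambda>" "src \<Lambda> (f p) = rng \<Lambda> (g p q)" "f q = f p \<cdot> g p q"
    if pq: "p \<le> q" "enatv q \<le> m" for p q
  proof -
    obtain \<nu> where "\<nu> \<in> Mor \<Lambda>" "src \<Lambda> (f p) = rng \<Lambda> \<nu>" "f q = f p \<cdot> \<nu>"
      using pre[OF pq] by (rule prefixE)
    then show "g p q \<in> Mor \<Lambda>" "src \<Lambda> (f p) = rng \<Lambda> (g p q)" "f q = f p \<cdot> g p q"
      using g_eq[OF pq] by auto
  qed
  have gpp: "g p p = src \<Lambda> (f p)" if "enatv p \<le> m" for p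
    using f[OF that] that by (intro g_eq) (auto simp: identities)
  define x where "x = (m, \<lambda>(p, q). if p \<le> q \<and> enatv q \<le> m then g p q else undefined)"
  have x: "x \<in> paths k \<Lambda>"
  proof (rule pathsI)
    show "pdeg x \<in> Nk_inf k" using m by (simp add: x_def)
    show "pseg x p q \<in> Mor \<Lambda> \<and> deg \<Lambda> (pseg x p q) = q - p \<and>
      rng \<Lambda> (pseg x p q) = pseg x p p \<and> src \<Lambda> (pseg x p q) = pseg x q q"
      if pq: "p \<le> q" "enatv q \<le> pdeg x" for p q
    proof -
      have q: "enatv q \<le> m" using pq by (simp add: x_def)
      have p: "enatv p \<le> m" using enatv_mono[OF q pq(1)] .
      note g = g[OF pq(1) q]
      have c: "deg \<Lambda> (f q) = deg \<Lambda> (f p) + deg \<Lambda> (g p q)" "src \<Lambda> (f q) = src \<Lambda> (g p q)"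
        using composites[of "f p" "g p q"] g f[OF p] by auto
      have "deg \<Lambda> (g p q) = q - p" using c(1) f[OF p] f[OF q] by (auto simp: fun_eq_iff pointwise)
      then show ?thesis using p q pq(1) g c(2) gpp by (simp add: x_def)
    qed
    show "pseg x p r = pseg x p q \<cdot> pseg x q r" if pqr: "p \<le> q" "q \<le> r" "enatv r \<le> pdeg x" for p q r
    proof -
      have r: "enatv r \<le> m" using pqr by (simp add: x_def)
      have q: "enatv q \<le> m" using enatv_mono[OF r pqr(2)] .
      have p: "enatv p \<le> m" using enatv_mono[OF q pqr(1)] .
      note g1 = g[OF pqr(1) q] and g2 = g[OF pqr(2) r]
      have s: "src \<Lambda> (g p q) = rng \<Lambda> (g q r)"
        using g1 g2 composites(3)[of "f p" "g p q"] f[OF p] by simp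
      have "g p r = g p q \<cdot> g q r"
      proof (rule g_eq)
        show "f r = f p \<cdot> g p q \<cdot> g q r"
          using g1 g2 s f[OF p] by (simp add: dot_assoc)
      qed (use g1 g2 s pqr r composites in auto)
      then show ?thesis using pqr q r order_trans[OF pqr(1,2)] by (simp add: x_def)
    qed
  qed (auto simp: x_def)
  moreover have "init x q = f q" if q: "enatv q \<le> m" for q
  proof -
    \<comment> \<open>\<open>f 0\<close> has degree 0, hence is an identity, so that the segment
      starting at 0 is all of \<open>f q\<close>.\<close>
    have 0: "f 0 \<in> Mor \<Lambda>" "deg \<Lambda> (f 0) = 0" using f[of 0] by auto
    have "init x q = g 0 q" using q by (simp add: x_def)
    also have "\<dots> = f 0 \<cdot> g 0 q"
      using g[OF zero_le_natv q] deg_zero_identity[OF 0] by (metis identities(7))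
    finally show ?thesis using g[OF zero_le_natv q] by simp
  qed
  ultimately show ?thesis by (intro bexI[of _ x]) (auto simp: x_def)
qed

lemma shift_props:
  assumes x: "x \<in> paths k \<Lambda>" and n: "enatv n \<le> pdeg x"
  shows "shift k n x \<in> paths k \<Lambda>" "pdeg (shift k n x) = pdeg x - enatv n"
    "p \<le> q \<Longrightarrow> enatv (n + q) \<le> pdeg x \<Longrightarrow> pseg (shift k n x) p q = pseg x (n + p) (n + q)"
    "prng (shift k n x) = pseg x n n"
proof -
  show d: "pdeg (shift k n x) = pdeg x - enatv n" by (simp add: shift_def)
  have dN: "pdeg x - enatv n \<in> Nk_inf k" by (rule Nk_inf_diff[OF paths_deg[OF x]])
  have Mor: "(p, q) \<in> Mor (Omega k (pdeg x - enatv n)) \<longleftrightarrow> p \<le> q \<and> enatv q \<le> pdeg x - enatv n" for p q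
    using Nk_inf_le[OF dN] Nk_le by (auto simp: Omega_def)
  have seg: "pseg (shift k n x) p q =
      (if p \<le> q \<and> enatv q \<le> pdeg x - enatv n then pseg x (n + p) (n + q) else undefined)" for p q
    using Mor by (auto simp: shift_def)
  have le: "n + p \<le> n + q \<longleftrightarrow> p \<le> q" for p q by (simp add: le_fun_def pointwise)
  show s: "pseg (shift k n x) p q = pseg x (n + p) (n + q)" if "p \<le> q" "enatv (n + q) \<le> pdeg x" for p q
    using that seg enatv_add_le_iff[OF n] by simp
  show "prng (shift k n x) = pseg x n n" using s[of 0 0] n by (simp add: prng_def)
  show "shift k n x \<in> paths k \<Lambda>"
  proof (rule pathsI)
    show "pdeg (shift k n x) \<in> Nk_inf k" using d dN by simp
    show "pseg (shift k n x) p q = undefined" if "\<not> (p \<le> q \<and> enatv q \<le> pdeg (shift k n x))" for p q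
      using that seg d by auto
    show "pseg (shift k n x) p r = pseg (shift k n x) p q \<cdot> pseg (shift k n x) q r"
      if "p \<le> q" "q \<le> r" "enatv r \<le> pdeg (shift k n x)" for p q r
    proof -
      have r: "enatv (n + r) \<le> pdeg x" using that d enatv_add_le_iff[OF n] by simp
      have q: "enatv (n + q) \<le> pdeg x" using enatv_mono[OF r] le that by blast
      have pr: "p \<le> r" using that by (blast intro: order_trans)
      show ?thesis
        using paths_comp[OF x, of "n + p" "n + q" "n + r"] that(1,2) r
        by (simp add: s[OF pr r] s[OF that(1) q] s[OF that(2) r] le)
    qed
    show "pseg (shift k n x) p q \<in> Mor \<Lambda> \<and> deg \<Lambda> (pseg (shift k n x) p q) = q - p \<and>
      rng \<Lambda> (pseg (shift k n x) p q) = pseg (shift k n x) p p \<and>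
      src \<Lambda> (pseg (shift k n x) p q) = pseg (shift k n x) q q"
      if "p \<le> q" "enatv q \<le> pdeg (shift k n x)" for p q
    proof -
      have q: "enatv (n + q) \<le> pdeg x" using that d enatv_add_le_iff[OF n] by simp
      have p: "enatv (n + p) \<le> pdeg x" using enatv_mono[OF q] le that by blast
      have "n + q - (n + p) = q - p" by (auto simp: fun_eq_iff pointwise)
      then show ?thesis
        using s[of p q] s[of p p] s[of q q] paths_seg[OF x, of "n + p" "n + q"] le that p q by simp
    qed
  qed
qed

lemma shift_shift:
  assumes x: "x \<in> paths k \<Lambda>" and mn: "enatv (m + n) \<le> pdeg x"
  shows "shift k n (shift k m x) = shift k (m + n) x"
proof -
  have m: "enatv m \<le> pdeg x" by (rule enatv_mono[OF mn]) simp
  have n: "enatv n \<le> pdeg (shift k m x)"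
    using mn m by (simp add: shift_props[OF x m] enatv_add_le_iff)
  note sm = shift_props[OF x m] and smn = shift_props[OF x mn]
  note sn = shift_props[OF sm(1) n]
  show ?thesis
  proof (rule paths_eqI[OF sn(1) smn(1)])
    show d: "pdeg (shift k n (shift k m x)) = pdeg (shift k (m + n) x)"
      by (simp add: sn(2) sm(2) smn(2) enatv_diff_diff)
    fix q assume "enatv q \<le> pdeg (shift k n (shift k m x))"
    then have q: "enatv (m + n + q) \<le> pdeg x" using enatv_add_le_iff[OF mn] d smn(2) by simp
    then have "enatv (n + q) \<le> pdeg (shift k m x)"
      using enatv_add_le_iff[OF m] sm(2) by (simp add: add.assoc)
    then have "init (shift k n (shift k m x)) q = init (shift k (m + n) x) q"
      using sn(3)[of 0 q] sm(3)[of n "n + q"] smn(3)[of 0 q] q by (simp add: add.assoc)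
    then show "\<exists>r\<ge>q. enatv r \<le> pdeg (shift k n (shift k m x)) \<and>
        init (shift k n (shift k m x)) r = init (shift k (m + n) x) r"
      using \<open>enatv q \<le> pdeg (shift k n (shift k m x))\<close> by blast
  qed
qed

section \<open>Initial segments of paths and prepending\<close>

definition starts_with :: "'a \<Rightarrow> 'a path \<Rightarrow> bool" where
  "starts_with \<eta> x \<longleftrightarrow> enatv (deg \<Lambda> \<eta>) \<le> pdeg x \<and> init x (deg \<Lambda> \<eta>) = \<eta>"

lemma starts_with_init: "x \<in> paths k \<Lambda> \<Longrightarrow> enatv q \<le> pdeg x \<Longrightarrow> starts_with (init x q) x"
  by (simp add: starts_with_def init_props)

lemma starts_with_prefix:
  assumes "x \<in> paths k \<Lambda>" "starts_with \<eta> x" "prefix \<mu> \<eta>"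
  shows "starts_with \<mu> x"
  using assms init_eq_prefix[OF assms(1), of "deg \<Lambda> \<eta>" \<mu>] enatv_mono[OF _ prefixD(4)[OF assms(3)]]
  unfolding starts_with_def by metis

lemma starts_with_common:
  assumes x: "x \<in> paths k \<Lambda>" and \<mu>: "starts_with \<mu> x" and \<nu>: "starts_with \<nu> x"
  shows "\<exists>\<eta>\<in>MCE \<Lambda> \<mu> \<nu>. starts_with \<eta> x"
proof -
  let ?q = "sup (deg \<Lambda> \<mu>) (deg \<Lambda> \<nu>)"
  have q: "enatv ?q \<le> pdeg x" using \<mu> \<nu> by (intro enatv_sup) (auto simp: starts_with_def)
  have pre: "prefix \<mu> (init x ?q)" "prefix \<nu> (init x ?q)"
    using init_prefix[OF x _ q] \<mu> \<nu> by (metis starts_with_def sup_ge1 sup_ge2)+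
  then have "init x ?q \<in> MCE \<Lambda> \<mu> \<nu>"
    using prefixD(1) by (simp add: MCE_iff init_props(2)[OF x q])
  then show ?thesis using starts_with_init[OF x q] by blast
qed

lemma starts_with_same_deg:
  "starts_with \<mu> x \<Longrightarrow> starts_with \<nu> x \<Longrightarrow> deg \<Lambda> \<mu> = deg \<Lambda> \<nu> \<Longrightarrow> \<mu> = \<nu>"
  by (simp add: starts_with_def)

text \<open>The degree of such a path and its segments at degrees beyond
  \<open>deg \<Lambda> \<eta>\<close> are forced, and these degrees are cofinal.\<close>

lemma prepend_unique:
  assumes x: "x \<in> paths k \<Lambda>" and \<eta>: "\<eta> \<in> Mor \<Lambda>"
    and y: "y \<in> paths k \<Lambda>" "starts_with \<eta> y" "shift k (deg \<Lambda> \<eta>) y = x"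
    and z: "z \<in> paths k \<Lambda>" "starts_with \<eta> z" "shift k (deg \<Lambda> \<eta>) z = x"
  shows "y = z"
proof -
  let ?d = "deg \<Lambda> \<eta>"
  have *: "pdeg w = pdeg x + enatv ?d \<and> (\<forall>q. enatv q \<le> pdeg x \<longrightarrow> init w (?d + q) = \<eta> \<cdot> init x q)"
    if w: "w \<in> paths k \<Lambda>" "starts_with \<eta> w" "shift k ?d w = x" for w
  proof -
    have d: "enatv ?d \<le> pdeg w" and i: "init w ?d = \<eta>" using w by (auto simp: starts_with_def)
    note s = shift_props[OF w(1) d]
    have e: "pdeg w = pdeg x + enatv ?d" using s(2) w(3) enatv_diff_add[OF d] by simp
    have "init w (?d + q) = \<eta> \<cdot> init x q" if "enatv q \<le> pdeg x" for q
    proof -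
      have q: "enatv (?d + q) \<le> pdeg w" using that by (simp add: e enatv_le_add_iff)
      have "init w (?d + q) = init w ?d \<cdot> pseg w ?d (?d + q)"
        by (rule init_comp[OF w(1) _ q]) simp
      then show ?thesis using s(3)[of 0 q] q w(3) i by simp
    qed
    then show ?thesis using e by blast
  qed
  show ?thesis
  proof (rule paths_eqI[OF y(1) z(1)])
    show "pdeg y = pdeg z" using *[OF y] *[OF z] by simp
    fix q assume q: "enatv q \<le> pdeg y"
    \<comment> \<open>Because subtraction is truncated, this is the join of \<open>?d\<close> and
      \<open>q\<close>, written in the form to which the known segments apply.\<close>
    let ?r = "?d + (q - ?d)"
    have r: "?r = sup ?d q" by (auto simp: fun_eq_iff pointwise sup_max max_def)
    have "enatv ?r \<le> pdeg y"
      unfolding r using *[OF y] by (intro enatv_sup q) simp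
    moreover have "init y ?r = init z ?r"
      using *[OF y] *[OF z] calculation enatv_le_add_iff by metis
    moreover have "q \<le> ?r" unfolding r by simp
    ultimately show "\<exists>r\<ge>q. enatv r \<le> pdeg y \<and> init y r = init z r" by blast
  qed
qed

text \<open>A degree \<open>q\<close> need not be comparable with
  \<open>deg \<Lambda> \<eta>\<close>, so a segment of degree \<open>q\<close> cannot be written
  down directly. The morphism \<open>g q\<close> has as degree the join of the two, and
  \<open>f q\<close> is its initial segment of degree \<open>q\<close>.\<close>

lemma prepend_exists:
  assumes x: "x \<in> paths k \<Lambda>" and \<eta>: "\<eta> \<in> Mor \<Lambda>" "src \<Lambda> \<eta> = prng x"
  shows "\<exists>y\<in>paths k \<Lambda>. starts_with \<eta> y \<and> shift k (deg \<Lambda> \<eta>) y = x"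
proof -
  let ?d = "deg \<Lambda> \<eta>"
  define m where "m = pdeg x + enatv ?d"
  have m: "m \<in> Nk_inf k" unfolding m_def by (intro Nk_inf_add paths_deg x identities \<eta>)
  define g where "g = (\<lambda>q. \<eta> \<cdot> init x (q - ?d))"
  have diff: "enatv (q - ?d) \<le> pdeg x" if "enatv q \<le> m" for q
  proof -
    have "?d + (q - ?d) = sup ?d q" by (auto simp: fun_eq_iff pointwise sup_max max_def)
    moreover have "enatv (sup ?d q) \<le> m" using that by (intro enatv_sup) (auto simp: m_def)
    ultimately show ?thesis using enatv_le_add_iff[of ?d "q - ?d" "pdeg x"] m_def by simp
  qed
  have g: "g q \<in> Mor \<Lambda>" "deg \<Lambda> (g q) = ?d + (q - ?d)" if "enatv q \<le> m" for q
    using composites[OF \<eta>(1), of "init x (q - ?d)"] \<eta>(2) init_props[OF x diff[OF that]]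
    by (simp_all add: g_def)
  have gpre: "prefix (g p) (g q)" if pq: "p \<le> q" "enatv q \<le> m" for p q
  proof -
    have p: "enatv p \<le> m" using enatv_mono pq by blast
    have le: "p - ?d \<le> q - ?d" using pq(1) by (simp add: le_fun_def pointwise diff_le_mono)
    have "prefix (init x (p - ?d)) (init x (q - ?d))" by (rule init_prefix[OF x le diff[OF pq(2)]])
    then obtain \<nu> where \<nu>: "\<nu> \<in> Mor \<Lambda>" "src \<Lambda> (init x (p - ?d)) = rng \<Lambda> \<nu>"
      "init x (q - ?d) = init x (p - ?d) \<cdot> \<nu>" by (rule prefixE)
    have "g q = g p \<cdot> \<nu>" "src \<Lambda> (g p) = rng \<Lambda> \<nu>"
      using \<nu> \<eta> init_props[OF x diff[OF p]] by (simp_all add: g_def dot_assoc composites)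
    then show ?thesis using prefixI g(1)[OF p] \<nu>(1) by metis
  qed
  have "\<exists>\<mu>. prefix \<mu> (g q) \<and> deg \<Lambda> \<mu> = q" if "enatv q \<le> m" for q
  proof (rule prefix_of_deg[OF g(1)[OF that]])
    show "q \<le> deg \<Lambda> (g q)" unfolding g(2)[OF that] by (auto simp: le_fun_def pointwise)
  qed
  then obtain f where f: "\<And>q. enatv q \<le> m \<Longrightarrow> prefix (f q) (g q) \<and> deg \<Lambda> (f q) = q" by metis
  have fpre: "prefix (f p) (f q)" if pq: "p \<le> q" "enatv q \<le> m" for p q
  proof -
    have p: "enatv p \<le> m" using enatv_mono pq by blast
    then have "prefix (f p) (g q)" using f[OF p] gpre[OF pq] prefix_trans by blast
    then show ?thesis using prefix_linear[of "f p" "g q" "f q"] f[OF p] f[OF pq(2)] pq by simp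
  qed
  obtain y where y: "y \<in> paths k \<Lambda>" "pdeg y = m" "\<And>q. enatv q \<le> m \<Longrightarrow> init y q = f q"
    using path_of_initial_segments[OF m, of f] f fpre prefixD(1) by metis
  \<comment> \<open>Beyond \<open>?d\<close> nothing has to be cut off, so \<open>f\<close> agrees
    with \<open>g\<close> there.\<close>
  have fd: "f (?d + q) = \<eta> \<cdot> init x q" if q: "enatv q \<le> pdeg x" for q
  proof -
    have dq: "enatv (?d + q) \<le> m" using q by (simp add: m_def enatv_le_add_iff)
    have "?d + q - ?d = q" by (auto simp: fun_eq_iff pointwise)
    then have "g (?d + q) = \<eta> \<cdot> init x q" "deg \<Lambda> (g (?d + q)) = ?d + q"
      using g(2)[OF dq] by (simp_all add: g_def)
    then show ?thesis
      using prefix_deg_unique[OF conjunct1[OF f[OF dq]] prefix_refl[OF g(1)[OF dq]]] f[OF dq] by simp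
  qed
  have d: "enatv ?d \<le> pdeg y" by (simp add: y(2) m_def)
  have yd: "init y ?d = \<eta>"
  proof -
    have "init x 0 = src \<Lambda> \<eta>" using \<eta>(2) by (simp add: prng_def)
    then show ?thesis using fd[of 0] y(3)[of ?d] d y(2) \<eta>(1) by (simp add: identities)
  qed
  note s = shift_props[OF y(1) d]
  have "shift k ?d y = x"
  proof (rule paths_eqI[OF s(1) x])
    show e: "pdeg (shift k ?d y) = pdeg x" using s(2) by (simp add: y(2) m_def)
    fix q assume "enatv q \<le> pdeg (shift k ?d y)"
    then have q: "enatv q \<le> pdeg x" using e by simp
    have dq: "enatv (?d + q) \<le> pdeg y" using q by (simp add: y(2) m_def enatv_le_add_iff)
    have "pseg y ?d (?d + q) = init x q"
    proof (rule seg_unique[OF y(1) _ dq])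
      show "init y (?d + q) = init y ?d \<cdot> init x q"
        using y(3)[of "?d + q"] dq fd[OF q] yd y(2) by simp
    qed (use yd \<eta>(2) init_props[OF x q] in simp_all)
    then have "init (shift k ?d y) q = init x q" using s(3)[of 0 q] dq by simp
    then show "\<exists>r\<ge>q. enatv r \<le> pdeg (shift k ?d y) \<and> init (shift k ?d y) r = init x r"
      using q e by auto
  qed
  then show ?thesis using y(1) d yd by (auto simp: starts_with_def)
qed

lemma prepend_props:
  assumes x: "x \<in> paths k \<Lambda>" and \<eta>: "\<eta> \<in> Mor \<Lambda>" "src \<Lambda> \<eta> = prng x"
  shows "prepend k \<Lambda> \<eta> x \<in> paths k \<Lambda>" "starts_with \<eta> (prepend k \<Lambda> \<eta> x)"
    "shift k (deg \<Lambda> \<eta>) (prepend k \<Lambda> \<eta> x) = x"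
proof -
  obtain y where y: "y \<in> paths k \<Lambda>" "starts_with \<eta> y" "shift k (deg \<Lambda> \<eta>) y = x"
    using prepend_exists[OF assms] by blast
  have "prepend k \<Lambda> \<eta> x = y"
    unfolding prepend_def
  proof (rule the_equality)
    have d: "enatv (deg \<Lambda> \<eta>) \<le> pdeg y" using y(2) by (simp add: starts_with_def)
    show "y \<in> paths k \<Lambda> \<and> pdeg y = pdeg x + enatv (deg \<Lambda> \<eta>) \<and>
        init y (deg \<Lambda> \<eta>) = \<eta> \<and> shift k (deg \<Lambda> \<eta>) y = x"
      using y shift_props(2)[OF y(1) d] enatv_diff_add[OF d] by (simp add: starts_with_def)
    fix z assume "z \<in> paths k \<Lambda> \<and> pdeg z = pdeg x + enatv (deg \<Lambda> \<eta>) \<and>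
        init z (deg \<Lambda> \<eta>) = \<eta> \<and> shift k (deg \<Lambda> \<eta>) z = x"
    then show "z = y"
      by (intro prepend_unique[OF x \<eta>(1) _ _ _ y]) (simp_all add: starts_with_def)
  qed
  then show "prepend k \<Lambda> \<eta> x \<in> paths k \<Lambda>" "starts_with \<eta> (prepend k \<Lambda> \<eta> x)"
    "shift k (deg \<Lambda> \<eta>) (prepend k \<Lambda> \<eta> x) = x"
    using y by auto
qed

lemma prng_shift:
  assumes "y \<in> paths k \<Lambda>" "starts_with \<eta> y"
  shows "prng (shift k (deg \<Lambda> \<eta>) y) = src \<Lambda> \<eta>"
  using assms shift_props(4)[OF assms(1)] init_props(3)[OF assms(1)] by (metis starts_with_def)

lemma starts_with_Mor: "y \<in> paths k \<Lambda> \<Longrightarrow> starts_with \<eta> y \<Longrightarrow> \<eta> \<in> Mor \<Lambda>"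
  using init_props(1) by (metis starts_with_def)

lemma prepend_shift:
  assumes y: "y \<in> paths k \<Lambda>" "starts_with \<eta> y"
  shows "prepend k \<Lambda> \<eta> (shift k (deg \<Lambda> \<eta>) y) = y"
proof -
  have d: "enatv (deg \<Lambda> \<eta>) \<le> pdeg y" using y(2) by (simp add: starts_with_def)
  note p = prepend_props[OF shift_props(1)[OF y(1) d] starts_with_Mor[OF y] prng_shift[OF y, symmetric]]
  show ?thesis
    by (rule prepend_unique[OF shift_props(1)[OF y(1) d] starts_with_Mor[OF y] p y refl])
qed

lemma prng_prepend:
  assumes "x \<in> paths k \<Lambda>" "\<eta> \<in> Mor \<Lambda>" "src \<Lambda> \<eta> = prng x"
  shows "prng (prepend k \<Lambda> \<eta> x) = rng \<Lambda> \<eta>"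
  using prepend_props[OF assms] init_props(4) by (metis starts_with_def)

text \<open>Once \<open>y\<close> begins with \<open>\<mu>\<close>, left cancellation leaves its
  next segment as the only candidate for \<open>\<nu>\<close>.\<close>

lemma starts_with_comp_iff:
  assumes y: "y \<in> paths k \<Lambda>" and \<mu>: "\<mu> \<in> Mor \<Lambda>" and \<nu>: "\<nu> \<in> Mor \<Lambda>" and s: "src \<Lambda> \<mu> = rng \<Lambda> \<nu>"
  shows "starts_with (\<mu> \<cdot> \<nu>) y \<longleftrightarrow> starts_with \<mu> y \<and> starts_with \<nu> (shift k (deg \<Lambda> \<mu>) y)"
proof -
  have d: "deg \<Lambda> (\<mu> \<cdot> \<nu>) = deg \<Lambda> \<mu> + deg \<Lambda> \<nu>" by (rule composites[OF \<mu> \<nu> s])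
  show ?thesis
  proof (cases "starts_with \<mu> y")
    case True
    then have m: "enatv (deg \<Lambda> \<mu>) \<le> pdeg y" and i: "init y (deg \<Lambda> \<mu>) = \<mu>"
      by (auto simp: starts_with_def)
    note sh = shift_props[OF y m]
    have le: "enatv (deg \<Lambda> \<nu>) \<le> pdeg (shift k (deg \<Lambda> \<mu>) y) \<longleftrightarrow> enatv (deg \<Lambda> (\<mu> \<cdot> \<nu>)) \<le> pdeg y"
      by (simp add: d sh(2) enatv_add_le_iff[OF m])
    show ?thesis
    proof (cases "enatv (deg \<Lambda> (\<mu> \<cdot> \<nu>)) \<le> pdeg y")
      case q: True
      then have q': "enatv (deg \<Lambda> \<mu> + deg \<Lambda> \<nu>) \<le> pdeg y" by (simp add: d)
      let ?t = "pseg y (deg \<Lambda> \<mu>) (deg \<Lambda> \<mu> + deg \<Lambda> \<nu>)"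
      have t: "?t \<in> Mor \<Lambda>" "src \<Lambda> \<mu> = rng \<Lambda> ?t"
        using paths_seg[OF y _ q', of "deg \<Lambda> \<mu>"] init_props(3)[OF y m] i by auto
      have "init y (deg \<Lambda> (\<mu> \<cdot> \<nu>)) = \<mu> \<cdot> ?t"
        using init_comp[OF y _ q', of "deg \<Lambda> \<mu>"] i d by simp
      moreover have "\<mu> \<cdot> ?t = \<mu> \<cdot> \<nu> \<longleftrightarrow> ?t = \<nu>"
        using factorization_unique(2)[OF \<mu> t \<mu> \<nu> s] by metis
      moreover have "init (shift k (deg \<Lambda> \<mu>) y) (deg \<Lambda> \<nu>) = ?t" using sh(3)[of 0] q' by simp
      ultimately show ?thesis using True q le by (simp add: starts_with_def)
    qed (use le True in \<open>auto simp: starts_with_def\<close>)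
  next
    case False
    then show ?thesis using starts_with_prefix[OF y _ prefixI[OF \<mu> \<nu> s]] by blast
  qed
qed

lemma shift_comp:
  assumes y: "y \<in> paths k \<Lambda>" and \<mu>: "\<mu> \<in> Mor \<Lambda>" "\<nu> \<in> Mor \<Lambda>" "src \<Lambda> \<mu> = rng \<Lambda> \<nu>"
    and "starts_with (\<mu> \<cdot> \<nu>) y"
  shows "shift k (deg \<Lambda> (\<mu> \<cdot> \<nu>)) y = shift k (deg \<Lambda> \<nu>) (shift k (deg \<Lambda> \<mu>) y)"
  using assms(5) composites(4)[OF \<mu>] shift_shift[OF y, of "deg \<Lambda> \<mu>" "deg \<Lambda> \<nu>"]
  by (simp add: starts_with_def)

lemma prepend_prepend:
  assumes x: "x \<in> paths k \<Lambda>" and \<mu>: "\<mu> \<in> Mor \<Lambda>" "\<nu> \<in> Mor \<Lambda>" "src \<Lambda> \<mu> = rng \<Lambda> \<nu>"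
    and s: "src \<Lambda> \<nu> = prng x"
  shows "prepend k \<Lambda> (\<mu> \<cdot> \<nu>) x = prepend k \<Lambda> \<mu> (prepend k \<Lambda> \<nu> x)"
proof -
  let ?z = "prepend k \<Lambda> \<nu> x" and ?y = "prepend k \<Lambda> \<mu> (prepend k \<Lambda> \<nu> x)"
  note c = composites[OF \<mu>]
  note z = prepend_props[OF x \<mu>(2) s]
  have "src \<Lambda> \<mu> = prng ?z" using prng_prepend[OF x \<mu>(2) s] \<mu>(3) by simp
  note y = prepend_props[OF z(1) \<mu>(1) this]
  have st: "starts_with (\<mu> \<cdot> \<nu>) ?y"
    using starts_with_comp_iff[OF y(1) \<mu>] y z by simp
  have "shift k (deg \<Lambda> (\<mu> \<cdot> \<nu>)) ?y = x" using shift_comp[OF y(1) \<mu> st] y z by simp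
  moreover have "src \<Lambda> (\<mu> \<cdot> \<nu>) = prng x" using c s by simp
  ultimately show ?thesis
    using prepend_unique[OF x c(1) prepend_props[OF x c(1)] y(1) st] by blast
qed

lemma prepend_identity:
  assumes x: "x \<in> paths k \<Lambda>"
  shows "prepend k \<Lambda> (prng x) x = x"
proof -
  have v: "prng x \<in> Mor \<Lambda>" "deg \<Lambda> (prng x) = 0" using init_props[OF x, of 0] by (auto simp: prng_def)
  have "starts_with (prng x) x" using v by (simp add: starts_with_def prng_def)
  then have "prepend k \<Lambda> (prng x) (shift k 0 x) = x" using prepend_shift[OF x] v by metis
  moreover have "shift k 0 x = x"
  proof (rule paths_eqI[OF shift_props(1)[OF x enatv_0] x])
    show d: "pdeg (shift k 0 x) = pdeg x"
    proof -
      have "pdeg x - enatv 0 = pdeg x"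
        by (simp add: fun_eq_iff pointwise zero_enat_def[symmetric])
      then show ?thesis using shift_props(2)[OF x enatv_0] by simp
    qed
    fix q assume "enatv q \<le> pdeg (shift k 0 x)"
    then show "\<exists>r\<ge>q. enatv r \<le> pdeg (shift k 0 x) \<and> init (shift k 0 x) r = init x r"
      using shift_props(3)[OF x enatv_0, of 0 q] d by auto
  qed
  ultimately show ?thesis by simp
qed

section \<open>Aperiodic boundary paths\<close>

abbreviation X :: "'a path set" where "X \<equiv> aperiodic_boundary_paths k \<Lambda>"

lemma boundary_paths_iff:
  "x \<in> boundary_paths k \<Lambda> \<longleftrightarrow> x \<in> paths k \<Lambda> \<and> (\<forall>n E. enatv n \<le> pdeg x \<and> E \<in> FE \<Lambda> (pseg x n n) \<longrightarrow>
     (\<exists>p. enatv (n + p) \<le> pdeg x \<and> pseg x n (n + p) \<in> E))"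
proof -
  have "(\<exists>p\<in>Nk k. enatv p \<le> pdeg x - enatv n \<and> pseg x n (n + p) \<in> E) \<longleftrightarrow>
      (\<exists>p. enatv (n + p) \<le> pdeg x \<and> pseg x n (n + p) \<in> E)"
    if "x \<in> paths k \<Lambda>" "enatv n \<le> pdeg x" for n E
    using enatv_add_le_iff[OF that(2)] Nk_inf_le[OF Nk_inf_diff[OF paths_deg[OF that(1)]]] by blast
  then show ?thesis
    unfolding boundary_paths_def using Nk_inf_le[OF paths_deg[of x]] by blast
qed

lemma aperiodic_iff:
  "x \<in> X \<longleftrightarrow> x \<in> boundary_paths k \<Lambda> \<and>
     (\<forall>m n. enatv m \<le> pdeg x \<and> enatv n \<le> pdeg x \<and> shift k m x = shift k n x \<longrightarrow> m = n)"
  unfolding aperiodic_boundary_paths_def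
  using Nk_inf_le[OF paths_deg[of x]] boundary_paths_iff by blast

lemma X_paths: "x \<in> X \<Longrightarrow> x \<in> paths k \<Lambda>"
  by (simp add: aperiodic_iff boundary_paths_iff)

lemma shift_X:
  assumes "x \<in> X" and n: "enatv n \<le> pdeg x"
  shows "shift k n x \<in> X"
proof -
  have x: "x \<in> paths k \<Lambda>" by (rule X_paths[OF assms(1)])
  note s = shift_props[OF x n]
  have le: "enatv q \<le> pdeg (shift k n x) \<longleftrightarrow> enatv (n + q) \<le> pdeg x" for q
    by (simp add: s(2) enatv_add_le_iff[OF n])
  have "\<exists>p. enatv (m + p) \<le> pdeg (shift k n x) \<and> pseg (shift k n x) m (m + p) \<in> E"
    if m: "enatv m \<le> pdeg (shift k n x)" and E: "E \<in> FE \<Lambda> (pseg (shift k n x) m m)" for m E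
  proof -
    have m': "enatv (n + m) \<le> pdeg x" using m le by simp
    then have "E \<in> FE \<Lambda> (pseg x (n + m) (n + m))" using E s(3)[of m m] by simp
    then obtain p where "enatv (n + m + p) \<le> pdeg x" "pseg x (n + m) (n + m + p) \<in> E"
      using assms(1) m' unfolding aperiodic_iff boundary_paths_iff by blast
    then show ?thesis using s(3)[of m "m + p"] le by (auto simp: add.assoc)
  qed
  moreover have "m = m'"
    if "enatv m \<le> pdeg (shift k n x)" "enatv m' \<le> pdeg (shift k n x)"
      "shift k m (shift k n x) = shift k m' (shift k n x)" for m m'
  proof -
    have "shift k (n + m) x = shift k (n + m') x" using that shift_shift[OF x] le by metis
    then have "n + m = n + m'" using assms(1) that le unfolding aperiodic_iff by blast
    then show ?thesis by simp
  qed
  ultimately show ?thesis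
    using s(1) unfolding aperiodic_iff boundary_paths_iff by blast
qed

text \<open>The vertex at \<open>n\<close> may lie before the part of \<open>y\<close> that is known
  to be a boundary path. Let \<open>N\<close> be the join of \<open>d\<close> and \<open>n\<close>,
  and let \<open>\<kappa>\<close> be the segment of \<open>y\<close> from \<open>n\<close> to
  \<open>N\<close>. The extenders of \<open>E\<close> along \<open>\<kappa>\<close> form a finite
  exhaustive set at \<open>N\<close>, where the hypothesis applies; the extender met there, composed
  with \<open>\<kappa>\<close>, has an element of \<open>E\<close> as initial segment.\<close>

lemma boundary_path_of_shift:
  assumes "shift k d y \<in> boundary_paths k \<Lambda>" and y: "y \<in> paths k \<Lambda>" and d: "enatv d \<le> pdeg y"
  shows "y \<in> boundary_paths k \<Lambda>"
proof -
  let ?x = "shift k d y"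
  note s = shift_props[OF y d]
  have "\<exists>p. enatv (n + p) \<le> pdeg y \<and> pseg y n (n + p) \<in> E"
    if n: "enatv n \<le> pdeg y" and E: "E \<in> FE \<Lambda> (pseg y n n)" for n E
  proof -
    define N where "N = sup d n"
    have N: "enatv N \<le> pdeg y" unfolding N_def by (rule enatv_sup[OF d n])
    have nN: "n \<le> N" by (simp add: N_def)
    define j where "j = N - d"
    have dj: "d + j = N" unfolding j_def N_def by (rule add_diff_cancel_fun) simp
    have j: "enatv j \<le> pdeg ?x" using N dj by (simp add: s(2) enatv_add_le_iff[OF d])
    let ?\<kappa> = "pseg y n N"
    have \<kappa>: "?\<kappa> \<in> Mor \<Lambda>" "rng \<Lambda> ?\<kappa> = pseg y n n" "src \<Lambda> ?\<kappa> = pseg y N N"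
      using paths_seg[OF y nN N] by auto
    have "pseg ?x j j = src \<Lambda> ?\<kappa>" using s(3)[of j j] dj N \<kappa> by simp
    then have "extenders ?\<kappa> E \<in> FE \<Lambda> (pseg ?x j j)"
      using extenders_FE[OF E, of ?\<kappa>] \<kappa>(1,2) by (simp add: paths_from_def)
    then obtain p where p: "enatv (j + p) \<le> pdeg ?x" "pseg ?x j (j + p) \<in> extenders ?\<kappa> E"
      using assms(1) j unfolding boundary_paths_iff by blast
    have Np: "enatv (N + p) \<le> pdeg y"
      using p(1) enatv_add_le_iff[OF d, of "j + p"] dj s(2) by (simp add: add.assoc[symmetric])
    have "pseg ?x j (j + p) = pseg y N (N + p)"
      using s(3)[of j "j + p"] dj Np by (simp add: add.assoc[symmetric])
    then obtain \<mu> where \<mu>: "\<mu> \<in> E" "?\<kappa> \<cdot> pseg y N (N + p) \<in> MCE \<Lambda> ?\<kappa> \<mu>"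
      using p(2) by (auto simp: extenders_def)
    have \<mu>M: "\<mu> \<in> Mor \<Lambda>" using \<mu> E by (auto simp: FE_def exhaustive_def paths_from_def)
    have "?\<kappa> \<cdot> pseg y N (N + p) = pseg y n (N + p)"
      using paths_comp[OF y nN _ Np] by simp
    then have pre: "prefix \<mu> (pseg y n (N + p))" using \<mu> \<kappa> \<mu>M by (simp add: MCE_iff)
    have nNp: "n \<le> N + p" using nN by (rule order_trans) simp
    \<comment> \<open>The degree of \<open>\<mu>\<close> has to fit into the path before the segment
      of that degree from \<open>n\<close> can be formed; equality of degrees then identifies it
      with \<open>\<mu>\<close>.\<close>
    have "deg \<Lambda> \<mu> \<le> N + p - n" using prefixD(4)[OF pre] paths_seg[OF y nNp Np] by simp
    then have le: "n + deg \<Lambda> \<mu> \<le> N + p"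
      using nNp by (auto simp: le_fun_def pointwise le_diff_conv2 add.commute)
    have q: "enatv (n + deg \<Lambda> \<mu>) \<le> pdeg y" by (rule enatv_mono[OF Np le])
    let ?\<mu>' = "pseg y n (n + deg \<Lambda> \<mu>)"
    have m': "?\<mu>' \<in> Mor \<Lambda>" "deg \<Lambda> ?\<mu>' = deg \<Lambda> \<mu>" "src \<Lambda> ?\<mu>' = pseg y (n + deg \<Lambda> \<mu>) (n + deg \<Lambda> \<mu>)"
      using paths_seg[OF y _ q, of n] by simp_all
    have "pseg y n (N + p) = ?\<mu>' \<cdot> pseg y (n + deg \<Lambda> \<mu>) (N + p)"
      using paths_comp[OF y _ le Np, of n] by simp
    then have "prefix ?\<mu>' (pseg y n (N + p))"
      using prefixI[of ?\<mu>'] m' paths_seg[OF y le Np] by metis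
    then have "?\<mu>' = \<mu>" using prefix_deg_unique pre m' by blast
    then show ?thesis using q \<mu> by auto
  qed
  then show ?thesis using y unfolding boundary_paths_iff by blast
qed

text \<open>A coincidence between two shifts of the longer path is shifted further until both lie
  beyond \<open>\<eta>\<close>, where it becomes a coincidence between shifts of
  \<open>x\<close>.\<close>

lemma prepend_X:
  assumes xX: "x \<in> X" and \<eta>: "\<eta> \<in> Mor \<Lambda>" "src \<Lambda> \<eta> = prng x"
  shows "prepend k \<Lambda> \<eta> x \<in> X"
proof -
  define y where "y = prepend k \<Lambda> \<eta> x"
  define d where "d = deg \<Lambda> \<eta>"
  note p = prepend_props[OF X_paths[OF xX] \<eta>, folded y_def d_def]
  have y: "y \<in> paths k \<Lambda>" by (rule p)
  have d: "enatv d \<le> pdeg y" using p by (simp add: starts_with_def d_def)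
  have "y \<in> boundary_paths k \<Lambda>"
    using boundary_path_of_shift[OF _ y d] p xX by (simp add: aperiodic_iff)
  moreover have "m = n"
    if m: "enatv m \<le> pdeg y" and n: "enatv n \<le> pdeg y" and eq: "shift k m y = shift k n y" for m n
  proof -
    have e: "pdeg y - enatv m = pdeg y - enatv n"
      using arg_cong[OF eq, of fst] by (simp add: shift_props y m n)
    \<comment> \<open>Both \<open>m + l\<close> and \<open>n + l\<close> must reach \<open>d\<close>
      and stay within the degree of \<open>y\<close>. Where \<open>m\<close> and \<open>n\<close>
      agree, \<open>l\<close> adds just enough, giving the larger of \<open>m i\<close> and
      \<open>d i\<close>. Where they differ the degree is infinite, and adding all of
      \<open>d i\<close> is harmless.\<close>
    define l where "l = (\<lambda>i. if m i = n i then d i - m i else d i)"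
    \<comment> \<open>Equal shifts have equal degrees; subtracting two different numbers from a
      finite degree that bounds both would give different results.\<close>
    have inf: "pdeg y i = \<infinity>" if "m i \<noteq> n i" for i
    proof -
      have "pdeg y i - enat (m i) = pdeg y i - enat (n i)" using e by (simp add: fun_eq_iff pointwise)
      moreover have "enat (m i) \<le> pdeg y i" "enat (n i) \<le> pdeg y i" using m n by (auto simp: le_fun_def pointwise)
      ultimately show ?thesis using that by (cases "pdeg y i") auto
    qed
    have le: "enatv (m + l) \<le> pdeg y" "enatv (n + l) \<le> pdeg y"
    proof -
      have "enat (m i + l i) \<le> pdeg y i \<and> enat (n i + l i) \<le> pdeg y i" for i
      proof (cases "m i = n i")
        case True
        have "enat (m i) \<le> pdeg y i" "enat (d i) \<le> pdeg y i" using m d by (auto simp: le_fun_def pointwise)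
        then show ?thesis using True by (auto simp: l_def) (metis le_add_diff_inverse nat_le_linear add_0_right diff_is_0_eq')+
      qed (simp add: inf)
      then show "enatv (m + l) \<le> pdeg y" "enatv (n + l) \<le> pdeg y" by (auto simp: le_fun_def pointwise)
    qed
    have dl: "d \<le> m + l" "d \<le> n + l" by (auto simp: l_def le_fun_def pointwise)
    have "shift k (m + l) y = shift k (n + l) y"
      using eq shift_shift[OF y le(1)] shift_shift[OF y le(2)] by simp
    \<comment> \<open>Both multi-indices are now above \<open>d\<close>, so these shifts of
      \<open>y\<close> factor through the shift by \<open>d\<close>, which is
      \<open>x\<close>.\<close>
    then have "shift k (m + l - d) x = shift k (n + l - d) x"
      using shift_shift[OF y, of d "m + l - d"] shift_shift[OF y, of d "n + l - d"] p le
      by (simp add: add_diff_cancel_fun dl)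
    moreover have "enatv (m + l - d) \<le> pdeg x" "enatv (n + l - d) \<le> pdeg x"
      using p(3) shift_props(2)[OF y d] enatv_add_le_iff[OF d] le add_diff_cancel_fun dl by metis+
    ultimately have "m + l - d = n + l - d" using xX unfolding aperiodic_iff by blast
    then have "m + l = n + l" using add_diff_cancel_fun dl by metis
    then show ?thesis by simp
  qed
  ultimately show ?thesis unfolding aperiodic_iff y_def[symmetric] by blast
qed

section \<open>Monomials\<close>

abbreviation \<xi> :: "'a path \<Rightarrow> 'a path \<Rightarrow> complex" where "\<xi> \<equiv> basis_vec"

text \<open>Shifting by \<open>deg \<Lambda> \<eta>\<close> undoes prepending, so prepending is a
  partial injection of \<open>X\<close> and induces a bounded operator; values on basis vectors
  determine it.\<close>

lemma S_ap_spec: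
  assumes \<eta>: "\<eta> \<in> Mor \<Lambda>"
  shows "S_ap k \<Lambda> \<eta> \<in> bounded_ops X"
    and "x \<in> X \<Longrightarrow> S_ap k \<Lambda> \<eta> (\<xi> x) = (if src \<Lambda> \<eta> = prng x then \<xi> (prepend k \<Lambda> \<eta> x) else 0)"
proof -
  let ?A = "{x \<in> X. src \<Lambda> \<eta> = prng x}"
  let ?P = "\<lambda>T. T \<in> bounded_ops X \<and>
    (\<forall>x\<in>X. T (\<xi> x) = (if src \<Lambda> \<eta> = prng x then \<xi> (prepend k \<Lambda> \<eta> x) else 0))"
  have "inj_on (prepend k \<Lambda> \<eta>) ?A"
    using prepend_props(3) X_paths \<eta> by (intro inj_onI) (metis (mono_tags, lifting) mem_Collect_eq)
  moreover have "prepend k \<Lambda> \<eta> ` ?A \<subseteq> X" using prepend_X \<eta> by auto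
  ultimately obtain T where "?P T"
    using partial_injection_op_exists[of ?A X "prepend k \<Lambda> \<eta>"] by auto
  moreover have "T' = T''" if "?P T'" "?P T''" for T' T''
    using that by (intro bounded_ops_eqI[of T' X T'']) auto
  ultimately have "\<exists>!T. ?P T" by blast
  then have "?P (S_ap k \<Lambda> \<eta>)" unfolding S_ap_def by (rule theI')
  then show "S_ap k \<Lambda> \<eta> \<in> bounded_ops X"
    "x \<in> X \<Longrightarrow> S_ap k \<Lambda> \<eta> (\<xi> x) = (if src \<Lambda> \<eta> = prng x then \<xi> (prepend k \<Lambda> \<eta> x) else 0)"
    by auto
qed

lemma S_ap_adj_bounded: "\<eta> \<in> Mor \<Lambda> \<Longrightarrow> S_ap_adj k \<Lambda> \<eta> \<in> bounded_ops X"
  unfolding S_ap_adj_def by (intro op_adjoint_bounded_ops S_ap_spec)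

text \<open>The matrix of the adjoint is the conjugate transpose, and for \<open>x\<close> and
  \<open>z\<close> in \<open>X\<close> the equation \<open>z = prepend k \<Lambda> \<eta> x\<close>
  with matching source can be solved for \<open>x\<close> exactly when \<open>z\<close> starts with
  \<open>\<eta>\<close>. Outside \<open>X\<close> both sides vanish.\<close>

lemma S_ap_adj_basis:
  assumes \<eta>: "\<eta> \<in> Mor \<Lambda>" and z: "z \<in> X"
  shows "S_ap_adj k \<Lambda> \<eta> (\<xi> z) = (if starts_with \<eta> z then \<xi> (shift k (deg \<Lambda> \<eta>) z) else 0)"
proof
  fix x
  let ?r = "if starts_with \<eta> z then \<xi> (shift k (deg \<Lambda> \<eta>) z) else 0"
  have zp: "z \<in> paths k \<Lambda>" by (rule X_paths[OF z])
  show "S_ap_adj k \<Lambda> \<eta> (\<xi> z) x = ?r x"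
  proof (cases "x \<in> X")
    case x: True
    have xp: "x \<in> paths k \<Lambda>" by (rule X_paths[OF x])
    have "S_ap_adj k \<Lambda> \<eta> (\<xi> z) x = cnj (S_ap k \<Lambda> \<eta> (\<xi> x) z)"
      unfolding S_ap_adj_def by (rule op_adjoint_basis_entry[OF S_ap_spec(1)[OF \<eta>] x z])
    also have "\<dots> = (if src \<Lambda> \<eta> = prng x \<and> z = prepend k \<Lambda> \<eta> x then 1 else 0)"
      using S_ap_spec(2)[OF \<eta> x] by (auto simp: basis_vec_def zero_fun_apply)
    also have "src \<Lambda> \<eta> = prng x \<and> z = prepend k \<Lambda> \<eta> x \<longleftrightarrow>
        starts_with \<eta> z \<and> x = shift k (deg \<Lambda> \<eta>) z"
      using prepend_props[OF xp \<eta>] prepend_shift[OF zp] prng_shift[OF zp] by metis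
    finally show ?thesis by (simp add: basis_vec_def zero_fun_apply)
  next
    case False
    have "S_ap_adj k \<Lambda> \<eta> (\<xi> z) \<in> ell2 X" 
      by (rule bounded_ops_ell2[OF S_ap_adj_bounded[OF \<eta>] basis_vec_ell2[OF z]])
    moreover have "starts_with \<eta> z \<Longrightarrow> shift k (deg \<Lambda> \<eta>) z \<in> X"
      by (intro shift_X[OF z]) (simp add: starts_with_def)
    ultimately show ?thesis using False by (auto simp: ell2_vanish basis_vec_def)
  qed
qed

lemma S_ap_comp:
  assumes \<mu>: "\<mu> \<in> Mor \<Lambda>" "\<nu> \<in> Mor \<Lambda>" "src \<Lambda> \<mu> = rng \<Lambda> \<nu>"
  shows "S_ap k \<Lambda> \<mu> \<circ> S_ap k \<Lambda> \<nu> = S_ap k \<Lambda> (\<mu> \<cdot> \<nu>)"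
proof (rule bounded_ops_eqI)
  note c = composites[OF \<mu>]
  show "S_ap k \<Lambda> \<mu> \<circ> S_ap k \<Lambda> \<nu> \<in> bounded_ops X" by (intro op_comp S_ap_spec \<mu>)
  show "S_ap k \<Lambda> (\<mu> \<cdot> \<nu>) \<in> bounded_ops X" by (intro S_ap_spec c)
  fix x assume x: "x \<in> X"
  show "(S_ap k \<Lambda> \<mu> \<circ> S_ap k \<Lambda> \<nu>) (\<xi> x) = S_ap k \<Lambda> (\<mu> \<cdot> \<nu>) (\<xi> x)"
  proof (cases "src \<Lambda> \<nu> = prng x")
    case True
    then show ?thesis
      using S_ap_spec(2)[OF \<mu>(1) prepend_X[OF x \<mu>(2) True]] \<mu>(3)
        prng_prepend[OF X_paths[OF x] \<mu>(2) True] prepend_prepend[OF X_paths[OF x] \<mu> True]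
      by (simp add: S_ap_spec(2)[OF \<mu>(2) x] S_ap_spec(2)[OF c(1) x] c(3))
  next
    case False
    then show ?thesis
      using bounded_ops_zero[OF S_ap_spec(1)[OF \<mu>(1)]]
      by (simp add: S_ap_spec(2)[OF \<mu>(2) x] S_ap_spec(2)[OF c(1) x] c(3))
  qed
qed

lemma S_ap_adj_comp:
  assumes \<mu>: "\<mu> \<in> Mor \<Lambda>" "\<nu> \<in> Mor \<Lambda>" "src \<Lambda> \<mu> = rng \<Lambda> \<nu>"
  shows "S_ap_adj k \<Lambda> \<nu> \<circ> S_ap_adj k \<Lambda> \<mu> = S_ap_adj k \<Lambda> (\<mu> \<cdot> \<nu>)"
  unfolding S_ap_adj_def S_ap_comp[OF \<mu>, symmetric]
  by (rule op_adjoint_comp[symmetric]) (intro S_ap_spec \<mu>)+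

abbreviation monomials :: "'a path operator set" where
  "monomials \<equiv> {S_ap k \<Lambda> \<mu> \<circ> S_ap_adj k \<Lambda> \<nu> | \<mu> \<nu>. \<mu> \<in> Mor \<Lambda> \<and> \<nu> \<in> Mor \<Lambda> \<and> src \<Lambda> \<mu> = src \<Lambda> \<nu>}"

lemma monomialI:
  assumes "\<mu> \<in> Mor \<Lambda>" "\<nu> \<in> Mor \<Lambda>" "src \<Lambda> \<mu> = src \<Lambda> \<nu>"
  shows "S_ap k \<Lambda> \<mu> \<circ> S_ap_adj k \<Lambda> \<nu> \<in> monomials"
  using assms by blast

lemma monomials_bounded: "monomials \<subseteq> bounded_ops X"
  by (auto intro: op_comp S_ap_spec S_ap_adj_bounded)

lemma monomial_basis:
  assumes \<mu>: "\<mu> \<in> Mor \<Lambda>" "\<nu> \<in> Mor \<Lambda>" "src \<Lambda> \<mu> = src \<Lambda> \<nu>" and z: "z \<in> X"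
  shows "(S_ap k \<Lambda> \<mu> \<circ> S_ap_adj k \<Lambda> \<nu>) (\<xi> z) =
    (if starts_with \<nu> z then \<xi> (prepend k \<Lambda> \<mu> (shift k (deg \<Lambda> \<nu>) z)) else 0)"
proof (cases "starts_with \<nu> z")
  case True
  then have "shift k (deg \<Lambda> \<nu>) z \<in> X" by (intro shift_X[OF z]) (simp add: starts_with_def)
  then show ?thesis
    using True \<mu> prng_shift[OF X_paths[OF z] True]
    by (simp add: S_ap_adj_basis[OF \<mu>(2) z] S_ap_spec(2)[OF \<mu>(1)])
next
  case False
  then show ?thesis
    using bounded_ops_zero[OF S_ap_spec(1)[OF \<mu>(1)]] by (simp add: S_ap_adj_basis[OF \<mu>(2) z])
qed

lemma adj_S_ap_basis:
  assumes \<mu>: "\<nu> \<in> Mor \<Lambda>" "\<alpha> \<in> Mor \<Lambda>" and w: "w \<in> X" and s: "src \<Lambda> \<alpha> = prng w"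
  shows "(S_ap_adj k \<Lambda> \<nu> \<circ> S_ap k \<Lambda> \<alpha>) (\<xi> w) =
    (if starts_with \<nu> (prepend k \<Lambda> \<alpha> w) then \<xi> (shift k (deg \<Lambda> \<nu>) (prepend k \<Lambda> \<alpha> w)) else 0)"
  using S_ap_adj_basis[OF \<mu>(1) prepend_X[OF w \<mu>(2) s]] by (simp add: S_ap_spec(2)[OF \<mu>(2) w] s)

section \<open>Products of monomials and the algebra they span\<close>

definition tail :: "'a \<Rightarrow> 'a \<Rightarrow> 'a" where
  "tail \<mu> \<eta> = (SOME \<nu>. \<nu> \<in> Mor \<Lambda> \<and> src \<Lambda> \<mu> = rng \<Lambda> \<nu> \<and> \<eta> = \<mu> \<cdot> \<nu>)"

lemma tail:
  assumes "prefix \<mu> \<eta>"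
  shows "tail \<mu> \<eta> \<in> Mor \<Lambda>" "src \<Lambda> \<mu> = rng \<Lambda> (tail \<mu> \<eta>)" "\<mu> \<cdot> tail \<mu> \<eta> = \<eta>"
    "src \<Lambda> (tail \<mu> \<eta>) = src \<Lambda> \<eta>"
proof -
  have "\<exists>\<nu>. \<nu> \<in> Mor \<Lambda> \<and> src \<Lambda> \<mu> = rng \<Lambda> \<nu> \<and> \<eta> = \<mu> \<cdot> \<nu>" using assms by (auto simp: prefix_def)
  then have *: "tail \<mu> \<eta> \<in> Mor \<Lambda> \<and> src \<Lambda> \<mu> = rng \<Lambda> (tail \<mu> \<eta>) \<and> \<eta> = \<mu> \<cdot> tail \<mu> \<eta>"
    unfolding tail_def by (rule someI_ex)
  then show "tail \<mu> \<eta> \<in> Mor \<Lambda>" "src \<Lambda> \<mu> = rng \<Lambda> (tail \<mu> \<eta>)" "\<mu> \<cdot> tail \<mu> \<eta> = \<eta>" by auto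
  then show "src \<Lambda> (tail \<mu> \<eta>) = src \<Lambda> \<eta>"
    using composites(3)[of \<mu> "tail \<mu> \<eta>"] prefixD(1)[OF assms] by simp
qed

text \<open>On \<open>\<xi>\<^sub>w\<close> at most one summand is nonzero, namely that of the initial segment of \<open>\<alpha>w\<close> of degree \<open>d(\<nu>) \<or> d(\<alpha>)\<close>.\<close>

lemma S_ap_adj_S_ap:
  assumes \<nu>: "\<nu> \<in> Mor \<Lambda>" and \<alpha>: "\<alpha> \<in> Mor \<Lambda>"
  shows "S_ap_adj k \<Lambda> \<nu> \<circ> S_ap k \<Lambda> \<alpha> =
    (\<Sum>\<omega>\<in>MCE \<Lambda> \<nu> \<alpha>. S_ap k \<Lambda> (tail \<nu> \<omega>) \<circ> S_ap_adj k \<Lambda> (tail \<alpha> \<omega>))"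
    (is "?L = (\<Sum>\<omega>\<in>?M. ?R \<omega>)")
proof (rule bounded_ops_eqI)
  have M: "prefix \<nu> \<omega>" "prefix \<alpha> \<omega>" "deg \<Lambda> \<omega> = sup (deg \<Lambda> \<nu>) (deg \<Lambda> \<alpha>)"
    if "\<omega> \<in> ?M" for \<omega>
    using that MCE_iff[OF \<nu> \<alpha>] by auto
  have fin: "finite ?M" using finitely_aligned \<nu> \<alpha> by (simp add: finitely_aligned_def)
  show "?L \<in> bounded_ops X" by (intro op_comp S_ap_spec S_ap_adj_bounded \<nu> \<alpha>)
  show "(\<Sum>\<omega>\<in>?M. ?R \<omega>) \<in> bounded_ops X"
    by (intro sum_bounded_ops op_comp S_ap_spec S_ap_adj_bounded) (auto intro: tail M)
  fix w assume w: "w \<in> X"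
  have wp: "w \<in> paths k \<Lambda>" by (rule X_paths[OF w])
  have R: "?R \<omega> (\<xi> w) = (if starts_with (tail \<alpha> \<omega>) w
      then \<xi> (prepend k \<Lambda> (tail \<nu> \<omega>) (shift k (deg \<Lambda> (tail \<alpha> \<omega>)) w)) else 0)" if "\<omega> \<in> ?M" for \<omega>
    using monomial_basis[OF tail(1)[OF M(1)[OF that]] tail(1)[OF M(2)[OF that]] _ w]
      tail(4)[OF M(1)[OF that]] tail(4)[OF M(2)[OF that]] by simp
  show "?L (\<xi> w) = (\<Sum>\<omega>\<in>?M. ?R \<omega>) (\<xi> w)"
  proof (cases "src \<Lambda> \<alpha> = prng w")
    case False
    have "?L (\<xi> w) = 0"
      using False bounded_ops_zero[OF S_ap_adj_bounded[OF \<nu>]] by (simp add: S_ap_spec(2)[OF \<alpha> w])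
    moreover have "?R \<omega> (\<xi> w) = 0" if \<omega>: "\<omega> \<in> ?M" for \<omega>
    proof -
      have "\<not> starts_with (tail \<alpha> \<omega>) w"
      proof
        assume "starts_with (tail \<alpha> \<omega>) w"
        then have "rng \<Lambda> (tail \<alpha> \<omega>) = prng w" using init_props(4)[OF wp] by (metis starts_with_def)
        then show False using tail(2)[OF M(2)[OF \<omega>]] False by simp
      qed
      then show ?thesis using R[OF \<omega>] by simp
    qed
    ultimately show ?thesis by (simp add: sum_ops_apply)
  next
    case s: True
    define y where "y = prepend k \<Lambda> \<alpha> w"
    note yp = prepend_props[OF wp \<alpha> s, folded y_def]
    have L: "?L (\<xi> w) = (if starts_with \<nu> y then \<xi> (shift k (deg \<Lambda> \<nu>) y) else 0)"
      using adj_S_ap_basis[OF \<nu> \<alpha> w s] by (simp add: y_def)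
    \<comment> \<open>Since \<open>y\<close> is \<open>w\<close> with \<open>\<alpha>\<close>
      prepended, starting with \<open>\<alpha> \<cdot> tail \<alpha> \<omega>\<close> is a condition
      on \<open>w\<close> alone.\<close>
    have st: "starts_with (tail \<alpha> \<omega>) w \<longleftrightarrow> starts_with \<omega> y" if "\<omega> \<in> ?M" for \<omega>
      using starts_with_comp_iff[OF yp(1) \<alpha>, of "tail \<alpha> \<omega>"] tail[OF M(2)[OF that]] yp by simp
    show ?thesis
    proof (cases "starts_with \<nu> y")
      case True
      obtain \<omega> where \<omega>: "\<omega> \<in> ?M" "starts_with \<omega> y"
        using starts_with_common[OF yp(1) True yp(2)] by blast
      note p1 = M(1)[OF \<omega>(1)] and p2 = M(2)[OF \<omega>(1)]
      note t1 = tail[OF p1] and t2 = tail[OF p2]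
      \<comment> \<open>The path left after removing \<open>\<omega>\<close> from \<open>y\<close>
        is reached through \<open>\<nu>\<close> and through \<open>\<alpha>\<close>. Prepending
        \<open>tail \<nu> \<omega>\<close> to it therefore restores what is left after removing
        \<open>\<nu>\<close>.\<close>
      have e1: "shift k (deg \<Lambda> \<omega>) y = shift k (deg \<Lambda> (tail \<nu> \<omega>)) (shift k (deg \<Lambda> \<nu>) y)"
        using shift_comp[OF yp(1) \<nu> t1(1,2)] t1(3) \<omega>(2) by simp
      have e2: "shift k (deg \<Lambda> \<omega>) y = shift k (deg \<Lambda> (tail \<alpha> \<omega>)) w"
        using shift_comp[OF yp(1) \<alpha> t2(1,2)] t2(3) \<omega>(2) yp(3) by simp
      have "starts_with (tail \<nu> \<omega>) (shift k (deg \<Lambda> \<nu>) y)"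
        using starts_with_comp_iff[OF yp(1) \<nu> t1(1,2)] t1(3) \<omega>(2) by simp
      moreover have "shift k (deg \<Lambda> \<nu>) y \<in> paths k \<Lambda>"
        using True shift_props(1)[OF yp(1)] by (simp add: starts_with_def)
      ultimately have "prepend k \<Lambda> (tail \<nu> \<omega>) (shift k (deg \<Lambda> \<omega>) y) = shift k (deg \<Lambda> \<nu>) y"
        using prepend_shift e1 by simp
      then have R\<omega>: "?R \<omega> (\<xi> w) = ?L (\<xi> w)"
        using R[OF \<omega>(1)] st[OF \<omega>(1)] \<omega>(2) e2 L True by simp
      \<comment> \<open>All elements of one \<open>MCE\<close> set have the same degree, and a path
        has only one initial segment of each degree.\<close>
      have "?R \<zeta> (\<xi> w) = 0" if "\<zeta> \<in> ?M - {\<omega>}" for \<zeta>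
      proof -
        have "\<not> starts_with \<zeta> y"
          using that starts_with_same_deg[of \<zeta> y \<omega>] \<omega> M(3) by auto
        then show ?thesis using R st that by simp
      qed
      then have "(\<Sum>\<zeta>\<in>?M. ?R \<zeta> (\<xi> w)) = ?R \<omega> (\<xi> w)"
        using fin \<omega>(1) by (subst sum.remove[of _ \<omega>]) (simp_all add: sum.neutral)
      then show ?thesis using R\<omega> by (simp only: sum_ops_apply)
    next
      case False
      have "?R \<omega> (\<xi> w) = 0" if \<omega>: "\<omega> \<in> ?M" for \<omega>
        using False starts_with_prefix[OF yp(1) _ M(1)[OF \<omega>]] R[OF \<omega>] st[OF \<omega>] by auto
      then show ?thesis using L False by (simp add: sum_ops_apply)
    qed
  qed
qed

text \<open>Expanding the inner product of generators writes the composite as a sum over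
  \<open>\<omega>\<close> of monomials with indices \<open>\<mu> \<cdot> tail \<nu> \<omega>\<close>
  and \<open>\<beta> \<cdot> tail \<alpha> \<omega>\<close>, whose sources both equal that of
  \<open>\<omega>\<close>. The outer factors are moved into the sum by the two span lemmas, one side
  at a time.\<close>

lemma monomials_comp:
  assumes "a \<in> monomials" "b \<in> monomials"
  shows "a \<circ> b \<in> op.span monomials"
proof -
  obtain \<mu> \<nu> where a: "a = S_ap k \<Lambda> \<mu> \<circ> S_ap_adj k \<Lambda> \<nu>"
    and \<mu>: "\<mu> \<in> Mor \<Lambda>" "\<nu> \<in> Mor \<Lambda>" "src \<Lambda> \<mu> = src \<Lambda> \<nu>" using assms(1) by auto
  obtain \<alpha> \<beta> where b: "b = S_ap k \<Lambda> \<alpha> \<circ> S_ap_adj k \<Lambda> \<beta>"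
    and \<alpha>: "\<alpha> \<in> Mor \<Lambda>" "\<beta> \<in> Mor \<Lambda>" "src \<Lambda> \<alpha> = src \<Lambda> \<beta>" using assms(2) by auto
  let ?M = "MCE \<Lambda> \<nu> \<alpha>"
  let ?R = "\<lambda>\<omega>. S_ap k \<Lambda> (tail \<nu> \<omega>) \<circ> S_ap_adj k \<Lambda> (tail \<alpha> \<omega>)"
  have M: "prefix \<nu> \<omega>" "prefix \<alpha> \<omega>" if "\<omega> \<in> ?M" for \<omega>
    using that MCE_iff[OF \<mu>(2) \<alpha>(1)] by auto
  have T: "(S_ap k \<Lambda> \<mu> \<circ> ?R \<omega>) \<circ> S_ap_adj k \<Lambda> \<beta> \<in> op.span monomials" if "\<omega> \<in> ?M" for \<omega>
  proof -
    note t1 = tail[OF M(1)[OF that]] and t2 = tail[OF M(2)[OF that]]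
    have s: "src \<Lambda> \<mu> = rng \<Lambda> (tail \<nu> \<omega>)" "src \<Lambda> \<beta> = rng \<Lambda> (tail \<alpha> \<omega>)"
      using t1(2) t2(2) \<mu>(3) \<alpha>(3) by simp_all
    note c1 = composites[OF \<mu>(1) t1(1) s(1)] and c2 = composites[OF \<alpha>(2) t2(1) s(2)]
    have "(S_ap k \<Lambda> \<mu> \<circ> ?R \<omega>) \<circ> S_ap_adj k \<Lambda> \<beta> =
        (S_ap k \<Lambda> \<mu> \<circ> S_ap k \<Lambda> (tail \<nu> \<omega>)) \<circ> (S_ap_adj k \<Lambda> (tail \<alpha> \<omega>) \<circ> S_ap_adj k \<Lambda> \<beta>)"
      by (simp add: comp_assoc)
    also have "\<dots> = S_ap k \<Lambda> (\<mu> \<cdot> tail \<nu> \<omega>) \<circ> S_ap_adj k \<Lambda> (\<beta> \<cdot> tail \<alpha> \<omega>)"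
      by (simp only: S_ap_comp[OF \<mu>(1) t1(1) s(1)] S_ap_adj_comp[OF \<alpha>(2) t2(1) s(2)])
    also have "\<dots> \<in> monomials"
      using c1(1,3) c2(1,3) t1(4) t2(4) by (intro monomialI) simp_all
    finally show ?thesis by (rule op.span_base)
  qed
  have bdd: "?R ` ?M \<subseteq> bounded_ops X"
    by (auto intro!: op_comp S_ap_spec S_ap_adj_bounded tail M)
  have sp: "S_ap_adj k \<Lambda> \<nu> \<circ> S_ap k \<Lambda> \<alpha> \<in> op.span (?R ` ?M)"
    unfolding S_ap_adj_S_ap[OF \<mu>(2) \<alpha>(1)] by (intro op.span_sum op.span_base) auto
  have "S_ap k \<Lambda> \<mu> \<circ> (S_ap_adj k \<Lambda> \<nu> \<circ> S_ap k \<Lambda> \<alpha>) \<in>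
      op.span ((\<lambda>\<omega>. S_ap k \<Lambda> \<mu> \<circ> ?R \<omega>) ` ?M)"
  proof (rule op_span_comp_left[OF S_ap_spec(1)[OF \<mu>(1)] bdd _ sp])
    fix T assume "T \<in> ?R ` ?M"
    then show "S_ap k \<Lambda> \<mu> \<circ> T \<in> op.span ((\<lambda>\<omega>. S_ap k \<Lambda> \<mu> \<circ> ?R \<omega>) ` ?M)"
      by (elim imageE, intro op.span_base) (simp only: image_eqI)
  qed
  then have "(S_ap k \<Lambda> \<mu> \<circ> (S_ap_adj k \<Lambda> \<nu> \<circ> S_ap k \<Lambda> \<alpha>)) \<circ> S_ap_adj k \<Lambda> \<beta> \<in> op.span monomials"
  proof (rule op_span_comp_right[rotated])
    fix T assume "T \<in> (\<lambda>\<omega>. S_ap k \<Lambda> \<mu> \<circ> ?R \<omega>) ` ?M"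
    then show "T \<circ> S_ap_adj k \<Lambda> \<beta> \<in> op.span monomials"
      by (rule imageE) (simp only: T)
  qed
  then show ?thesis by (simp add: a b comp_assoc)
qed

lemma monomials_adjoint:
  assumes "a \<in> monomials"
  shows "op_adjoint X a \<in> monomials"
proof -
  obtain \<mu> \<nu> where a: "a = S_ap k \<Lambda> \<mu> \<circ> S_ap_adj k \<Lambda> \<nu>"
    and \<mu>: "\<mu> \<in> Mor \<Lambda>" "\<nu> \<in> Mor \<Lambda>" "src \<Lambda> \<mu> = src \<Lambda> \<nu>" using assms by auto
  have "op_adjoint X a = S_ap k \<Lambda> \<nu> \<circ> S_ap_adj k \<Lambda> \<mu>"
    unfolding a S_ap_adj_def
    by (simp only: op_adjoint_comp op_adjoint_bounded_ops op_adjoint_adjoint S_ap_spec(1)[OF \<mu>(1)]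
        S_ap_spec(1)[OF \<mu>(2)])
  then show ?thesis using monomialI[OF \<mu>(2,1) \<mu>(3)[symmetric]] by simp
qed

text \<open>For the vertex \<open>src \<Lambda> \<eta>\<close>, the operator \<open>S_ap_adj\<close>
  is the projection onto the paths with that range, which \<open>S_ap k \<Lambda> \<eta>\<close>
  absorbs.\<close>

lemma S_ap_monomial:
  assumes \<eta>: "\<eta> \<in> Mor \<Lambda>"
  shows "S_ap k \<Lambda> \<eta> \<in> monomials"
proof -
  let ?v = "src \<Lambda> \<eta>"
  note v = identities[OF \<eta>]
  have "S_ap_adj k \<Lambda> ?v (\<xi> x) = (if ?v = prng x then \<xi> x else 0)" if x: "x \<in> X" for x
  proof -
    have xp: "x \<in> paths k \<Lambda>" by (rule X_paths[OF x])
    have "starts_with ?v x \<longleftrightarrow> ?v = prng x" by (auto simp: starts_with_def v prng_def)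
    moreover have "shift k 0 x = x" if "?v = prng x"
      using prepend_props(3)[OF xp v(2)] prepend_identity[OF xp] that v by simp
    ultimately show ?thesis using S_ap_adj_basis[OF v(2) x] v(10) by auto
  qed
  then have "S_ap k \<Lambda> \<eta> \<circ> S_ap_adj k \<Lambda> ?v = S_ap k \<Lambda> \<eta>"
    by (intro bounded_ops_eqI[of _ X] op_comp S_ap_spec(1) S_ap_adj_bounded \<eta> v)
      (simp add: S_ap_spec(2)[OF \<eta>] bounded_ops_zero[OF S_ap_spec(1)[OF \<eta>]])
  then show ?thesis using monomialI[OF \<eta> v(2) v(6)[symmetric]] by simp
qed

text \<open>The closure of the span is one of the algebras being intersected, which gives the upper
  bound; products and adjoints of generators give the lower bound. The former provides the
  approximation in \<open>expectation_diagonal\<close>, the latter lets \<open>\<Phi>\<close> be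
  evaluated on the span.\<close>

lemma Cstar_min_facts:
  shows "cstar_subalgebra X (Cstar_min k \<Lambda>)" "op.span monomials \<subseteq> Cstar_min k \<Lambda>"
    "Cstar_min k \<Lambda> \<subseteq> op_closure X (op.span monomials)"
proof -
  let ?B = "op_closure X (op.span monomials)"
  have B: "cstar_subalgebra X ?B"
    by (rule cstar_subalgebra_closure_span[OF monomials_bounded monomials_comp])
      (assumption | rule op.span_base monomials_adjoint)+
  have "op.span monomials \<subseteq> ?B"
    by (rule op_closure_superset[OF op_span_bounded[OF monomials_bounded]])
  then have "S_ap k \<Lambda> \<eta> \<in> ?B" if "\<eta> \<in> Mor \<Lambda>" for \<eta>
    using op.span_base[OF S_ap_monomial[OF that]] by (rule subsetD)
  then have "S_ap k \<Lambda> ` Mor \<Lambda> \<subseteq> ?B" by (rule image_subsetI)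
  note g = cstar_subalgebra_generated[OF B this, folded Cstar_min_def]
  show "cstar_subalgebra X (Cstar_min k \<Lambda>)" "Cstar_min k \<Lambda> \<subseteq> ?B" by (rule g)+
  have "S_ap k \<Lambda> \<mu> \<circ> S_ap_adj k \<Lambda> \<nu> \<in> Cstar_min k \<Lambda>" if "\<mu> \<in> Mor \<Lambda>" "\<nu> \<in> Mor \<Lambda>" for \<mu> \<nu>
    using g(1,2) that unfolding cstar_subalgebra_def S_ap_adj_def by blast
  then have "monomials \<subseteq> Cstar_min k \<Lambda>" by auto
  then show "op.span monomials \<subseteq> Cstar_min k \<Lambda>"
    using g(1) by (intro op.span_minimal op.subspaceI) (auto simp: cstar_subalgebra_def)
qed

text \<open>This is where aperiodicity of \<open>x\<close> enters: \<open>\<mu>\<sigma>\<^sup>n(x) = x\<close> with \<open>m = d(\<mu>)\<close> forces \<open>\<sigma>\<^sup>m(x) = \<sigma>\<^sup>n(x)\<close>.\<close>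

lemma monomial_diagonal:
  assumes \<mu>: "\<mu> \<in> Mor \<Lambda>" "\<nu> \<in> Mor \<Lambda>" "src \<Lambda> \<mu> = src \<Lambda> \<nu>" "\<mu> \<noteq> \<nu>" and x: "x \<in> X"
  shows "(S_ap k \<Lambda> \<mu> \<circ> S_ap_adj k \<Lambda> \<nu>) (\<xi> x) x = 0"
proof (cases "starts_with \<nu> x")
  case True
  have xp: "x \<in> paths k \<Lambda>" by (rule X_paths[OF x])
  have n: "enatv (deg \<Lambda> \<nu>) \<le> pdeg x" using True by (simp add: starts_with_def)
  let ?w = "shift k (deg \<Lambda> \<nu>) x"
  have "prepend k \<Lambda> \<mu> ?w \<noteq> x"
  proof
    assume e: "prepend k \<Lambda> \<mu> ?w = x"
    have "src \<Lambda> \<mu> = prng ?w" using prng_shift[OF xp True] \<mu>(3) by simp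
    note p = prepend_props[OF shift_props(1)[OF xp n] \<mu>(1) this, unfolded e]
    have "deg \<Lambda> \<mu> = deg \<Lambda> \<nu>"
      using x p n unfolding aperiodic_iff starts_with_def by blast
    then show False using starts_with_same_deg[OF p(2) True] \<mu>(4) by simp
  qed
  then show ?thesis using monomial_basis[OF \<mu>(1-3) x] True by (simp add: basis_vec_def)
next
  case False
  then show ?thesis using monomial_basis[OF \<mu>(1-3) x] by (simp add: zero_fun_apply)
qed

lemma expectation_diagonal:
  assumes ce: "conditional_expectation X (Cstar_min k \<Lambda>) (Diag_min k \<Lambda>) \<Phi>"
    and \<Phi>: "\<And>\<mu> \<nu>. \<mu> \<in> Mor \<Lambda> \<Longrightarrow> \<nu> \<in> Mor \<Lambda> \<Longrightarrow> src \<Lambda> \<mu> = src \<Lambda> \<nu> \<Longrightarrow>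
           \<Phi> (S_ap k \<Lambda> \<mu> \<circ> S_ap_adj k \<Lambda> \<nu>) = (if \<mu> = \<nu> then P_ap k \<Lambda> \<mu> else 0)"
    and a: "a \<in> Cstar_min k \<Lambda>" and x: "x \<in> X"
  shows "\<Phi> a (\<xi> x) x = a (\<xi> x) x"
proof -
  let ?A = "Cstar_min k \<Lambda>"
  have A: "cstar_subalgebra X ?A" and L: "op.span monomials \<subseteq> ?A"
    and AB: "?A \<subseteq> op_closure X (op.span monomials)"
    by (fact Cstar_min_facts)+
  have add: "b \<in> ?A \<Longrightarrow> c \<in> ?A \<Longrightarrow> \<Phi> (b + c) = \<Phi> b + \<Phi> c"
    and scale: "b \<in> ?A \<Longrightarrow> \<Phi> (op_scale t b) = op_scale t (\<Phi> b)"
    and contr: "b \<in> ?A \<Longrightarrow> op_norm X (\<Phi> b) \<le> op_norm X b"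
    and bdd: "b \<in> ?A \<Longrightarrow> \<Phi> b \<in> bounded_ops X" for b c t
    using ce unfolding conditional_expectation_def Diag_min_def op_closure_def by auto
  have Ab: "?A \<subseteq> bounded_ops X" using A by (simp add: cstar_subalgebra_def)
  have Aadd: "b \<in> ?A \<Longrightarrow> c \<in> ?A \<Longrightarrow> b + c \<in> ?A" and Ascale: "b \<in> ?A \<Longrightarrow> op_scale t b \<in> ?A" for b c t
    using A by (auto simp: cstar_subalgebra_def)
  have span: "\<Phi> b (\<xi> x) x = b (\<xi> x) x" if "b \<in> op.span monomials" for b
  proof -
    \<comment> \<open>Linearity of \<open>\<Phi>\<close> is available on \<open>Cstar_min\<close>
      only, so membership is carried through the induction.\<close>
    have "b \<in> ?A \<and> \<Phi> b (\<xi> x) x = b (\<xi> x) x"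
      using that
    proof (induction rule: op.span_induct_alt)
      case base
      have 0: "0 \<in> ?A" using A by (simp add: cstar_subalgebra_def)
      have "\<Phi> 0 + \<Phi> 0 = \<Phi> 0" using add[OF 0 0] by simp
      then have "\<Phi> 0 = 0" by simp
      then have "\<Phi> 0 (\<xi> x) x = (0 :: 'a path operator) (\<xi> x) x" by simp
      then show ?case using 0 by blast
    next
      case (step t g b)
      obtain \<mu> \<nu> where g: "g = S_ap k \<Lambda> \<mu> \<circ> S_ap_adj k \<Lambda> \<nu>"
        and \<mu>: "\<mu> \<in> Mor \<Lambda>" "\<nu> \<in> Mor \<Lambda>" "src \<Lambda> \<mu> = src \<Lambda> \<nu>" using step(1) by auto
      have gA: "g \<in> ?A" using L op.span_base[OF step(1)] by blast
      \<comment> \<open>For equal indices \<open>\<Phi>\<close> fixes the monomial; for distinct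
        ones both entries are 0.\<close>
      have "\<Phi> g (\<xi> x) x = g (\<xi> x) x"
        using \<Phi>[OF \<mu>] monomial_diagonal[OF \<mu> _ x] by (auto simp: g P_ap_def zero_fun_apply)
      then have "\<Phi> (op_scale t g + b) (\<xi> x) x = (op_scale t g + b) (\<xi> x) x"
        using add[OF Ascale[OF gA]] scale[OF gA] step(2) by (simp add: op_scale_def plus_fun_apply)
      moreover have "op_scale t g + b \<in> ?A" using Aadd Ascale gA step(2) by blast
      ultimately show ?case by blast
    qed
    then show ?thesis ..
  qed
  \<comment> \<open>A diagonal entry is a functional of norm at most 1, so it survives norm
    limits.\<close>
  have entry: "cmod (T (\<xi> x) x) \<le> op_norm X T" if T: "T \<in> bounded_ops X" for T
    using cmod_le_ell2_norm[OF bounded_ops_ell2[OF T basis_vec_ell2[OF x]], of x]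
      ell2_norm_apply_le[OF T basis_vec_ell2[OF x]] by (simp add: ell2_norm_basis_vec[OF x])
  have "cmod (\<Phi> a (\<xi> x) x - a (\<xi> x) x) \<le> \<epsilon>" if \<epsilon>: "\<epsilon> > 0" for \<epsilon>
  proof -
    \<comment> \<open>The error \<open>a - b\<close> is counted twice, once directly and once
      through the contraction \<open>\<Phi>\<close>.\<close>
    obtain b where b: "b \<in> op.span monomials" "op_norm X (a - b) < \<epsilon> / 2"
      using op_closureE[of a X "op.span monomials" "\<epsilon> / 2"] a AB \<epsilon> by auto
    have bA: "b \<in> ?A" using b L by auto
    define c where "c = a - b"
    have "c = a + op_scale (-1) b" by (simp add: c_def op_scale_def fun_eq_iff pointwise)
    then have c: "c \<in> ?A" using Aadd[OF a Ascale[OF bA]] by metis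
    have ac: "a = c + b" by (simp add: c_def)
    have "\<Phi> a (\<xi> x) x - a (\<xi> x) x = \<Phi> c (\<xi> x) x - c (\<xi> x) x"
      using add[OF c bA] span[OF b(1)] by (simp add: ac plus_fun_apply)
    also have "cmod \<dots> \<le> cmod (\<Phi> c (\<xi> x) x) + cmod (c (\<xi> x) x)" by (rule norm_triangle_ineq4)
    also have "\<dots> \<le> op_norm X c + op_norm X c"
      using entry[OF bdd[OF c]] contr[OF c] entry[of c] c Ab by fastforce
    also have "\<dots> \<le> \<epsilon>" using b(2) by (simp add: c_def)
    finally show ?thesis .
  qed
  then have "cmod (\<Phi> a (\<xi> x) x - a (\<xi> x) x) \<le> 0" by (rule field_le_epsilon) simp
  then show ?thesis by simp
qed

end

theorem lemma3p10:
  fixes k :: nat and \<Lambda> :: "'a graded_category"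
    and \<Phi> :: "'a path operator \<Rightarrow> 'a path operator"
  assumes "kgraph k \<Lambda>" and "finitely_aligned \<Lambda>" and "aperiodic \<Lambda>"
    and "conditional_expectation (aperiodic_boundary_paths k \<Lambda>) (Cstar_min k \<Lambda>) (Diag_min k \<Lambda>) \<Phi>"
    and "\<And>\<mu> \<nu>. \<mu> \<in> Mor \<Lambda> \<Longrightarrow> \<nu> \<in> Mor \<Lambda> \<Longrightarrow> src \<Lambda> \<mu> = src \<Lambda> \<nu> \<Longrightarrow>
           \<Phi> (S_ap k \<Lambda> \<mu> \<circ> S_ap_adj k \<Lambda> \<nu>) = (if \<mu> = \<nu> then P_ap k \<Lambda> \<mu> else 0)"
    and "a \<in> Cstar_min k \<Lambda>" and "op_positive (aperiodic_boundary_paths k \<Lambda>) a"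
    and "\<Phi> a = 0"
  shows "a = 0"
proof -
  interpret finitely_aligned_kgraph k \<Lambda> by unfold_locales (fact assms)+
  have "a \<in> bounded_ops X"
    using assms(6) Cstar_min_facts(1) by (auto simp: cstar_subalgebra_def)
  then show ?thesis
    using assms(7)
  proof (rule op_positive_zero_diagonal)
    fix x assume "x \<in> X"
    then show "a (\<xi> x) x = 0"
      using expectation_diagonal[OF assms(4,5,6) \<open>x \<in> X\<close>] unfolding assms(8) zero_fun_apply by metis
  qed
qed

end
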